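(* Let $\Bbbk$ be a field. Let $\mathcal{Y}\mathit{Sym}$ be the Loday-Ronco Hopf algebra of planar binary trees over $\Bbbk$ with its monomial basis $\{M_t\}$, let $\mathrm{gr}(\mathcal{Y}\mathit{Sym})$ be the Hopf algebra associated to its coradical filtration, and let $\mathrm{gr}(\mathcal{Y}\mathit{Sym})^*$ be its graded dual with respect to the grading by number of internal nodes, with dual basis $\{M_t^*\}$. Let $\mathcal{H}_O$ be the Grossman-Larson Hopf algebra of ordered trees over $\Bbbk$, graded by one less than the number of nodes. Then there is an isomorphism of graded Hopf algebras $$\Psi:\mathrm{gr}(\mathcal{Y}\mathit{Sym})^*\to\mathcal{H}_O$$ uniquely determined by $$\Psi(M_t^* )=\psi(t)$$ for all $\backslash$-irreducible planar binary trees $t$, where $\psi$ is the bijection from planar binary trees to ordered trees described in the context.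
   Context: **Planar binary trees.** A planar binary tree is either $|$ (one leaf, no internal node) or $l\vee r$, a root node with left subtree $l$ and right subtree $r$ (planar binary trees). Let $Y_n$ be the set of those with $n$ internal nodes (equivalently $n+1$ leaves). For planar binary trees $s,t$, $s\backslash t$ is obtained by identifying the right-most leaf of $s$ with the root of $t$ (so $|\backslash t=t$ and $(l\vee r)\backslash t=l\vee(r\backslash t)$). This is associative with unit $|$. A tree $t\neq |$ is $\backslash$-irreducible if it is not of the form $t_1\backslash t_2$ with $t_1,t_2\ne |$; equivalently $t=t'\vee |$ for some $t'$. Every $t$ has a unique decomposition $t=t_1\backslash\cdots\backslash t_k$ with all $t_i$ $\backslash$-irreducible; $k$ is the number of irreducible components of $t$ ($k=0$ for $t=|$). **The Hopf algebra $\mathcal{Y}\mathit{Sym}$.** It has a linear basis $F_t$ indexed by all planar binary trees. Splittings of a tree $t$ at its leaves into ordered pairs: $|$ has the single splitting $(|,|)$; the splittings of $l\vee r$ are the pairs $(l_0,\,l_1\vee r)$ for each splitting $(l_0,l_1)$ of $l$ and the pairs $(l\vee r_0,\,r_1)$ for each splitting $(r_0,r_1)$ of $r$. So a tree with $n+1$ leaves has $n+1$ splittings (one per leaf). The coproduct is $\Delta(F_t)=\sum F_{t_0}\otimes F_{t_1}$ over all splittings $(t_0,t_1)$ of $t$. For $t\in Y_q$, the product is $F_s\cdot F_t=\sum F_{(s_0,\dots,s_q)/t}$, summed (with multiplicity) over all terms $F_{s_0}\otimes\cdots\otimes F_{s_q}$ of the iterated coproduct $\Delta^{(q)}(F_s)$,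 where $(s_0,\dots,s_q)/t$ is obtained by attaching the root of $s_i$ to the $i$-th leaf of $t$ (leaves numbered $0,\dots,q$ from left to right). The unit is $F_|$ and the counit is the coefficient of $F_|$. It is a Hopf algebra graded by the number of internal nodes. The Tamari order on $Y_n$ is the partial order generated by $t\le t'$ whenever $t'$ is obtained from $t$ by replacing a subtree of the form $(a\vee b)\vee c$ by $a\vee(b\vee c)$. With $\mu$ the Möbius function of this poset, the monomial basis is $M_t:=\sum_{s\ge t}\mu(t,s)F_s$ (sum over $s\in Y_n$, for $t\in Y_n$). **Coradical filtration and associated graded.** For a Hopf algebra $H$ which is connected as a coalgebra, $F^0(H)=\Bbbk\cdot 1$, and $F^k(H)$ consists of those $h\in H$ such that every term of $\Delta^{(k)}(h)\in H^{\otimes(k+1)}$ has a tensor factor from $F^0(H)$, i.e. $\Delta^{(k)}(h)\in\sum_{i=0}^{k}H^{\otimes i}\otimes F^0(H)\otimes H^{\otimes(k-i)}$. Then $\mathrm{gr}(H)=\bigoplus_{k\ge0}F^k(H)/F^{k-1}(H)$ (with $F^{-1}(H)=0$), with the induced product and coproduct, is a Hopf algebra. Known facts: $\mathcal{Y}\mathit{Sym}$ is a cofree graded coalgebra, with $\Delta(M_t)=\sum_{t=r\backslash s}M_r\otimes M_s$; $F^k(\mathcal{Y}\mathit{Sym})$ is spanned by the $M_t$ for which $t$ has at most $k$ irreducible components. Hence the classes of the $M_t$ (in $F^k/F^{k-1}$, $k$ the number of irreducible components of $t$), still denoted $M_t$, form a basis of $\mathrm{gr}(\mathcal{Y}\mathit{Sym})$.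 $\mathrm{gr}(\mathcal{Y}\mathit{Sym})$ is a graded Hopf algebra with finite-dimensional components for the grading in which $M_t$, $t\in Y_n$, has degree $n$; its graded dual is taken with respect to this grading, and $\{M_t^*\}$ is the basis dual to $\{M_t\}$. **Ordered trees and $\mathcal{H}_O$.** An ordered tree is a finite rooted tree with a linear (left-to-right) order on the children of each node. $x\backslash y$ is obtained by identifying the roots of $x$ and $y$, with the nodes of $x$ to the left of those of $y$. An ordered tree is planted if its root has exactly one child. Every ordered tree is uniquely $x=x_1\backslash\cdots\backslash x_k$ with $x_i$ planted (its planted components). $\mathrm{Nod}(y)$ is the set of nodes of $y$ (root included). For $f:[k]=\{1,\dots,k\}\to\mathrm{Nod}(y)$, $x\,\#_f\,y$ is the ordered tree obtained by identifying the root of each $x_i$ with the node $f(i)$ of $y$, keeping the order of the components of $x$ attached to the same node and placing them to the left of the children of that node in $y$. For $S=\{i_1<\cdots<i_p\}\subseteq[k]$, $x_S:=x_{i_1}\backslash\cdots\backslash x_{i_p}$, and $S^c=[k]\setminus S$. $\mathcal{H}_O$ is the vector space with basis the ordered trees, with $$x\cdot y=\sum_{f:[k]\to\mathrm{Nod}(y)}x\,\#_f\,y,\qquad \Delta(x)=\sum_{S\subseteq[k]}x_S\otimes x_{S^c}.$$ It is a graded Hopf algebra, the degree being one less than the number of nodes; the unit is the one-node tree. **The bijection $\psi$** from planar binary trees with $n$ leaves to ordered trees with $n$ nodes: $\psi(|)$ is the one-node tree; $\psi(t'\vee |)$ is the planted tree obtained by adding a new root below $\psi(t')$ (the old root becomes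 the only child of the new root); and $\psi(t_1\backslash\cdots\backslash t_k)=\psi(t_1)\backslash\cdots\backslash\psi(t_k)$ for the decomposition into $\backslash$-irreducible trees. *)

theory Defs
  imports Complex_Main "HOL-Library.Poly_Mapping" "HOL-Library.FuncSet"
begin

section \<open>Free vector spaces and tensor products\<close>

text \<open>\<open>'b \<Rightarrow>\<^sub>0 'k\<close> is the \<open>'k\<close>-vector space with basis \<open>single b 1\<close>.\<close>

definition fscale :: "'k::field \<Rightarrow> ('b \<Rightarrow>\<^sub>0 'k) \<Rightarrow> ('b \<Rightarrow>\<^sub>0 'k)" where
  "fscale c x = Poly_Mapping.map ((*) c) x"

lemma lookup_fscale [simp]: "Poly_Mapping.lookup (fscale c x) b = c * Poly_Mapping.lookup x b"
  by (simp add: fscale_def Poly_Mapping.map.rep_eq when_def)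

interpretation fvs: vector_space "fscale :: 'k::field \<Rightarrow> ('b \<Rightarrow>\<^sub>0 'k) \<Rightarrow> _"
  by standard (auto intro!: poly_mapping_eqI simp: lookup_add algebra_simps)

definition linext :: "('a \<Rightarrow> ('b \<Rightarrow>\<^sub>0 'k)) \<Rightarrow> ('a \<Rightarrow>\<^sub>0 'k::field) \<Rightarrow> ('b \<Rightarrow>\<^sub>0 'k)" where
  "linext f x = (\<Sum>a\<in>Poly_Mapping.keys x. fscale (Poly_Mapping.lookup x a) (f a))"

definition bilinext ::
  "('a \<Rightarrow> 'b \<Rightarrow> ('c \<Rightarrow>\<^sub>0 'k)) \<Rightarrow> ('a \<Rightarrow>\<^sub>0 'k::field) \<Rightarrow> ('b \<Rightarrow>\<^sub>0 'k) \<Rightarrow> ('c \<Rightarrow>\<^sub>0 'k)" where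
  "bilinext f x y = linext (\<lambda>a. linext (f a) y) x"

lemma linext_superset:
  assumes "finite A" "Poly_Mapping.keys x \<subseteq> A"
  shows "linext f x = (\<Sum>a\<in>A. fscale (Poly_Mapping.lookup x a) (f a))"
  unfolding linext_def using assms
  by (intro sum.mono_neutral_left) (auto simp: in_keys_iff)

lemma linext_add: "linext f (x + y) = linext f x + linext f y"
proof -
  let ?A = "Poly_Mapping.keys x \<union> Poly_Mapping.keys y"
  have "linext f (x + y) = (\<Sum>a\<in>?A. fscale (Poly_Mapping.lookup (x + y) a) (f a))"
    by (intro linext_superset) (auto simp: keys_add)
  also have "\<dots> = linext f x + linext f y"
    by (simp add: linext_superset[of ?A] lookup_add fvs.scale_left_distrib sum.distrib)
  finally show ?thesis .
qed

lemma linext_fscale: "linext f (fscale c x) = fscale c (linext f x)"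
proof -
  have "linext f (fscale c x) = (\<Sum>a\<in>Poly_Mapping.keys x. fscale (Poly_Mapping.lookup (fscale c x) a) (f a))"
    by (intro linext_superset) (auto simp: in_keys_iff)
  then show ?thesis
    by (simp add: linext_def fvs.scale_sum_right)
qed

lemma linext_single: "linext f (Poly_Mapping.single a 1) = f a"
  by (simp add: linext_def)

text \<open>
  The tensor product of two vector spaces, with scalar multiplications \<open>sa\<close> and \<open>sb\<close>, is the
  quotient of the free vector space on pairs (the pair \<open>(a, b)\<close> standing for the pure tensor of
  \<open>a\<close> and \<open>b\<close>) by the bilinearity relations. We work with representatives, compared by
  \<open>tensor_eq\<close>.
\<close>

definition tensor_relations ::
  "('k::field \<Rightarrow> 'a::ab_group_add \<Rightarrow> 'a) \<Rightarrow> ('k \<Rightarrow> 'b::ab_group_add \<Rightarrow> 'b) \<Rightarrow> ('a \<times> 'b \<Rightarrow>\<^sub>0 'k) set"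
where
  "tensor_relations sa sb =
     {Poly_Mapping.single (a + a', b) 1 - Poly_Mapping.single (a, b) 1
        - Poly_Mapping.single (a', b) 1 | a a' b. True}
   \<union> {Poly_Mapping.single (a, b + b') 1 - Poly_Mapping.single (a, b) 1
        - Poly_Mapping.single (a, b') 1 | a b b'. True}
   \<union> {Poly_Mapping.single (sa c a, b) 1 - Poly_Mapping.single (a, b) c | c a b. True}
   \<union> {Poly_Mapping.single (a, sb c b) 1 - Poly_Mapping.single (a, b) c | c a b. True}"

definition tensor_eq ::
  "('k::field \<Rightarrow> 'a::ab_group_add \<Rightarrow> 'a) \<Rightarrow> ('k \<Rightarrow> 'b::ab_group_add \<Rightarrow> 'b)
     \<Rightarrow> ('a \<times> 'b \<Rightarrow>\<^sub>0 'k) \<Rightarrow> ('a \<times> 'b \<Rightarrow>\<^sub>0 'k) \<Rightarrow> bool" where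
  "tensor_eq sa sb u v \<longleftrightarrow> u - v \<in> fvs.span (tensor_relations sa sb)"

definition tensor_map :: "('a \<Rightarrow> 'c) \<Rightarrow> ('b \<Rightarrow> 'd) \<Rightarrow> ('a \<times> 'b \<Rightarrow>\<^sub>0 'k::field) \<Rightarrow> ('c \<times> 'd \<Rightarrow>\<^sub>0 'k)" where
  "tensor_map f g = linext (\<lambda>(a, b). Poly_Mapping.single (f a, g b) 1)"

definition tensor_pair :: "('a \<Rightarrow> 'k) \<Rightarrow> ('b \<Rightarrow> 'k) \<Rightarrow> ('a \<times> 'b \<Rightarrow>\<^sub>0 'k::field) \<Rightarrow> 'k" where
  "tensor_pair f g T = (\<Sum>(a, b)\<in>Poly_Mapping.keys T. Poly_Mapping.lookup T (a, b) * (f a * g b))"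

section \<open>Structure maps and isomorphisms of graded Hopf algebras\<close>

text \<open>
  \<open>comul x\<close> is a representative of the coproduct in the tensor square, see \<open>tensor_eq\<close>;
  \<open>homog n\<close> is the homogeneous component of degree \<open>n\<close>.
\<close>

record (overloaded) ('k, 'v) hopf =
  scal :: "'k \<Rightarrow> 'v \<Rightarrow> 'v"
  mul :: "'v \<Rightarrow> 'v \<Rightarrow> 'v"
  unit :: 'v
  comul :: "'v \<Rightarrow> ('v \<times> 'v \<Rightarrow>\<^sub>0 'k)"
  counit :: "'v \<Rightarrow> 'k"
  homog :: "nat \<Rightarrow> 'v set"

text \<open>
  The antipode is not mentioned: it is determined by the bialgebra structure, and a bialgebra
  map between Hopf algebras commutes with the antipodes.
\<close>

definition graded_hopf_iso ::
  "('k::field, 'v::ab_group_add) hopf \<Rightarrow> ('k, 'w::ab_group_add) hopf \<Rightarrow> ('v \<Rightarrow> 'w) \<Rightarrow> bool" where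
  "graded_hopf_iso A B f \<longleftrightarrow>
     Vector_Spaces.linear (scal A) (scal B) f \<and> bij f \<and>
     (\<forall>x y. f (mul A x y) = mul B (f x) (f y)) \<and>
     f (unit A) = unit B \<and>
     (\<forall>x. tensor_eq (scal B) (scal B) (tensor_map f f (comul A x)) (comul B (f x))) \<and>
     (\<forall>x. counit B (f x) = counit A x) \<and>
     (\<forall>n. f ` homog A n = homog B n)"

section \<open>Planar binary trees\<close>

datatype pbt = Leaf | Node pbt pbt

primrec nodes :: "pbt \<Rightarrow> nat" where
  "nodes Leaf = 0"
| "nodes (Node l r) = Suc (nodes l + nodes r)"

text \<open>\<open>s\<close> backslash \<open>t\<close>: the root of \<open>t\<close> is identified with the right-most leaf of \<open>s\<close>.\<close>

primrec bslash :: "pbt \<Rightarrow> pbt \<Rightarrow> pbt" where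
  "bslash Leaf t = t"
| "bslash (Node l r) t = Node l (bslash r t)"

definition bs_irreducible :: "pbt \<Rightarrow> bool" where
  "bs_irreducible t \<longleftrightarrow>
     t \<noteq> Leaf \<and> \<not> (\<exists>t1 t2. t1 \<noteq> Leaf \<and> t2 \<noteq> Leaf \<and> t = bslash t1 t2)"

text \<open>
  The number of irreducible components. As \<open>Node l r = bslash (Node l Leaf) r\<close> with
  \<open>Node l Leaf\<close> irreducible, the components of \<open>Node l r\<close> are \<open>Node l Leaf\<close> followed by those
  of \<open>r\<close>; see \<open>ncomp_eq_length\<close>.
\<close>

primrec ncomp :: "pbt \<Rightarrow> nat" where
  "ncomp Leaf = 0"
| "ncomp (Node l r) = Suc (ncomp r)"

lemma bslash_Leaf [simp]: "bslash t Leaf = t"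
  by (induction t) auto

lemma bslash_assoc: "bslash (bslash r s) t = bslash r (bslash s t)"
  by (induction r) auto

lemma bs_irreducible_iff: "bs_irreducible t \<longleftrightarrow> (\<exists>t'. t = Node t' Leaf)"
proof
  assume irr: "bs_irreducible t"
  show "\<exists>t'. t = Node t' Leaf"
  proof (cases t)
    case Leaf
    with irr show ?thesis by (simp add: bs_irreducible_def)
  next
    case (Node l r)
    then have "t = bslash (Node l Leaf) r" by simp
    with irr have "r = Leaf" by (metis bs_irreducible_def pbt.distinct(1))
    with Node show ?thesis by blast
  qed
next
  assume "\<exists>t'. t = Node t' Leaf"
  then obtain t' where t: "t = Node t' Leaf" by blast
  have "t2 = Leaf" if "t1 \<noteq> Leaf" "t = bslash t1 t2" for t1 t2
  proof (cases t1)
    case (Node a b)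
    with that t have "bslash b t2 = Leaf" by simp
    then show ?thesis by (cases b) auto
  qed (use that in simp)
  then show "bs_irreducible t" using t by (auto simp: bs_irreducible_def)
qed

lemma ncomp_bslash [simp]: "ncomp (bslash s t) = ncomp s + ncomp t"
  by (induction s) auto

lemma ncomp_eq_length:
  "(\<forall>t\<in>set ts. bs_irreducible t) \<Longrightarrow> ncomp (foldr bslash ts Leaf) = length ts"
  by (induction ts) (auto simp: bs_irreducible_iff)

section \<open>The Hopf algebra YSym\<close>

type_synonym 'k ysym = "pbt \<Rightarrow>\<^sub>0 'k"

abbreviation fund :: "pbt \<Rightarrow> 'k::field ysym" where
  "fund t \<equiv> Poly_Mapping.single t 1"

primrec splits :: "pbt \<Rightarrow> (pbt \<times> pbt) list" where
  "splits Leaf = [(Leaf, Leaf)]"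
| "splits (Node l r) =
     map (\<lambda>(l0, l1). (l0, Node l1 r)) (splits l) @ map (\<lambda>(r0, r1). (Node l r0, r1)) (splits r)"

text \<open>The terms of the \<open>q\<close>-fold iterated coproduct; these are lists of length \<open>q + 1\<close>.\<close>

primrec iter_splits :: "nat \<Rightarrow> pbt \<Rightarrow> pbt list list" where
  "iter_splits 0 t = [[t]]"
| "iter_splits (Suc q) t = concat (map (\<lambda>(t0, t1). map ((#) t0) (iter_splits q t1)) (splits t))"

text \<open>\<open>graft ss t\<close> attaches the root of the \<open>i\<close>-th entry of \<open>ss\<close> to the \<open>i\<close>-th leaf of \<open>t\<close>.\<close>

fun graft :: "pbt list \<Rightarrow> pbt \<Rightarrow> pbt" where
  "graft ss Leaf = hd ss"
| "graft ss (Node l r) =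
     Node (graft (take (nodes l + 1) ss) l) (graft (drop (nodes l + 1) ss) r)"

text \<open>
  Since YSym has the basis \<open>fund\<close>, its tensor powers are modelled directly as free vector spaces
  on pairs, resp. on lists of fixed length, of trees.
\<close>

definition ysym_tensor :: "'k::field ysym \<Rightarrow> 'k ysym \<Rightarrow> (pbt \<times> pbt \<Rightarrow>\<^sub>0 'k)" where
  "ysym_tensor = bilinext (\<lambda>s t. Poly_Mapping.single (s, t) 1)"

definition ysym_comul :: "'k::field ysym \<Rightarrow> (pbt \<times> pbt \<Rightarrow>\<^sub>0 'k)" where
  "ysym_comul = linext (\<lambda>t. \<Sum>p\<leftarrow>splits t. Poly_Mapping.single p 1)"

definition ysym_iter_comul :: "nat \<Rightarrow> 'k::field ysym \<Rightarrow> (pbt list \<Rightarrow>\<^sub>0 'k)" where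
  "ysym_iter_comul k = linext (\<lambda>t. \<Sum>w\<leftarrow>iter_splits k t. Poly_Mapping.single w 1)"

definition ysym_mul :: "'k::field ysym \<Rightarrow> 'k ysym \<Rightarrow> 'k ysym" where
  "ysym_mul = bilinext (\<lambda>s t. \<Sum>w\<leftarrow>iter_splits (nodes t) s. fund (graft w t))"

definition ysym_counit :: "'k::field ysym \<Rightarrow> 'k" where
  "ysym_counit x = Poly_Mapping.lookup x Leaf"

subsection \<open>Tamari order and monomial basis\<close>

inductive tamari_step :: "pbt \<Rightarrow> pbt \<Rightarrow> bool" where
  rotate: "tamari_step (Node (Node a b) c) (Node a (Node b c))"
| left: "tamari_step l l' \<Longrightarrow> tamari_step (Node l r) (Node l' r)"
| right: "tamari_step r r' \<Longrightarrow> tamari_step (Node l r) (Node l r')"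

abbreviation tamari :: "pbt \<Rightarrow> pbt \<Rightarrow> bool" where
  "tamari \<equiv> tamari_step\<^sup>*\<^sup>*"

text \<open>A statistic that increases along the Tamari order.\<close>

primrec tamari_rank :: "pbt \<Rightarrow> nat" where
  "tamari_rank Leaf = 0"
| "tamari_rank (Node l r) = tamari_rank l + tamari_rank r + nodes r"

lemma tamari_step_nodes: "tamari_step s t \<Longrightarrow> nodes s = nodes t"
  by (induction rule: tamari_step.induct) auto

lemma tamari_step_rank: "tamari_step s t \<Longrightarrow> tamari_rank s < tamari_rank t"
  by (induction rule: tamari_step.induct) (auto dest: tamari_step_nodes)

lemma tamari_rank_less: "tamari s t \<Longrightarrow> s \<noteq> t \<Longrightarrow> tamari_rank s < tamari_rank t"
  by (induction rule: rtranclp_induct)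
     (auto dest: tamari_step_rank intro: less_trans)

function tamari_mu :: "pbt \<Rightarrow> pbt \<Rightarrow> int" where
  "tamari_mu t s =
     (if t = s then 1
      else if tamari t s then - (\<Sum>u\<in>{u. tamari t u \<and> tamari u s \<and> u \<noteq> s}. tamari_mu t u)
      else 0)"
  by auto
termination
  by (relation "measure (\<lambda>(t, s). tamari_rank s)") (auto intro: tamari_rank_less)

declare tamari_mu.simps [simp del]

definition mono_basis :: "pbt \<Rightarrow> 'k::field ysym" where
  "mono_basis t = (\<Sum>s\<in>{s. tamari t s}. fscale (of_int (tamari_mu t s)) (fund s))"

section \<open>Coradical filtration and associated graded\<close>

text \<open>
  \<open>F\<^sup>0\<close> is spanned by \<open>fund Leaf\<close>, so the sum over \<open>i\<close> of the subspaces of \<open>H\<^sup>\<otimes>\<^sup>(\<^sup>k\<^sup>+\<^sup>1\<^sup>)\<close> with \<open>i\<close>-th factor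
  in \<open>F\<^sup>0\<close> is spanned by the words with \<open>Leaf\<close> in position \<open>i\<close>, for some \<open>i \<le> k\<close>. For \<open>k = 0\<close>
  this gives \<open>F\<^sup>0\<close> again.
\<close>

definition corad :: "nat \<Rightarrow> 'k::field ysym set" where
  "corad k = {h. ysym_iter_comul k h \<in>
     fvs.span (\<Union>i\<le>k. {Poly_Mapping.single (u @ [Leaf] @ v) 1 | u v.
                          length u = i \<and> length v = k - i})}"

definition corad_below :: "nat \<Rightarrow> 'k::field ysym set" where
  "corad_below k = (if k = 0 then {0} else corad (k - 1))"

lemma subspace_corad: "fvs.subspace (corad k)"
proof (rule fvs.subspaceI)
  show "0 \<in> corad k"
    by (simp add: corad_def ysym_iter_comul_def linext_def fvs.span_zero)
qed (simp_all add: corad_def ysym_iter_comul_def linext_add linext_fscale fvs.span_add fvs.span_scale)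

lemma subspace_corad_below: "fvs.subspace (corad_below k)"
  by (simp add: corad_below_def subspace_corad fvs.subspace_single_0)

text \<open>
  The direct sum of the quotients \<open>F\<^sup>k / F\<^sup>k\<^sup>-\<^sup>1\<close>: finitely supported sequences \<open>x\<close> with \<open>x\<^sub>k \<in> F\<^sup>k\<close>,
  modulo sequences with \<open>x\<^sub>k \<in> F\<^sup>k\<^sup>-\<^sup>1\<close>.
\<close>

definition gr_rel :: "(nat \<Rightarrow>\<^sub>0 'k::field ysym) \<Rightarrow> (nat \<Rightarrow>\<^sub>0 'k ysym) \<Rightarrow> bool" where
  "gr_rel x y \<longleftrightarrow>
     (\<forall>k. Poly_Mapping.lookup x k \<in> corad k \<and> Poly_Mapping.lookup y k \<in> corad k \<and> Poly_Mapping.lookup x k - Poly_Mapping.lookup y k \<in> corad_below k)"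

quotient_type (overloaded) 'k gr = "nat \<Rightarrow>\<^sub>0 'k::field ysym" / partial: gr_rel
proof (rule part_equivpI)
  show "\<exists>x. gr_rel x x"
    by (rule exI[of _ 0])
       (simp add: gr_rel_def fvs.subspace_0[OF subspace_corad] fvs.subspace_0[OF subspace_corad_below])
  show "symp gr_rel"
    using fvs.subspace_neg[OF subspace_corad_below] by (fastforce simp: symp_def gr_rel_def)
  show "transp gr_rel"
    using fvs.subspace_add[OF subspace_corad_below] by (fastforce simp: transp_def gr_rel_def)
qed


text \<open>\<open>gr_class k h\<close> is the class of \<open>h \<in> F\<^sup>k\<close> in \<open>F\<^sup>k / F\<^sup>k\<^sup>-\<^sup>1\<close>.\<close>

definition gr_class :: "nat \<Rightarrow> 'k::field ysym \<Rightarrow> 'k gr" where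
  "gr_class k h = abs_gr (Poly_Mapping.single k h)"

instantiation gr :: (field) ab_group_add
begin

lift_definition zero_gr :: "'a gr" is 0
  by (simp add: gr_rel_def fvs.subspace_0[OF subspace_corad] fvs.subspace_0[OF subspace_corad_below])

lift_definition plus_gr :: "'a gr \<Rightarrow> 'a gr \<Rightarrow> 'a gr" is "(+)"
  by (simp add: gr_rel_def lookup_add add_diff_add fvs.subspace_add[OF subspace_corad]
      fvs.subspace_add[OF subspace_corad_below])

lift_definition uminus_gr :: "'a gr \<Rightarrow> 'a gr" is uminus
  by (simp only: gr_rel_def lookup_uminus minus_diff_minus fvs.subspace_neg[OF subspace_corad]
      fvs.subspace_neg[OF subspace_corad_below] simp_thms)

definition minus_gr :: "'a gr \<Rightarrow> 'a gr \<Rightarrow> 'a gr" where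
  "minus_gr x y = x + - y"

instance
proof
  note closed = fvs.subspace_0[OF subspace_corad_below] fvs.subspace_0[OF subspace_corad]
    fvs.subspace_add[OF subspace_corad]
  fix a b c :: "'a gr"
  show "a + b + c = a + (b + c)"
    by transfer (simp add: gr_rel_def lookup_add add.assoc closed)
  show "a + b = b + a"
    by transfer (simp add: gr_rel_def lookup_add add.commute closed)
  show "0 + a = a"
    by transfer (simp add: gr_rel_def lookup_add closed)
  show "- a + a = 0"
    by transfer (simp add: gr_rel_def lookup_add closed)
  show "a - b = a + - b"
    by (rule minus_gr_def)
qed

end

lift_definition gr_scale :: "'k::field \<Rightarrow> 'k gr \<Rightarrow> 'k gr" is "\<lambda>c x. Poly_Mapping.map (fscale c) x"
proof -
  fix c :: 'k and x y :: "nat \<Rightarrow>\<^sub>0 'k ysym"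
  assume "gr_rel x y"
  moreover have "Poly_Mapping.lookup (Poly_Mapping.map (fscale c) z) k = fscale c (Poly_Mapping.lookup z k)"
    for z :: "nat \<Rightarrow>\<^sub>0 'k ysym" and k
    by (simp add: Poly_Mapping.map.rep_eq when_def)
  ultimately show "gr_rel (Poly_Mapping.map (fscale c) x) (Poly_Mapping.map (fscale c) y)"
    by (simp add: gr_rel_def fvs.subspace_scale[OF subspace_corad]
        fvs.subspace_scale[OF subspace_corad_below] flip: fvs.scale_right_diff_distrib)
qed

interpretation gr: vector_space "gr_scale :: 'k::field \<Rightarrow> 'k gr \<Rightarrow> 'k gr"
proof
  have *: "Poly_Mapping.lookup (Poly_Mapping.map (fscale c) z) k = fscale c (Poly_Mapping.lookup z k)"
    for c :: 'k and z :: "nat \<Rightarrow>\<^sub>0 'k ysym" and k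
    by (simp add: Poly_Mapping.map.rep_eq when_def)
  note closed = fvs.subspace_0[OF subspace_corad_below] fvs.subspace_add[OF subspace_corad]
    fvs.subspace_scale[OF subspace_corad]
  fix a b :: 'k and x y :: "'k gr"
  show "gr_scale a (x + y) = gr_scale a x + gr_scale a y"
    by transfer (simp add: gr_rel_def * lookup_add fvs.scale_right_distrib closed)
  show "gr_scale (a + b) x = gr_scale a x + gr_scale b x"
    by transfer (simp add: gr_rel_def * lookup_add fvs.scale_left_distrib closed)
  show "gr_scale a (gr_scale b x) = gr_scale (a * b) x"
    by transfer (simp add: gr_rel_def * closed)
  show "gr_scale 1 x = x"
    by transfer (simp add: gr_rel_def * closed)
qed

text \<open>
  The induced product of the classes of \<open>x \<in> F\<^sup>i\<close> and \<open>y \<in> F\<^sup>j\<close> is the class of \<open>x \<cdot> y\<close> in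
  \<open>F\<^sup>i\<^sup>+\<^sup>j / F\<^sup>i\<^sup>+\<^sup>j\<^sup>-\<^sup>1\<close>. It is computed on the representatives chosen by \<open>rep_gr\<close>; the choice
  is immaterial because \<open>F\<^sup>i \<cdot> F\<^sup>j \<subseteq> F\<^sup>i\<^sup>+\<^sup>j\<close>. The same remark applies to the maps below.
\<close>

definition gr_mul :: "'k::field gr \<Rightarrow> 'k gr \<Rightarrow> 'k gr" where
  "gr_mul X Y = (\<Sum>i\<in>Poly_Mapping.keys (rep_gr X). \<Sum>j\<in>Poly_Mapping.keys (rep_gr Y).
     gr_class (i + j) (ysym_mul (Poly_Mapping.lookup (rep_gr X) i) (Poly_Mapping.lookup (rep_gr Y) j)))"

definition gr_unit :: "'k::field gr" where
  "gr_unit = gr_class 0 (fund Leaf)"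

text \<open>
  For \<open>h \<in> F\<^sup>k\<close>, the coproduct of \<open>h\<close> is a finite sum of tensors of \<open>a \<in> F\<^sup>i\<close> and \<open>b \<in> F\<^sup>j\<close> with
  \<open>i + j = k\<close>; the induced coproduct of the class of \<open>h\<close> is the sum of the tensors of the classes
  of \<open>a\<close> and \<open>b\<close>. The entries of the list below are quadruples \<open>(i, a, j, b)\<close>.
\<close>

definition filtered_comul ::
  "nat \<Rightarrow> 'k::field ysym \<Rightarrow> (nat \<times> 'k ysym \<times> nat \<times> 'k ysym) list \<Rightarrow> bool" where
  "filtered_comul k h L \<longleftrightarrow>
     (\<forall>(i, a, j, b)\<in>set L. i + j = k \<and> a \<in> corad i \<and> b \<in> corad j) \<and>
     ysym_comul h = (\<Sum>(i, a, j, b)\<leftarrow>L. ysym_tensor a b)"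

definition gr_comul :: "'k::field gr \<Rightarrow> ('k gr \<times> 'k gr \<Rightarrow>\<^sub>0 'k)" where
  "gr_comul X = (\<Sum>k\<in>Poly_Mapping.keys (rep_gr X).
     \<Sum>(i, a, j, b)\<leftarrow>(SOME L. filtered_comul k (Poly_Mapping.lookup (rep_gr X) k) L).
       Poly_Mapping.single (gr_class i a, gr_class j b) 1)"

text \<open>The counit vanishes on \<open>F\<^sup>k / F\<^sup>k\<^sup>-\<^sup>1\<close> for \<open>k > 0\<close>.\<close>

definition gr_counit :: "'k::field gr \<Rightarrow> 'k" where
  "gr_counit X = ysym_counit (Poly_Mapping.lookup (rep_gr X) 0)"

definition gr_mono :: "pbt \<Rightarrow> 'k::field gr" where
  "gr_mono t = gr_class (ncomp t) (mono_basis t)"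

text \<open>The grading of \<open>gr(YSym)\<close> by the number of internal nodes, not by \<open>k\<close>.\<close>

definition gr_homog :: "nat \<Rightarrow> 'k::field gr set" where
  "gr_homog n = gr.span {gr_mono t | t. nodes t = n}"

section \<open>The graded dual\<close>

interpretation ground: vector_space "(*) :: 'k::field \<Rightarrow> 'k \<Rightarrow> 'k"
  by standard (simp_all add: algebra_simps)

interpretation gr_ground: vector_space_pair gr_scale "(*) :: 'k::field \<Rightarrow> 'k \<Rightarrow> 'k"
  by standard

typedef (overloaded) 'k grdual =
  "{\<phi> :: 'k::field gr \<Rightarrow> 'k. Vector_Spaces.linear gr_scale (*) \<phi> \<and>
      finite {n. \<exists>x\<in>gr_homog n. \<phi> x \<noteq> 0}}"
  morphisms dual_app Abs_grdual
proof -
  have "Vector_Spaces.linear gr_scale (*) (\<lambda>x :: 'k gr. 0 :: 'k)"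
    by (rule gr_ground.linear_zero)
  then show ?thesis by (intro exI[of _ "\<lambda>x. 0"]) simp
qed

setup_lifting type_definition_grdual

lemma linear_dual_app: "Vector_Spaces.linear gr_scale (*) (dual_app \<phi>)"
  using dual_app by blast

instantiation grdual :: (field) ab_group_add
begin

lift_definition zero_grdual :: "'a grdual" is "\<lambda>x. 0"
  by (simp add: gr_ground.linear_zero)

lift_definition plus_grdual :: "'a grdual \<Rightarrow> 'a grdual \<Rightarrow> 'a grdual" is "\<lambda>\<phi> \<psi> x. \<phi> x + \<psi> x"
proof -
  fix \<phi> \<psi> :: "'a gr \<Rightarrow> 'a"
  let ?N = "\<lambda>\<phi> :: 'a gr \<Rightarrow> 'a. {n. \<exists>x\<in>gr_homog n. \<phi> x \<noteq> 0}"
  assume "Vector_Spaces.linear gr_scale (*) \<phi> \<and> finite (?N \<phi>)"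
    and "Vector_Spaces.linear gr_scale (*) \<psi> \<and> finite (?N \<psi>)"
  moreover have "?N (\<lambda>x. \<phi> x + \<psi> x) \<subseteq> ?N \<phi> \<union> ?N \<psi>" by auto
  ultimately show "Vector_Spaces.linear gr_scale (*) (\<lambda>x. \<phi> x + \<psi> x) \<and> finite (?N (\<lambda>x. \<phi> x + \<psi> x))"
    by (auto intro: gr_ground.linear_compose_add finite_subset)
qed

lift_definition uminus_grdual :: "'a grdual \<Rightarrow> 'a grdual" is "\<lambda>\<phi> x. - \<phi> x"
  by (simp add: gr_ground.linear_compose_neg)

lift_definition minus_grdual :: "'a grdual \<Rightarrow> 'a grdual \<Rightarrow> 'a grdual" is "\<lambda>\<phi> \<psi> x. \<phi> x - \<psi> x"
proof -
  fix \<phi> \<psi> :: "'a gr \<Rightarrow> 'a"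
  let ?N = "\<lambda>\<phi> :: 'a gr \<Rightarrow> 'a. {n. \<exists>x\<in>gr_homog n. \<phi> x \<noteq> 0}"
  assume "Vector_Spaces.linear gr_scale (*) \<phi> \<and> finite (?N \<phi>)"
    and "Vector_Spaces.linear gr_scale (*) \<psi> \<and> finite (?N \<psi>)"
  moreover have "?N (\<lambda>x. \<phi> x - \<psi> x) \<subseteq> ?N \<phi> \<union> ?N \<psi>" by auto
  ultimately show "Vector_Spaces.linear gr_scale (*) (\<lambda>x. \<phi> x - \<psi> x) \<and> finite (?N (\<lambda>x. \<phi> x - \<psi> x))"
    by (auto intro: gr_ground.linear_compose_sub finite_subset)
qed

instance
  by standard (transfer, simp add: fun_eq_iff algebra_simps)+

end

lift_definition dual_scale :: "'k::field \<Rightarrow> 'k grdual \<Rightarrow> 'k grdual" is "\<lambda>c \<phi> x. c * \<phi> x"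
proof -
  fix c :: 'k and \<phi> :: "'k gr \<Rightarrow> 'k"
  let ?N = "\<lambda>\<phi> :: 'k gr \<Rightarrow> 'k. {n. \<exists>x\<in>gr_homog n. \<phi> x \<noteq> 0}"
  assume "Vector_Spaces.linear gr_scale (*) \<phi> \<and> finite (?N \<phi>)"
  moreover have "?N (\<lambda>x. c * \<phi> x) \<subseteq> ?N \<phi>" by auto
  ultimately show "Vector_Spaces.linear gr_scale (*) (\<lambda>x. c * \<phi> x) \<and> finite (?N (\<lambda>x. c * \<phi> x))"
    by (auto intro: gr_ground.linear_compose_scale_right finite_subset)
qed

text \<open>
  The product of the dual is \<open>(\<phi> \<cdot> \<psi>)(x) = (\<phi> \<otimes> \<psi>)(\<Delta> x)\<close>; its coproduct is determined by
  \<open>\<langle>\<Delta> \<phi>, x \<otimes> y\<rangle> = \<phi>(x \<cdot> y)\<close>, which fixes \<open>\<Delta> \<phi>\<close> as an element of the tensor product.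
\<close>

definition dual_mul :: "'k::field grdual \<Rightarrow> 'k grdual \<Rightarrow> 'k grdual" where
  "dual_mul \<phi> \<psi> = Abs_grdual (\<lambda>x. tensor_pair (dual_app \<phi>) (dual_app \<psi>) (gr_comul x))"

definition dual_unit :: "'k::field grdual" where
  "dual_unit = Abs_grdual gr_counit"

definition dual_comul :: "'k::field grdual \<Rightarrow> ('k grdual \<times> 'k grdual \<Rightarrow>\<^sub>0 'k)" where
  "dual_comul \<phi> = (SOME T. \<forall>x y.
     tensor_pair (\<lambda>\<alpha>. dual_app \<alpha> x) (\<lambda>\<beta>. dual_app \<beta> y) T = dual_app \<phi> (gr_mul x y))"

definition dual_counit :: "'k::field grdual \<Rightarrow> 'k" where
  "dual_counit \<phi> = dual_app \<phi> gr_unit"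

definition dual_homog :: "nat \<Rightarrow> 'k::field grdual set" where
  "dual_homog n = {\<phi>. \<forall>m. m \<noteq> n \<longrightarrow> (\<forall>x\<in>gr_homog m. dual_app \<phi> x = 0)}"

definition gr_ysym_dual :: "('k::field, 'k grdual) hopf" where
  "gr_ysym_dual = \<lparr>scal = dual_scale, mul = dual_mul, unit = dual_unit, comul = dual_comul,
     counit = dual_counit, homog = dual_homog\<rparr>"

definition dual_mono :: "pbt \<Rightarrow> 'k::field grdual" where
  "dual_mono t = (THE \<phi>. \<forall>s. dual_app \<phi> (gr_mono s) = (if s = t then 1 else 0))"

section \<open>Ordered trees and the Grossman-Larson Hopf algebra\<close>

datatype otree = ONode "otree list"

primrec children :: "otree \<Rightarrow> otree list" where
  "children (ONode ts) = ts"

primrec onodes :: "otree \<Rightarrow> nat" where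
  "onodes (ONode ts) = Suc (sum_list (map onodes ts))"

definition obslash :: "otree \<Rightarrow> otree \<Rightarrow> otree" where
  "obslash x y = ONode (children x @ children y)"

lemma size_nth_otree [termination_simp]:
  "i < length ts \<Longrightarrow> size (ts ! i :: otree) < Suc (size_list size ts)"
  using size_list_estimation'[of "ts ! i" ts "size (ts ! i)" size] by simp

text \<open>
  A node is given by its address: the list of child positions on the path from the root to it.
\<close>

fun Nod :: "otree \<Rightarrow> nat list set" where
  "Nod (ONode ts) = insert [] (\<Union>i<length ts. (#) i ` Nod (ts ! i))"

text \<open>\<open>attach g y\<close> inserts the trees \<open>g p\<close> to the left of the children of each node \<open>p\<close> of \<open>y\<close>.\<close>

fun attach :: "(nat list \<Rightarrow> otree list) \<Rightarrow> otree \<Rightarrow> otree" where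
  "attach g (ONode ts) =
     ONode (g [] @ map (\<lambda>i. attach (\<lambda>p. g (i # p)) (ts ! i)) [0..<length ts])"

text \<open>
  The planted components of \<open>x\<close> are the trees \<open>ONode [c]\<close> for the children \<open>c\<close> of the root of \<open>x\<close>;
  we number them \<open>0, \<dots>, k - 1\<close>. Identifying the root of \<open>ONode [c]\<close> with a node makes \<open>c\<close> a child
  of that node.
\<close>

definition ocomp :: "otree \<Rightarrow> nat" where
  "ocomp x = length (children x)"

definition sharp :: "otree \<Rightarrow> (nat \<Rightarrow> nat list) \<Rightarrow> otree \<Rightarrow> otree" where
  "sharp x f y = attach (\<lambda>p. map ((!) (children x)) (filter (\<lambda>i. f i = p) [0..<ocomp x])) y"

definition subcomp :: "otree \<Rightarrow> nat set \<Rightarrow> otree" where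
  "subcomp x S = ONode (nths (children x) S)"

type_synonym 'k ho = "otree \<Rightarrow>\<^sub>0 'k"

definition ho_mul :: "'k::field ho \<Rightarrow> 'k ho \<Rightarrow> 'k ho" where
  "ho_mul = bilinext (\<lambda>x y. \<Sum>f\<in>{..<ocomp x} \<rightarrow>\<^sub>E Nod y. Poly_Mapping.single (sharp x f y) 1)"

definition ho_comul :: "'k::field ho \<Rightarrow> ('k ho \<times> 'k ho \<Rightarrow>\<^sub>0 'k)" where
  "ho_comul = linext (\<lambda>x. \<Sum>S\<in>Pow {..<ocomp x}. Poly_Mapping.single
     (Poly_Mapping.single (subcomp x S) 1, Poly_Mapping.single (subcomp x ({..<ocomp x} - S)) 1) 1)"

definition grossman_larson :: "('k::field, 'k ho) hopf" where
  "grossman_larson = \<lparr>scal = fscale, mul = ho_mul, unit = Poly_Mapping.single (ONode []) 1,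
     comul = ho_comul, counit = (\<lambda>x. Poly_Mapping.lookup x (ONode [])),
     homog = (\<lambda>n. fvs.span {Poly_Mapping.single x 1 | x. onodes x = n + 1})\<rparr>"

section \<open>The bijection between planar binary trees and ordered trees\<close>

text \<open>
  This is the recursion of the informal definition, as \<open>Node l r = bslash (Node l Leaf) r\<close>:
  see \<open>psi_planted\<close> and \<open>psi_bslash\<close>.
\<close>

primrec psi :: "pbt \<Rightarrow> otree" where
  "psi Leaf = ONode []"
| "psi (Node l r) = obslash (ONode [psi l]) (psi r)"

lemma psi_planted: "psi (Node t Leaf) = ONode [psi t]"
  by (simp add: obslash_def)

lemma psi_bslash: "psi (bslash s t) = obslash (psi s) (psi t)"
proof (induction s)
  case Leaf
  show ?case by (cases "psi t") (simp add: obslash_def)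
next
  case (Node l r)
  then show ?case by (simp add: obslash_def)
qed

lemma onodes_psi: "onodes (psi t) = nodes t + 1"
proof (induction t)
  case (Node l r)
  then show ?case by (cases "psi r") (simp add: obslash_def)
qed simp

end

theory Submission
  imports Defs
begin

text \<open>
  Let \<open>c\<^sub>t h\<close> be the coefficient of \<open>M\<^sub>t\<close> in \<open>h\<close>, that is, the sum of the coefficients of \<open>F\<^sub>s\<close> over all
  \<open>s \<le> t\<close>. If \<open>(a, b)\<close> is the splitting of \<open>t\<close> in which \<open>a\<close> has as many nodes as \<open>r\<close>, then \<open>t\<close> lies
  below the backslash product of \<open>r\<close> and \<open>s\<close> in the Tamari order iff \<open>a \<le> r\<close> and \<open>b \<le> s\<close>. Hence
  comultiplication deconcatenates the monomial basis, and \<open>F\<^sup>k\<close> is cut out by the equations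
  \<open>c\<^sub>t h = 0\<close> for all \<open>t\<close> with more than \<open>k\<close> irreducible components. So the dual of the associated
  graded algebra is free on the \<open>M\<^sub>t\<^sup>*\<close> with \<open>t\<close> irreducible. As the product of YSym respects the
  filtration and the coproduct is multiplicative, these generators are primitive, and the coproduct
  of the dual unshuffles products of generators.

  On the other side, left multiplication by a planted tree grafts it at all nodes, and it is a
  coderivation of the coproduct by unshuffling. Sending the generators to planted trees therefore
  gives a bialgebra map; it is bijective since the image of \<open>M\<^sub>t\<^sup>*\<close> is \<open>psi t\<close> plus trees with
  fewer planted components.
\<close>

section \<open>Linear functionals on free vector spaces\<close>

text \<open>The coproduct of the graded algebra and that of its dual are given by chosen
  representatives, so they are accessible only through the linear forms that they feed. The
  coefficients c_t are such forms; being zeta sums, they carry no signs, and the Moebius function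
  enters essentially only in the evaluation of c_s at M_t. The coproduct of the dual is known only
  by its values at pairs of vectors. For this reason every coefficient of the image in the ordered
  trees is rewritten as evaluation at a fixed vector of the graded algebra.

  No formula for the product of M_r and M_s is used; only its terms with the largest possible number
  of irreducible components are computed. The coefficient at a backslash product factors over the
  deconcatenations of r and s, so the components of the index can be stripped one at a time, and
  counting components shows that exactly one of the two factors supplies the stripped component.

  On the side of ordered trees, it suffices to understand left multiplication by a single planted
  tree, because every M_t^* is an iterated product of generators.\<close>

abbreviation coef :: "('a \<Rightarrow>\<^sub>0 'k::zero) \<Rightarrow> 'a \<Rightarrow> 'k" where
  "coef \<equiv> Poly_Mapping.lookup"

abbreviation bvec :: "'a \<Rightarrow> ('a \<Rightarrow>\<^sub>0 'k::field)" where
  "bvec a \<equiv> Poly_Mapping.single a 1"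

text \<open>Identities in free vector spaces are tested by these forms, see
  \<open>lin_form_ext\<close>; this turns multilinear algebra into the manipulation of finite
  sums.\<close>

definition lin_form :: "('a \<Rightarrow> 'k::field) \<Rightarrow> ('a \<Rightarrow>\<^sub>0 'k) \<Rightarrow> 'k" where
  "lin_form f x = (\<Sum>a\<in>Poly_Mapping.keys x. coef x a * f a)"

lemma lin_form_superset:
  assumes "finite A" "Poly_Mapping.keys x \<subseteq> A"
  shows "lin_form f x = (\<Sum>a\<in>A. coef x a * f a)"
  unfolding lin_form_def using assms
  by (intro sum.mono_neutral_left) (auto simp: in_keys_iff)

lemma lin_form_0 [simp]: "lin_form f 0 = 0"
  by (simp add: lin_form_def)

lemma lin_form_add [simp]: "lin_form f (x + y) = lin_form f x + lin_form f y"
proof -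
  let ?A = "Poly_Mapping.keys x \<union> Poly_Mapping.keys y"
  have "lin_form f (x + y) = (\<Sum>a\<in>?A. coef (x + y) a * f a)"
    by (intro lin_form_superset) (auto simp: keys_add)
  then show ?thesis
    by (simp add: lin_form_superset[of ?A] lookup_add distrib_right sum.distrib)
qed

lemma lin_form_fscale [simp]: "lin_form f (fscale c x) = c * lin_form f x"
proof -
  have "lin_form f (fscale c x) = (\<Sum>a\<in>Poly_Mapping.keys x. coef (fscale c x) a * f a)"
    by (intro lin_form_superset) (auto simp: in_keys_iff)
  also have "\<dots> = c * lin_form f x"
    unfolding lin_form_def sum_distrib_left lookup_fscale mult.assoc ..
  finally show ?thesis .
qed

lemma lin_form_uminus [simp]: "lin_form f (- x) = - lin_form f x"
  by (simp add: lin_form_def sum_negf)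

lemma lin_form_diff [simp]: "lin_form f (x - y) = lin_form f x - lin_form f y"
  using lin_form_add[of f x "- y"] by simp

lemma lin_form_single [simp]: "lin_form f (Poly_Mapping.single a c) = c * f a"
  by (simp add: lin_form_def)

lemma lin_form_sum: "lin_form f (\<Sum>i\<in>I. x i) = (\<Sum>i\<in>I. lin_form f (x i))"
  by (induction I rule: infinite_finite_induct) auto

lemma lin_form_sum_list: "lin_form f (\<Sum>i\<leftarrow>xs. x i) = (\<Sum>i\<leftarrow>xs. lin_form f (x i))"
  by (induction xs) auto

lemma lin_form_linext: "lin_form f (linext g x) = lin_form (\<lambda>a. lin_form f (g a)) x"
  by (simp add: linext_def lin_form_sum) (simp add: lin_form_def)

lemma lin_form_cong:
  "(\<And>a. a \<in> Poly_Mapping.keys x \<Longrightarrow> f a = g a) \<Longrightarrow> lin_form f x = lin_form g x"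
  by (simp add: lin_form_def)

lemma lin_form_fun_add: "lin_form (\<lambda>a. f a + g a) x = lin_form f x + lin_form g x"
  by (simp add: lin_form_def distrib_left sum.distrib)

lemma lin_form_fun_zero [simp]: "lin_form (\<lambda>a. 0) x = 0"
  by (simp add: lin_form_def)

lemma lin_form_fun_cmult: "lin_form (\<lambda>a. c * f a) x = c * lin_form f x"
  by (simp only: lin_form_def sum_distrib_left mult.left_commute)

lemma lin_form_fun_multc: "lin_form (\<lambda>a. f a * c) x = lin_form f x * c"
  by (simp only: lin_form_def sum_distrib_right mult.assoc)

lemma lin_form_fun_sum: "lin_form (\<lambda>a. \<Sum>i\<in>I. f i a) x = (\<Sum>i\<in>I. lin_form (f i) x)"
  by (induction I rule: infinite_finite_induct) (auto simp: lin_form_fun_add)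

lemma lin_form_fun_sum_list: "lin_form (\<lambda>a. \<Sum>i\<leftarrow>xs. f i a) x = (\<Sum>i\<leftarrow>xs. lin_form (f i) x)"
  by (induction xs) (auto simp: lin_form_fun_add)

lemma lin_form_swap:
  "lin_form (\<lambda>a. lin_form (\<lambda>b. F a b) y) x = lin_form (\<lambda>b. lin_form (\<lambda>a. F a b) x) y"
proof -
  have "lin_form (\<lambda>a. lin_form (\<lambda>b. F a b) y) x =
      (\<Sum>b\<in>Poly_Mapping.keys y. lin_form (\<lambda>a. coef y b * F a b) x)"
    by (simp only: lin_form_def[of _ y] lin_form_fun_sum)
  then show ?thesis by (simp only: lin_form_fun_cmult) (simp add: lin_form_def)
qed

lemma lin_form_of_bool [simp]: "lin_form (\<lambda>a. of_bool (a = b)) x = coef x b"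
proof -
  have "lin_form (\<lambda>a. of_bool (a = b)) x =
      (\<Sum>a\<in>insert b (Poly_Mapping.keys x). coef x a * of_bool (a = b))"
    by (rule lin_form_superset) auto
  also have "\<dots> = (\<Sum>a\<in>insert b (Poly_Mapping.keys x). if a = b then coef x a else 0)"
    by (rule sum.cong) auto
  finally show ?thesis by simp
qed

lemma coef_linext: "coef (linext g x) b = lin_form (\<lambda>a. coef (g a) b) x"
  by (simp flip: lin_form_of_bool add: lin_form_linext)

lemma lin_form_bilinext:
  "lin_form f (bilinext g x y) = lin_form (\<lambda>a. lin_form (\<lambda>b. lin_form f (g a b)) y) x"
  by (simp add: bilinext_def lin_form_linext)

lemma coef_sum: "coef (\<Sum>i\<in>I. x i) a = (\<Sum>i\<in>I. coef (x i) a)"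
  by (induction I rule: infinite_finite_induct) (auto simp: lookup_add)

lemma coef_sum_list: "coef (\<Sum>i\<leftarrow>xs. x i) a = (\<Sum>i\<leftarrow>xs. coef (x i) a)"
  by (induction xs) (auto simp: lookup_add)

lemma coef_bvec: "coef (bvec a) b = of_bool (a = b)"
  by (simp add: lookup_single when_def)

lemma linext_bvec [simp]: "linext bvec x = x"
  by (rule poly_mapping_eqI) (simp add: coef_linext coef_bvec)

lemma linext_zero [simp]: "linext f 0 = 0"
  by (simp add: linext_def)

lemma linext_uminus: "linext f (- x) = - linext f x"
  using linext_fscale[of f "- 1" x] by simp

lemma linext_diff: "linext f (x - y) = linext f x - linext f y"
  using linext_add[of f x "- y"] by (simp add: linext_uminus)

lemma linext_in_span: "(\<And>a. a \<in> Poly_Mapping.keys x \<Longrightarrow> f a \<in> fvs.span S) \<Longrightarrow> linext f x \<in> fvs.span S"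
  unfolding linext_def by (intro fvs.span_sum fvs.span_scale)

lemma sum_list_concat_map:
  "(\<Sum>y\<leftarrow>concat (map f xs). g y) = (\<Sum>x\<leftarrow>xs. \<Sum>y\<leftarrow>f x. g y)"
  by (induction xs) auto

lemma sum_list_map_map: "(\<Sum>y\<leftarrow>map f xs. g y) = (\<Sum>x\<leftarrow>xs. g (f x))"
  by (simp add: o_def)

lemma sum_list_swap:
  fixes F :: "'a \<Rightarrow> 'b \<Rightarrow> 'c::comm_monoid_add"
  shows "(\<Sum>x\<leftarrow>xs. \<Sum>y\<leftarrow>ys. F x y) = (\<Sum>y\<leftarrow>ys. \<Sum>x\<leftarrow>xs. F x y)"
  by (induction xs) (simp_all add: sum_list_addf)

text \<open>Triangularity: if all coefficients strictly below \<open>a\<close> vanish, the zeta sum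
  at \<open>a\<close> is the coefficient of \<open>a\<close> itself. The down-closed predicate
  \<open>P\<close> restricts the argument to a part of the order, such as the words without the
  letter \<open>Leaf\<close>.\<close>

lemma zeta_coef_eq_0:
  fixes x :: "'a \<Rightarrow>\<^sub>0 'k::field" and \<rho> :: "'a \<Rightarrow> nat"
  assumes refl: "\<And>a. R a a"
    and rank: "\<And>a b. R b a \<Longrightarrow> b \<noteq> a \<Longrightarrow> \<rho> b < \<rho> a"
    and down: "\<And>a b. P a \<Longrightarrow> R b a \<Longrightarrow> P b"
    and zero: "\<And>a. P a \<Longrightarrow> lin_form (\<lambda>b. of_bool (R b a)) x = 0"
  shows "P a \<Longrightarrow> coef x a = 0"
proof (induction a rule: measure_induct_rule[of \<rho>])
  case (less a)
  have "0 = lin_form (\<lambda>b. of_bool (R b a)) x"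
    using less.prems zero by simp
  also have "\<dots> = lin_form (\<lambda>b. of_bool (b = a)) x"
  proof (rule lin_form_cong)
    fix b assume "b \<in> Poly_Mapping.keys x"
    then show "of_bool (R b a) = (of_bool (b = a) :: 'k)"
      using less.IH[of b] down[OF less.prems, of b] rank[of b a] refl[of a]
      by (auto simp: in_keys_iff of_bool_def)
  qed
  finally show ?case by simp
qed

lemma sum_list_swap_split:
  fixes F :: "'a \<Rightarrow> 'b \<Rightarrow> 'c \<Rightarrow> 'd \<Rightarrow> 'e::comm_monoid_add"
  shows "(\<Sum>(a, b)\<leftarrow>xs. \<Sum>(c, d)\<leftarrow>ys. F a b c d) = (\<Sum>(c, d)\<leftarrow>ys. \<Sum>(a, b)\<leftarrow>xs. F a b c d)"
  unfolding case_prod_unfold by (rule sum_list_swap)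

lemma sum_list_swap_split':
  fixes F :: "'a \<Rightarrow> 'b \<Rightarrow> 'c \<Rightarrow> 'e::comm_monoid_add"
  shows "(\<Sum>a\<leftarrow>xs. \<Sum>(c, d)\<leftarrow>ys. F a c d) = (\<Sum>(c, d)\<leftarrow>ys. \<Sum>a\<leftarrow>xs. F a c d)"
  unfolding case_prod_unfold by (rule sum_list_swap)

lemma sum_list_split_addf:
  fixes F :: "'a \<Rightarrow> 'b \<Rightarrow> 'e::comm_monoid_add"
  shows "(\<Sum>(a, b)\<leftarrow>xs. F a b + G a b) = (\<Sum>(a, b)\<leftarrow>xs. F a b) + (\<Sum>(a, b)\<leftarrow>xs. G a b)"
  by (simp add: case_prod_unfold sum_list_addf)

lemma sum_list_pair_cong:
  "(\<And>a b. (a, b) \<in> set xs \<Longrightarrow> F a b = G a b) \<Longrightarrow> (\<Sum>(a, b)\<leftarrow>xs. F a b) = (\<Sum>(a, b)\<leftarrow>xs. G a b)"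
  by (intro arg_cong[of _ _ sum_list] map_cong refl) auto

lemma sum_sum_list_swap:
  fixes F :: "'a \<Rightarrow> 'b \<Rightarrow> 'c::comm_monoid_add"
  shows "(\<Sum>x\<in>A. \<Sum>y\<leftarrow>ys. F x y) = (\<Sum>y\<leftarrow>ys. \<Sum>x\<in>A. F x y)"
  by (induction ys) (simp_all add: sum.distrib)

lemma lin_form_nonzero: "lin_form f x \<noteq> 0 \<Longrightarrow> \<exists>a\<in>Poly_Mapping.keys x. f a \<noteq> 0"
  using lin_form_cong[of x f "\<lambda>_. 0"] by auto

lemma lin_form_of_bool_flip: "lin_form (\<lambda>a. of_bool (b = a)) x = coef x b"
  using lin_form_of_bool[of b x] by (simp only: eq_commute[of b])

text \<open>The pairing for which the basis is self-dual; it exchanges a functional given by its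
  coordinates with its argument.\<close>

lemma lin_form_coef_sym: "lin_form (coef x) y = lin_form (coef y) x"
proof -
  let ?A = "Poly_Mapping.keys x \<union> Poly_Mapping.keys y"
  have "lin_form (coef x) y = (\<Sum>a\<in>?A. coef y a * coef x a)"
    and "lin_form (coef y) x = (\<Sum>a\<in>?A. coef x a * coef y a)"
    by (intro lin_form_superset; auto)+
  then show ?thesis by (simp add: mult.commute)
qed

lemma lin_form_fun_diff: "lin_form (\<lambda>a. f a - g a) x = lin_form f x - lin_form g x"
  by (simp add: lin_form_def right_diff_distrib sum_subtractf)

lemma lin_form_ext: "(\<And>F. lin_form F x = lin_form F y) \<Longrightarrow> x = y"
  by (rule poly_mapping_eqI) (simp flip: lin_form_of_bool)

lemma linext_linext: "linext f (linext g x) = linext (\<lambda>a. linext f (g a)) x"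
  by (rule lin_form_ext) (simp add: lin_form_linext)

lemma linext_fun_diff: "linext (\<lambda>a. f a - g a) x = linext f x - linext g x"
  by (rule lin_form_ext) (simp add: lin_form_linext lin_form_fun_diff)

lemma single_eq_fscale: "Poly_Mapping.single p c = fscale c (bvec p)"
  by (rule poly_mapping_eqI) (simp add: lookup_single when_def)

lemma subspace_sum_list: "fvs.subspace S \<Longrightarrow> (\<And>i. i \<in> set xs \<Longrightarrow> f i \<in> S) \<Longrightarrow> (\<Sum>i\<leftarrow>xs. f i) \<in> S"
  by (induction xs) (auto simp: fvs.subspace_0 fvs.subspace_add)

section \<open>The Tamari order and the monomial basis\<close>

lemma tamari_nodes: "tamari s t \<Longrightarrow> nodes s = nodes t"
  by (induction rule: rtranclp_induct) (auto dest: tamari_step_nodes)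

lemma tamari_Node: "tamari l l' \<Longrightarrow> tamari r r' \<Longrightarrow> tamari (Node l r) (Node l' r')"
proof -
  assume l: "tamari l l'" and r: "tamari r r'"
  from l have "tamari (Node l r) (Node l' r)"
    by (induction rule: rtranclp_induct) (auto intro: rtranclp.rtrancl_into_rtrancl tamari_step.left)
  also from r have "tamari (Node l' r) (Node l' r')"
    by (induction rule: rtranclp_induct) (auto intro: rtranclp.rtrancl_into_rtrancl tamari_step.right)
  finally show ?thesis .
qed

section \<open>Compatibility of the Tamari order with backslash products\<close>

lemma tamari_rotate: "tamari (Node (Node a b) c) (Node a (Node b c))"
  by (rule r_into_rtranclp) (rule tamari_step.rotate)

lemma tamari_bslash_step: "tamari_step r r' \<Longrightarrow> tamari (bslash r s) (bslash r' s)"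
  by (induction rule: tamari_step.induct)
     (auto intro: tamari_rotate tamari_Node)

lemma tamari_bslash:
  assumes "tamari r r'" "tamari s s'"
  shows "tamari (bslash r s) (bslash r' s')"
proof -
  from assms(1) have "tamari (bslash r s) (bslash r' s)"
    by (induction rule: rtranclp_induct) (auto intro: tamari_bslash_step rtranclp_trans)
  also have "tamari (bslash r' s) (bslash r' s')"
    using assms(2) by (induction r') (auto intro: tamari_Node)
  finally show ?thesis .
qed

text \<open>One rotation for each node on the right spine of \<open>a\<close>.\<close>

lemma tamari_bslash_Node: "tamari (Node (bslash a b) r) (bslash a (Node b r))"
proof (induction a)
  case (Node x y)
  have "tamari (Node (bslash (Node x y) b) r) (Node x (Node (bslash y b) r))"
    by (simp add: tamari_rotate)
  also have "tamari \<dots> (Node x (bslash y (Node b r)))"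
    using Node by (intro tamari_Node) auto
  finally show ?case by simp
qed simp

text \<open>Whenever the path to the cut leaf turns left, regluing takes the left part out of the
  left subtree, which is a chain of rotations by \<open>tamari_bslash_Node\<close>; right turns
  change nothing.\<close>

lemma tamari_split: "(a, b) \<in> set (splits t) \<Longrightarrow> tamari t (bslash a b)"
proof (induction t arbitrary: a b)
  case (Node l r)
  then consider l1 where "(a, l1) \<in> set (splits l)" "b = Node l1 r"
    | r0 where "(r0, b) \<in> set (splits r)" "a = Node l r0"
    by auto
  then show ?case
  proof cases
    case 1
    then have "tamari (Node l r) (Node (bslash a l1) r)"
      using Node.IH(1) by (intro tamari_Node) auto
    then show ?thesis using tamari_bslash_Node 1(2) by (auto intro: rtranclp_trans)
  next
    case 2
    then show ?thesis using Node.IH(2) by (auto intro: tamari_Node)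
  qed
qed simp

section \<open>Splittings along the Tamari order\<close>

lemma map_fst_nodes_splits: "map (\<lambda>(a, b). nodes a) (splits t) = [0..<Suc (nodes t)]"
proof (induction t)
  case (Node l r)
  have "map (\<lambda>(a, b). nodes a) (splits (Node l r)) =
      map (\<lambda>(a, b). nodes a) (splits l) @ map ((+) (Suc (nodes l))) (map (\<lambda>(a, b). nodes a) (splits r))"
    by (auto simp: case_prod_unfold)
  also have "\<dots> = [0..<Suc (nodes (Node l r))]"
    unfolding Node by (rule nth_equalityI) (auto simp: nth_append simp del: upt_Suc)
  finally show ?case .
qed simp

lemma nodes_splits: "(a, b) \<in> set (splits t) \<Longrightarrow> nodes a + nodes b = nodes t"
  by (induction t arbitrary: a b) auto

lemma split_bslash: "(a, b) \<in> set (splits (bslash a b))"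
proof (induction a)
  case Leaf
  show ?case by (induction b) force+
qed force

text \<open>By \<open>map_fst_nodes_splits\<close> the left parts have sizes 0, ..., n, each
  occurring once, so the size of the left part determines the splitting.\<close>

lemma splits_unique:
  assumes "(a, b) \<in> set (splits t)" "(c, d) \<in> set (splits t)" "nodes a = nodes c"
  shows "a = c \<and> b = d"
proof -
  have "distinct (map (\<lambda>(a, b). nodes a) (splits t))"
    by (simp add: map_fst_nodes_splits del: upt_Suc)
  then have "inj_on (\<lambda>(a, b). nodes a) (set (splits t))"
    by (simp add: distinct_map)
  from inj_onD[OF this _ assms(1,2)] assms(3) show ?thesis by simp
qed

lemma distinct_splits: "distinct (splits t)"
proof -
  have "distinct (map (\<lambda>(a, b). nodes a) (splits t))"
    by (simp add: map_fst_nodes_splits del: upt_Suc)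
  then show ?thesis by (simp add: distinct_map)
qed

text \<open>A splitting follows its leaf through the rotation. If the leaf lies in the first or the
  last of the three rotated subtrees, the rotation survives in one of the two parts. If it lies in
  the middle one, the cut separates the two nodes involved and both parts stay the same.\<close>

lemma splits_step:
  "tamari_step t t' \<Longrightarrow> (a, b) \<in> set (splits t) \<Longrightarrow>
     \<exists>a' b'. (a', b') \<in> set (splits t') \<and> tamari a a' \<and> tamari b b'"
proof (induction arbitrary: a b rule: tamari_step.induct)
  case (rotate x y z)
  then consider x1 where "(a, x1) \<in> set (splits x)" "b = Node (Node x1 y) z"
    | y0 y1 where "(y0, y1) \<in> set (splits y)" "a = Node x y0" "b = Node y1 z"
    | z0 where "(z0, b) \<in> set (splits z)" "a = Node (Node x y) z0"
    by auto
  then show ?case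
  proof cases
    case 1
    then show ?thesis
      by (intro exI[of _ a] exI[of _ "Node x1 (Node y z)"]) (auto intro: tamari_rotate)
  next
    case 2
    then show ?thesis by (intro exI[of _ a] exI[of _ b]) force
  next
    case 3
    then show ?thesis
      by (intro exI[of _ "Node x (Node y z0)"] exI[of _ b]) (force intro: tamari_rotate)
  qed
next
  case (left l l' r)
  from left.prems consider l1 where "(a, l1) \<in> set (splits l)" "b = Node l1 r"
    | r0 where "(r0, b) \<in> set (splits r)" "a = Node l r0"
    by auto
  then show ?case
  proof cases
    case 1
    from left.IH[OF 1(1)] obtain a' b' where
      "(a', b') \<in> set (splits l')" "tamari a a'" "tamari l1 b'" by blast
    then show ?thesis
      using 1 by (intro exI[of _ a'] exI[of _ "Node b' r"]) (auto intro: tamari_Node)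
  next
    case 2
    then show ?thesis using left.hyps
      by (intro exI[of _ "Node l' r0"] exI[of _ b]) (auto intro: tamari_Node)
  qed
next
  case (right r r' l)
  from right.prems consider l1 where "(a, l1) \<in> set (splits l)" "b = Node l1 r"
    | r0 where "(r0, b) \<in> set (splits r)" "a = Node l r0"
    by auto
  then show ?case
  proof cases
    case 1
    then show ?thesis using right.hyps
      by (intro exI[of _ a] exI[of _ "Node l1 r'"]) (auto intro: tamari_Node)
  next
    case 2
    from right.IH[OF 2(1)] obtain a' b' where
      "(a', b') \<in> set (splits r')" "tamari r0 a'" "tamari b b'" by blast
    then show ?thesis
      using 2 by (intro exI[of _ "Node l a'"] exI[of _ b']) (auto intro: tamari_Node)
  qed
qed

lemma splits_mono:
  "tamari t t' \<Longrightarrow> (a, b) \<in> set (splits t) \<Longrightarrow>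
     \<exists>a' b'. (a', b') \<in> set (splits t') \<and> tamari a a' \<and> tamari b b'"
proof (induction rule: rtranclp_induct)
  case (step y z)
  then show ?case by (meson rtranclp_trans splits_step)
qed blast

lemma nodes_bslash [simp]: "nodes (bslash s t) = nodes s + nodes t"
  by (induction s) auto

text \<open>Forwards, the splitting of \<open>t\<close> whose left part has the size of
  \<open>r\<close> is carried up the order to a splitting of \<open>bslash r s\<close>; sizes are
  preserved, so it must be \<open>(r, s)\<close>. Backwards, \<open>t\<close> lies below the product
  of the parts of any of its splittings, and this product is monotone.\<close>

lemma tamari_bslash_iff:
  "tamari t (bslash r s) \<longleftrightarrow> (\<exists>(a, b)\<in>set (splits t). tamari a r \<and> tamari b s)"
proof
  assume t: "tamari t (bslash r s)"
  have "nodes r \<in> set [0..<Suc (nodes t)]"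
    using tamari_nodes[OF t] by (auto simp del: upt_Suc)
  then obtain a b where ab: "(a, b) \<in> set (splits t)" "nodes a = nodes r"
    by (auto simp flip: map_fst_nodes_splits simp del: upt_Suc)
  from splits_mono[OF t ab(1)] obtain a' b' where
    a': "(a', b') \<in> set (splits (bslash r s))" "tamari a a'" "tamari b b'" by blast
  with splits_unique[OF a'(1) split_bslash] ab(2) tamari_nodes have "a' = r" "b' = s"
    by metis+
  with a' ab(1) show "\<exists>(a, b)\<in>set (splits t). tamari a r \<and> tamari b s" by blast
next
  assume "\<exists>(a, b)\<in>set (splits t). tamari a r \<and> tamari b s"
  then show "tamari t (bslash r s)"
    using tamari_split tamari_bslash by (blast intro: rtranclp_trans)
qed

text \<open>Comultiplication is dual to \<open>bslash\<close> with respect to the zeta functional of the Tamari order.\<close>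

lemma sum_splits_tamari:
  "(\<Sum>(a, b)\<leftarrow>splits t. of_bool (tamari a r) * of_bool (tamari b s)) =
     (of_bool (tamari t (bslash r s)) :: 'k::field)"
proof -
  let ?S = "{(a, b) \<in> set (splits t). tamari a r \<and> tamari b s}"
  have "(\<Sum>(a, b)\<leftarrow>splits t. of_bool (tamari a r) * of_bool (tamari b s)) =
      (\<Sum>p\<in>set (splits t). of_bool (p \<in> ?S) :: 'k)"
    by (subst sum_list_distinct_conv_sum_set[OF distinct_splits])
       (auto intro!: sum.cong simp: of_bool_def)
  also have "\<dots> = of_nat (card ?S)"
    by (subst sum.mono_neutral_right[of _ ?S]) auto
  \<comment> \<open>Sizes are constant along the order, so at most one splitting qualifies.\<close>
  also have "card ?S = of_bool (tamari t (bslash r s))"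
  proof (cases "tamari t (bslash r s)")
    case True
    then obtain a b where ab: "(a, b) \<in> ?S"
      using tamari_bslash_iff by blast
    then have "p = (a, b)" if "p \<in> ?S" for p
      using that splits_unique[of _ _ t a b] tamari_nodes
      by (metis (mono_tags, lifting) case_prodE mem_Collect_eq prod.inject)
    with ab have "?S = {(a, b)}" by blast
    with True show ?thesis by simp
  qed (use tamari_bslash_iff in \<open>auto simp: card_eq_0_iff\<close>)
  finally show ?thesis by simp
qed

lemma tamari_Leaf_iff [simp]: "tamari Leaf t \<longleftrightarrow> t = Leaf" "tamari t Leaf \<longleftrightarrow> t = Leaf"
  by (auto dest!: tamari_nodes) (metis nodes.simps(2) nat.distinct(1) pbt.exhaust)+

lemma finite_nodes: "finite {t. nodes t = n}"
proof (induction n rule: less_induct)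
  case (less n)
  have "{t. nodes t = n} \<subseteq> insert Leaf (\<Union>i\<in>{..<n}. \<Union>j\<in>{..<n}.
          (\<lambda>(l, r). Node l r) ` ({t. nodes t = i} \<times> {t. nodes t = j}))"
  proof
    fix t assume "t \<in> {t. nodes t = n}"
    then show "t \<in> insert Leaf (\<Union>i\<in>{..<n}. \<Union>j\<in>{..<n}.
          (\<lambda>(l, r). Node l r) ` ({t. nodes t = i} \<times> {t. nodes t = j}))"
      by (cases t) (auto simp: image_iff)
  qed
  moreover have "finite \<dots>"
    using less by auto
  ultimately show ?case by (rule finite_subset)
qed

lemma finite_tamari_above: "finite {s. tamari t s}"
  by (rule finite_subset[OF _ finite_nodes[of "nodes t"]]) (auto dest: tamari_nodes)

section \<open>Coefficients in the monomial basis\<close>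

definition mono_coeff :: "pbt \<Rightarrow> 'k::field ysym \<Rightarrow> 'k" where
  "mono_coeff t = lin_form (\<lambda>s. of_bool (tamari s t))"

lemma mono_coeff_linear [simp]:
  "mono_coeff t 0 = 0" "mono_coeff t (x + y) = mono_coeff t x + mono_coeff t y" "mono_coeff t (fscale c x) = c * mono_coeff t x"
  by (simp_all add: mono_coeff_def)

lemma tamari_antisym: "tamari s t \<Longrightarrow> tamari t s \<Longrightarrow> s = t"
  using tamari_rank_less[of s t] tamari_rank_less[of t s] by fastforce

text \<open>The defining recursion of the Moebius function makes its values sum to zero over every
  interval with more than one element.\<close>

lemma mono_coeff_mono_basis: "mono_coeff s (mono_basis t :: 'k::field ysym) = of_bool (s = t)"
proof -
  let ?I = "{u. tamari t u \<and> tamari u s}"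
  have fin: "finite ?I" by (rule finite_subset[OF _ finite_tamari_above[of t]]) auto
  have "mono_coeff s (mono_basis t :: 'k ysym) =
      (\<Sum>u\<in>{u. tamari t u}. of_int (tamari_mu t u) * of_bool (tamari u s))"
    by (simp add: mono_coeff_def mono_basis_def lin_form_sum)
  also have "\<dots> = (\<Sum>u\<in>?I. of_int (tamari_mu t u))"
    by (rule sum.mono_neutral_cong_right[OF finite_tamari_above]) auto
  also have "\<dots> = of_int (\<Sum>u\<in>?I. tamari_mu t u)" by simp
  also have "(\<Sum>u\<in>?I. tamari_mu t u) = of_bool (s = t)"
  proof (cases "tamari t s")
    case True
    then have I: "?I = insert s {u. tamari t u \<and> tamari u s \<and> u \<noteq> s}" by auto
    show ?thesis
    proof (cases "s = t")
      case True
      then have "?I = {t}" using tamari_antisym by auto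
      then show ?thesis using True by (simp add: tamari_mu.simps)
    next
      case False
      show ?thesis
        using fin False True unfolding I
        by (subst sum.insert) (auto simp: tamari_mu.simps[of t s])
    qed
  next
    case False
    then have "?I = {}" by (auto dest: rtranclp_trans)
    moreover from False have "s \<noteq> t" by auto
    ultimately show ?thesis by (simp only: sum.empty) simp
  qed
  finally show ?thesis by simp
qed

lemma mono_coeff_mono_basis_flip: "mono_coeff s (mono_basis t) = of_bool (t = s)"
  by (simp add: mono_coeff_mono_basis eq_commute)

lemma mono_coeff_eq_0: "(\<And>t. mono_coeff t h = 0) \<Longrightarrow> h = 0"
  by (intro poly_mapping_eqI)
     (simp add: mono_coeff_def zeta_coef_eq_0[where R = tamari and \<rho> = tamari_rank and P = "\<lambda>_. True"]
       tamari_rank_less)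

lemma mono_coeff_ext: "(\<And>t. mono_coeff t h = mono_coeff t h') \<Longrightarrow> h = h'"
  using mono_coeff_eq_0[of "h - h'"] by (simp add: mono_coeff_def)

text \<open>The coordinate vector in the monomial basis, see \<open>coef_mvec\<close>. Defining it
  by linear extension provides the finite support.\<close>

definition mvec :: "'k::field ysym \<Rightarrow> 'k ysym" where
  "mvec = linext (\<lambda>s. \<Sum>t\<in>{t. tamari s t}. fund t)"

lemma coef_mvec [simp]: "coef (mvec h) t = mono_coeff t (h :: 'k::field ysym)"
proof -
  have "coef (\<Sum>t\<in>{t. tamari s t}. fund t :: 'k ysym) t = of_bool (tamari s t)" for s
    by (simp add: coef_sum coef_bvec of_bool_def sum.delta[OF finite_tamari_above])
  then show ?thesis by (simp add: mvec_def coef_linext mono_coeff_def)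
qed

lemma mono_coeff_linext_mono_basis: "mono_coeff t (linext mono_basis x) = coef x t"
  unfolding mono_coeff_def lin_form_linext by (fold mono_coeff_def) (simp add: mono_coeff_mono_basis eq_commute[of t])

lemma mono_basis_expansion: "linext mono_basis (mvec h) = h"
  by (rule mono_coeff_ext) (simp add: mono_coeff_linext_mono_basis)

lemma lin_form_mono_basis: "lin_form f h = lin_form (\<lambda>t. lin_form f (mono_basis t)) (mvec h)"
  by (subst mono_basis_expansion[of h, symmetric]) (simp add: lin_form_linext)

lemma mono_basis_Leaf: "mono_basis Leaf = fund Leaf"
proof -
  have "{s. tamari Leaf s} = {Leaf}"
    by auto
  then show ?thesis by (simp add: mono_basis_def tamari_mu.simps)
qed

section \<open>The coradical filtration\<close>

text \<open>The factorizations of a tree as a backslash product, one for each gap before, between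
  and after its irreducible components.\<close>

primrec deconcs :: "pbt \<Rightarrow> (pbt \<times> pbt) list" where
  "deconcs Leaf = [(Leaf, Leaf)]"
| "deconcs (Node l r) = (Leaf, Node l r) # map (\<lambda>(a, b). (Node l a, b)) (deconcs r)"

lemma bslash_eq_deconcs: "(a, b) \<in> set (deconcs t) \<Longrightarrow> bslash a b = t"
  by (induction t arbitrary: a b) auto

lemma sum_deconcs:
  "(\<Sum>(a, b)\<leftarrow>deconcs t. of_bool (a = r) * of_bool (b = s)) = (of_bool (t = bslash r s) :: 'k::field)"
proof (induction t arbitrary: r)
  case Leaf
  show ?case by (cases r) auto
next
  case (Node x y)
  show ?case
  proof (cases r)
    case Leaf
    then show ?thesis by (simp add: case_prod_unfold o_def)
  next
    case r: (Node x' r')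
    show ?thesis
      using Node.IH(2)[of r'] by (cases "x = x'") (simp_all add: r case_prod_unfold o_def)
  qed
qed

lemma lin_form_ysym_tensor:
  "lin_form F (ysym_tensor x y) = lin_form (\<lambda>a. lin_form (\<lambda>b. F (a, b)) y) x"
  by (simp add: ysym_tensor_def lin_form_bilinext)

lemma lin_form_ysym_comul:
  "lin_form F (ysym_comul h) = lin_form (\<lambda>t. \<Sum>p\<leftarrow>splits t. F p) h"
  by (simp add: ysym_comul_def lin_form_linext lin_form_sum_list)

definition mono_coeff2 :: "pbt \<Rightarrow> pbt \<Rightarrow> (pbt \<times> pbt \<Rightarrow>\<^sub>0 'k::field) \<Rightarrow> 'k" where
  "mono_coeff2 r s = lin_form (\<lambda>(a, b). of_bool (tamari a r) * of_bool (tamari b s))"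

lemma mono_coeff2_ysym_comul: "mono_coeff2 r s (ysym_comul h) = mono_coeff (bslash r s) h"
  unfolding mono_coeff2_def lin_form_ysym_comul sum_splits_tamari mono_coeff_def ..

lemma mono_coeff2_ysym_tensor: "mono_coeff2 r s (ysym_tensor a b) = mono_coeff r a * mono_coeff s b"
  by (simp add: mono_coeff2_def mono_coeff_def lin_form_ysym_tensor lin_form_fun_cmult lin_form_fun_multc)

lemma mono_coeff2_sum_list: "mono_coeff2 r s (\<Sum>i\<leftarrow>xs. x i) = (\<Sum>i\<leftarrow>xs. mono_coeff2 r s (x i))"
  by (simp add: mono_coeff2_def lin_form_sum_list)

text \<open>Zeta sums for the product of two Tamari orders, ranked by the sum of the ranks.\<close>

lemma mono_coeff2_eq_0:
  assumes "\<And>r s. mono_coeff2 r s T = 0"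
  shows "T = 0"
proof -
  let ?R = "\<lambda>p q. tamari (fst p) (fst q) \<and> tamari (snd p) (snd q)"
  have "coef T p = 0" for p
  proof (rule zeta_coef_eq_0[where R = ?R
        and \<rho> = "\<lambda>p. tamari_rank (fst p) + tamari_rank (snd p)" and P = "\<lambda>_. True"])
    fix p q assume "?R q p" "q \<noteq> p"
    then show "tamari_rank (fst q) + tamari_rank (snd q) < tamari_rank (fst p) + tamari_rank (snd p)"
      using tamari_rank_less[of "fst q" "fst p"] tamari_rank_less[of "snd q" "snd p"]
      by (cases "fst q = fst p"; cases "snd q = snd p") (auto simp: prod_eq_iff)
  next
    fix p
    show "lin_form (\<lambda>q. of_bool (?R q p)) T = 0"
      using assms[of "fst p" "snd p"] by (simp add: mono_coeff2_def case_prod_unfold of_bool_conj)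
  qed auto
  then show ?thesis by (intro poly_mapping_eqI) simp
qed

lemma mono_coeff2_ext: "(\<And>r s. mono_coeff2 r s T = mono_coeff2 r s T') \<Longrightarrow> T = T'"
  using mono_coeff2_eq_0[of "T - T'"] by (simp add: mono_coeff2_def)

text \<open>At \<open>(r, s)\<close> both sides have coefficient 1 if \<open>t = bslash r s\<close>
  and 0 otherwise: on the left by the duality of comultiplication and \<open>bslash\<close>, on the
  right because \<open>deconcs\<close> lists each factorization once.\<close>

lemma ysym_comul_mono_basis:
  "ysym_comul (mono_basis t) = (\<Sum>(a, b)\<leftarrow>deconcs t. ysym_tensor (mono_basis a) (mono_basis b) :: pbt \<times> pbt \<Rightarrow>\<^sub>0 'k::field)"
proof (rule mono_coeff2_ext)
  fix r s
  have "mono_coeff2 r s (\<Sum>(a, b)\<leftarrow>deconcs t. ysym_tensor (mono_basis a) (mono_basis b) :: pbt \<times> pbt \<Rightarrow>\<^sub>0 'k) =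
      (\<Sum>(a, b)\<leftarrow>deconcs t. of_bool (a = r) * of_bool (b = s))"
    by (simp add: case_prod_unfold mono_coeff2_sum_list mono_coeff2_ysym_tensor mono_coeff_mono_basis eq_commute)
  then show "mono_coeff2 r s (ysym_comul (mono_basis t)) =
      mono_coeff2 r s (\<Sum>(a, b)\<leftarrow>deconcs t. ysym_tensor (mono_basis a) (mono_basis b) :: pbt \<times> pbt \<Rightarrow>\<^sub>0 'k)"
    by (simp add: sum_deconcs mono_coeff2_ysym_comul mono_coeff_mono_basis eq_commute)
qed

lemma lin_form_ysym_iter_comul:
  "lin_form F (ysym_iter_comul k h) = lin_form (\<lambda>t. \<Sum>w\<leftarrow>iter_splits k t. F w) h"
  by (simp add: ysym_iter_comul_def lin_form_linext lin_form_sum_list)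

lemma sum_iter_splits_tamari:
  "length ws = Suc k \<Longrightarrow> (\<Sum>w\<leftarrow>iter_splits k t. of_bool (list_all2 tamari w ws)) =
     (of_bool (tamari t (foldr bslash ws Leaf)) :: 'k::field)"
proof (induction k arbitrary: t ws)
  case 0
  then show ?case by (auto simp: length_Suc_conv)
next
  case (Suc k)
  then obtain u us where ws: "ws = u # us" and us: "length us = Suc k"
    by (auto simp: length_Suc_conv)
  have "(\<Sum>w\<leftarrow>iter_splits (Suc k) t. of_bool (list_all2 tamari w ws)) =
      (\<Sum>(a, b)\<leftarrow>splits t. of_bool (tamari a u) *
         (\<Sum>w\<leftarrow>iter_splits k b. of_bool (list_all2 tamari w us)) :: 'k)"
    by (simp add: ws case_prod_unfold sum_list_concat_map o_def of_bool_conj sum_list_const_mult)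
  also have "\<dots> = of_bool (tamari t (foldr bslash ws Leaf))"
    by (simp add: Suc.IH[OF us] sum_splits_tamari ws)
  finally show ?case .
qed

text \<open>All factors but the last are single irreducible components. The last one takes the rest,
  which is nontrivial because of the strict inequality.\<close>

lemma foldr_bslash_decomposition:
  "k < ncomp t \<Longrightarrow> \<exists>ws. length ws = Suc k \<and> Leaf \<notin> set ws \<and> foldr bslash ws Leaf = t"
proof (induction k arbitrary: t)
  case 0
  then show ?case by (intro exI[of _ "[t]"]) auto
next
  case (Suc k)
  then obtain l r where t: "t = Node l r" and "k < ncomp r" by (cases t) auto
  with Suc.IH obtain ws where "length ws = Suc k" "Leaf \<notin> set ws" "foldr bslash ws Leaf = r"
    by blast
  with t show ?case by (intro exI[of _ "Node l Leaf # ws"]) auto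
qed

lemma ncomp_foldr_bslash: "Leaf \<notin> set ws \<Longrightarrow> length ws \<le> ncomp (foldr bslash ws Leaf)"
proof (induction ws)
  case (Cons w ws)
  then have "ncomp w \<noteq> 0" by (cases w) auto
  with Cons show ?case by auto
qed simp

lemma length_iter_splits: "w \<in> set (iter_splits k t) \<Longrightarrow> length w = Suc k"
  by (induction k arbitrary: t w) auto

lemma list_all2_tamari_rank:
  "list_all2 tamari v w \<Longrightarrow> v \<noteq> w \<Longrightarrow> (\<Sum>t\<leftarrow>v. tamari_rank t) < (\<Sum>t\<leftarrow>w. tamari_rank t)"
proof (induction rule: list_all2_induct)
  case (Cons x xs y ys)
  then show ?case
    using tamari_rank_less[of x y] by (cases "x = y"; cases "xs = ys") auto
qed simp

text \<open>For a word \<open>ws\<close> of length \<open>k + 1\<close>, the zeta sum of the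
  iterated coproduct at \<open>ws\<close> is the monomial coefficient at the product of
  \<open>ws\<close>. The trees with more than \<open>k\<close> components are the products of such
  words without \<open>Leaf\<close>. So the equations say that these zeta sums vanish, which by
  triangularity means that every word in the iterated coproduct contains
  \<open>Leaf\<close>.\<close>

theorem corad_iff: "h \<in> corad k \<longleftrightarrow> (\<forall>t. k < ncomp t \<longrightarrow> mono_coeff t h = 0)"
proof
  let ?S = "\<Union>i\<le>k. {bvec (u @ [Leaf] @ v) | u v. length u = i \<and> length v = k - i}
     :: (pbt list \<Rightarrow>\<^sub>0 'a) set"
  have mono_coeff: "mono_coeff (foldr bslash ws Leaf) h =
      lin_form (\<lambda>w. of_bool (list_all2 tamari w ws)) (ysym_iter_comul k h)" if "length ws = Suc k" for ws
    unfolding lin_form_ysym_iter_comul sum_iter_splits_tamari[OF that] mono_coeff_def ..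
  {
    assume "h \<in> corad k"
    then have in_span: "ysym_iter_comul k h \<in> fvs.span ?S" by (simp add: corad_def)
    show "\<forall>t. k < ncomp t \<longrightarrow> mono_coeff t h = 0"
    proof (intro allI impI)
      fix t assume "k < ncomp t"
      then obtain ws where ws: "length ws = Suc k" "Leaf \<notin> set ws" "foldr bslash ws Leaf = t"
        using foldr_bslash_decomposition by blast
      let ?f = "\<lambda>w. of_bool (list_all2 tamari w ws) :: 'a"
      \<comment> \<open>\<open>Leaf\<close> is comparable only to itself, so a word containing it is
        not below \<open>ws\<close>.\<close>
      have "lin_form ?f x = 0" if "x \<in> ?S" for x
        using that ws(2) by (auto simp: list_all2_append1 list_all2_Cons1)
      then have "?S \<subseteq> {x. lin_form ?f x = 0}" by blast
      moreover have "fvs.subspace {x. lin_form ?f x = 0}"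
        by (rule fvs.subspaceI) auto
      ultimately have "fvs.span ?S \<subseteq> {x. lin_form ?f x = 0}"
        by (rule fvs.span_minimal)
      with in_span ws mono_coeff show "mono_coeff t h = 0" by auto
    qed
  next
    assume zero: "\<forall>t. k < ncomp t \<longrightarrow> mono_coeff t h = 0"
    let ?X = "ysym_iter_comul k h"
    let ?P = "\<lambda>w. length w = Suc k \<and> Leaf \<notin> set w"
    have "coef ?X w = 0" if "?P w" for w
      using that
    proof (rule zeta_coef_eq_0[where R = "list_all2 tamari"
          and \<rho> = "\<lambda>w. \<Sum>t\<leftarrow>w. tamari_rank t" and P = ?P, rotated -1])
      fix v w assume "?P w" "list_all2 tamari v w"
      then show "?P v"
        by (auto simp: list_all2_conv_all_nth in_set_conv_nth)
    next
      fix w assume "?P w"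
      with mono_coeff[of w] zero ncomp_foldr_bslash[of w]
      show "lin_form (\<lambda>b. of_bool (list_all2 tamari b w)) ?X = 0" by auto
    qed (auto intro: list_all2_tamari_rank list.rel_refl)
    moreover have "coef ?X w = 0" if "length w \<noteq> Suc k" for w
    proof -
      have "(\<Sum>v\<leftarrow>iter_splits k t. of_bool (v = w)) = (0 :: 'a)" for t
      proof -
        have "map (\<lambda>v. of_bool (v = w)) (iter_splits k t) = map (\<lambda>v. 0 :: 'a) (iter_splits k t)"
          using that length_iter_splits[of w k t] by auto
        then show ?thesis by (simp only: sum_list_0)
      qed
      then show ?thesis
        by (simp flip: lin_form_of_bool add: lin_form_ysym_iter_comul)
    qed
    ultimately have keys: "length w = Suc k \<and> Leaf \<in> set w" if "w \<in> Poly_Mapping.keys ?X" for w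
      using that by (auto simp: in_keys_iff)
    have "linext bvec ?X \<in> fvs.span ?S"
    proof (rule linext_in_span, rule fvs.span_base)
      fix w assume "w \<in> Poly_Mapping.keys ?X"
      with keys obtain u v where "w = u @ [Leaf] @ v" "length w = Suc k"
        by (metis append_Cons append_Nil split_list)
      moreover from this have "length v = k - length u" "length u \<le> k" by auto
      ultimately show "bvec w \<in> ?S" by blast
    qed
    then show "h \<in> corad k" by (simp add: corad_def)
  }
qed

lemma mono_basis_in_corad: "ncomp t \<le> k \<Longrightarrow> mono_basis t \<in> corad k"
  by (auto simp: corad_iff mono_coeff_mono_basis)

section \<open>Coordinates on the associated graded space\<close>

definition ncomp_part :: "nat \<Rightarrow> 'k::field ysym \<Rightarrow> 'k ysym" where
  "ncomp_part k = linext (\<lambda>t. if ncomp t = k then fund t else 0)"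

lemma coef_ncomp_part: "coef (ncomp_part k x) t = (if ncomp t = k then coef x t else 0)"
proof -
  have "coef (ncomp_part k x) t = lin_form (\<lambda>s. if ncomp t = k then of_bool (s = t) else 0) x"
    unfolding ncomp_part_def coef_linext by (rule lin_form_cong) (auto simp: coef_bvec)
  then show ?thesis by auto
qed

lemma lin_form_ncomp_part: "lin_form f (ncomp_part k x) = lin_form (\<lambda>t. if ncomp t = k then f t else 0) x"
  unfolding ncomp_part_def lin_form_linext by (rule lin_form_cong) auto

lemma corad_belowD: "h \<in> corad_below k \<Longrightarrow> k \<le> ncomp t \<Longrightarrow> mono_coeff t h = 0"
  by (auto simp: corad_below_def corad_iff mono_coeff_def split: if_splits)

lemma corad_belowI:
  assumes "h \<in> corad k" "\<And>t. ncomp t = k \<Longrightarrow> mono_coeff t h = 0"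
  shows "h \<in> corad_below k"
proof (cases k)
  case 0
  have "mono_coeff t h = 0" for t
    using assms 0 by (cases "ncomp t") (auto simp: corad_iff)
  then show ?thesis using 0 mono_coeff_eq_0 by (auto simp: corad_below_def)
next
  case (Suc j)
  then have "mono_coeff t h = 0" if "j < ncomp t" for t
    using assms that by (cases "ncomp t = k") (auto simp: corad_iff)
  with Suc show ?thesis by (simp add: corad_below_def corad_iff)
qed

text \<open>A class in the \<open>k\<close>-th quotient remembers exactly the monomial coefficients
  at trees with \<open>k\<close> components, so only these are kept from the \<open>k\<close>-th
  entry. By \<open>coef_gr_coords_abs\<close> any other representative gives the same
  vector.\<close>

definition gr_coords :: "'k::field gr \<Rightarrow> 'k ysym" where
  "gr_coords X = (\<Sum>k\<in>Poly_Mapping.keys (rep_gr X). ncomp_part k (mvec (coef (rep_gr X) k)))"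

lemma coef_gr_coords: "coef (gr_coords X) t = mono_coeff t (coef (rep_gr X) (ncomp t))"
proof -
  have "coef (gr_coords X) t =
      (\<Sum>k\<in>Poly_Mapping.keys (rep_gr X). if k = ncomp t then mono_coeff t (coef (rep_gr X) k) else 0)"
    unfolding gr_coords_def coef_sum by (rule sum.cong) (auto simp: coef_ncomp_part)
  then show ?thesis
    by (auto simp: in_keys_iff mono_coeff_def)
qed

lemma rep_gr_in_corad: "coef (rep_gr X) k \<in> corad k"
  using Quotient_rep_reflp[OF Quotient_gr, of X] by (simp add: gr_rel_def)

lemma abs_rep_gr: "abs_gr (rep_gr X) = X"
  by (rule Quotient_abs_rep[OF Quotient_gr])

lemma gr_rel_refl_iff: "gr_rel x x \<longleftrightarrow> (\<forall>k. coef x k \<in> corad k)"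
  by (auto simp: gr_rel_def fvs.subspace_0[OF subspace_corad_below])

lemma coef_gr_coords_abs:
  assumes "gr_rel x x"
  shows "coef (gr_coords (abs_gr x)) t = mono_coeff t (coef x (ncomp t))"
proof -
  have "gr_rel (rep_gr (abs_gr x)) x"
    using assms by (rule Quotient_rep_abs[OF Quotient_gr])
  then have "coef (rep_gr (abs_gr x)) (ncomp t) - coef x (ncomp t) \<in> corad_below (ncomp t)"
    by (simp add: gr_rel_def)
  from corad_belowD[OF this order_refl] show ?thesis
    by (simp add: coef_gr_coords mono_coeff_def)
qed

lemma gr_rel_rep: "gr_rel (rep_gr X) (rep_gr X)"
  by (simp add: gr_rel_refl_iff rep_gr_in_corad)

lemma gr_coords_inject: "gr_coords X = gr_coords Y \<longleftrightarrow> X = Y"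
proof
  assume eq: "gr_coords X = gr_coords Y"
  have "coef (rep_gr X) k - coef (rep_gr Y) k \<in> corad_below k" for k
  proof (rule corad_belowI)
    show "coef (rep_gr X) k - coef (rep_gr Y) k \<in> corad k"
      by (intro fvs.subspace_diff[OF subspace_corad] rep_gr_in_corad)
    fix t assume "ncomp t = k"
    then show "mono_coeff t (coef (rep_gr X) k - coef (rep_gr Y) k) = 0"
      using arg_cong[OF eq, of "\<lambda>x. coef x t"] by (simp add: coef_gr_coords mono_coeff_def)
  qed
  then have "gr_rel (rep_gr X) (rep_gr Y)"
    by (simp add: gr_rel_def rep_gr_in_corad)
  then show "X = Y"
    using Quotient_rel_abs[OF Quotient_gr] abs_rep_gr by metis
qed simp

lemma gr_coords_add: "gr_coords (X + Y) = gr_coords X + gr_coords Y"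
proof (rule poly_mapping_eqI)
  fix t
  have "gr_rel (rep_gr X + rep_gr Y) (rep_gr X + rep_gr Y)"
    by (simp add: gr_rel_refl_iff lookup_add rep_gr_in_corad fvs.subspace_add[OF subspace_corad])
  moreover have "abs_gr (rep_gr X + rep_gr Y) = X + Y"
    using plus_gr.abs_eq[OF gr_rel_rep gr_rel_rep, of X Y] by (simp add: abs_rep_gr)
  ultimately have "coef (gr_coords (X + Y)) t = mono_coeff t (coef (rep_gr X + rep_gr Y) (ncomp t))"
    using coef_gr_coords_abs by metis
  then show "coef (gr_coords (X + Y)) t = coef (gr_coords X + gr_coords Y) t"
    by (simp add: lookup_add coef_gr_coords mono_coeff_def)
qed

lemma gr_coords_scale: "gr_coords (gr_scale c X) = fscale c (gr_coords X)"
proof (rule poly_mapping_eqI)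
  fix t
  let ?x = "Poly_Mapping.map (fscale c) (rep_gr X)"
  have coef: "coef ?x k = fscale c (coef (rep_gr X) k)" for k
    by (simp add: Poly_Mapping.map.rep_eq when_def)
  have "gr_rel ?x ?x"
    by (simp add: gr_rel_refl_iff coef rep_gr_in_corad fvs.subspace_scale[OF subspace_corad])
  moreover have "abs_gr ?x = gr_scale c X"
    using gr_scale.abs_eq[OF gr_rel_rep, of c X] by (simp add: abs_rep_gr)
  ultimately have "coef (gr_coords (gr_scale c X)) t = mono_coeff t (coef ?x (ncomp t))"
    using coef_gr_coords_abs by metis
  then show "coef (gr_coords (gr_scale c X)) t = coef (fscale c (gr_coords X)) t"
    by (simp add: coef coef_gr_coords mono_coeff_def)
qed

lemma gr_coords_0: "gr_coords 0 = 0"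
  using gr_coords_add[of 0 0] by simp

lemma gr_coords_sum: "gr_coords (\<Sum>i\<in>I. X i) = (\<Sum>i\<in>I. gr_coords (X i))"
  by (induction I rule: infinite_finite_induct) (auto simp: gr_coords_0 gr_coords_add)

lemma gr_coords_class:
  assumes "h \<in> corad k"
  shows "gr_coords (gr_class k h) = ncomp_part k (mvec h)"
proof (rule poly_mapping_eqI)
  fix t
  have "gr_rel (Poly_Mapping.single k h) (Poly_Mapping.single k h)"
    using assms by (auto simp: gr_rel_refl_iff lookup_single when_def fvs.subspace_0[OF subspace_corad])
  from coef_gr_coords_abs[OF this] show "coef (gr_coords (gr_class k h)) t = coef (ncomp_part k (mvec h)) t"
    by (auto simp: gr_class_def coef_ncomp_part lookup_single when_def mono_coeff_def)
qed

lemma mvec_mono_basis: "mvec (mono_basis t) = fund t"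
  by (rule poly_mapping_eqI) (simp add: mono_coeff_mono_basis coef_bvec eq_commute)

lemma gr_coords_mono [simp]: "gr_coords (gr_mono t) = fund t"
  by (rule poly_mapping_eqI)
     (auto simp: gr_mono_def gr_coords_class mono_basis_in_corad mvec_mono_basis coef_ncomp_part coef_bvec)

lemma gr_unit_eq: "gr_unit = gr_mono Leaf"
  by (simp add: gr_unit_def gr_mono_def mono_basis_Leaf)

definition gr_of :: "'k::field ysym \<Rightarrow> 'k gr" where
  "gr_of x = (\<Sum>t\<in>Poly_Mapping.keys x. gr_scale (coef x t) (gr_mono t))"

lemma gr_coords_gr_of [simp]: "gr_coords (gr_of x) = x"
  using linext_bvec[of x] unfolding linext_def by (simp add: gr_of_def gr_coords_sum gr_coords_scale)

lemma gr_of_gr_coords [simp]: "gr_of (gr_coords X) = X"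
  by (simp flip: gr_coords_inject)

lemma linear_eq_lin_form:
  assumes "Vector_Spaces.linear gr_scale (*) f"
  shows "f X = lin_form (\<lambda>t. f (gr_mono t)) (gr_coords X)"
proof -
  have "f X = f (gr_of (gr_coords X))" by simp
  also have "\<dots> = lin_form (\<lambda>t. f (gr_mono t)) (gr_coords X)"
    unfolding gr_of_def lin_form_def
    by (simp add: gr_ground.linear_sum[OF assms] gr_ground.linear_scale[OF assms])
  finally show ?thesis .
qed

lemma linear_lin_form_gr_coords: "Vector_Spaces.linear gr_scale (*) (\<lambda>X. lin_form f (gr_coords X))"
  by (auto simp: Vector_Spaces.linear_iff gr_coords_add gr_coords_scale intro: gr.vector_space_axioms ground.vector_space_axioms)

lemma gr_homog_iff: "X \<in> gr_homog n \<longleftrightarrow> (\<forall>t. coef (gr_coords X) t \<noteq> 0 \<longrightarrow> nodes t = n)"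
proof
  let ?V = "{X. \<forall>t. coef (gr_coords X) t \<noteq> 0 \<longrightarrow> nodes t = n}"
  assume "X \<in> gr_homog n"
  moreover have "gr.span {gr_mono t | t. nodes t = n} \<subseteq> ?V"
  proof (rule gr.span_minimal)
    show "gr.subspace ?V"
      by (rule gr.subspaceI) (auto simp: gr_coords_0 gr_coords_add gr_coords_scale lookup_add, metis add_0)
  qed (auto simp: coef_bvec)
  ultimately show "\<forall>t. coef (gr_coords X) t \<noteq> 0 \<longrightarrow> nodes t = n"
    by (auto simp: gr_homog_def)
next
  assume "\<forall>t. coef (gr_coords X) t \<noteq> 0 \<longrightarrow> nodes t = n"
  then have "gr_of (gr_coords X) \<in> gr_homog n"
    unfolding gr_of_def gr_homog_def
    by (intro gr.span_sum gr.span_scale gr.span_base) (auto simp: in_keys_iff)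
  then show "X \<in> gr_homog n" by simp
qed

lemma lin_form_eq_gr_counit: "gr_counit X = coef (gr_coords X) Leaf"
proof -
  have "mono_coeff Leaf h = coef h Leaf" for h :: "'a ysym"
    by (simp add: mono_coeff_def)
  then show ?thesis by (simp add: gr_counit_def ysym_counit_def coef_gr_coords)
qed

section \<open>Products in the monomial basis\<close>

text \<open>The indices of the terms of the product of \<open>fund s\<close> and \<open>fund t\<close>, by recursion on \<open>t\<close>.\<close>

primrec prod_terms :: "pbt \<Rightarrow> pbt \<Rightarrow> pbt list" where
  "prod_terms s Leaf = [s]"
| "prod_terms s (Node l r) =
     concat (map (\<lambda>(a, b). concat (map (\<lambda>x. map (Node x) (prod_terms b r)) (prod_terms a l))) (splits s))"

lemma sum_prod_terms_Node:
  "(\<Sum>u\<leftarrow>prod_terms s (Node l r). F u) =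
     (\<Sum>(a, b)\<leftarrow>splits s. \<Sum>x\<leftarrow>prod_terms a l. \<Sum>y\<leftarrow>prod_terms b r. F (Node x y))"
  by (simp add: sum_list_concat_map sum_list_map_map case_prod_unfold o_def)

lemma sum_splits_Node:
  "(\<Sum>(a, b)\<leftarrow>splits (Node l r). F a b) =
     (\<Sum>(a, b)\<leftarrow>splits l. F a (Node b r)) + (\<Sum>(a, b)\<leftarrow>splits r. F (Node l a) b)"
  by (simp add: case_prod_unfold o_def)

text \<open>Both sides run over the ways to cut \<open>s\<close> at two leaves, possibly equal. In
  the inductive step, the cuts with one leaf in each subtree are the ones that require an exchange
  of sums.\<close>

lemma splits_coassoc:
  fixes F :: "pbt \<Rightarrow> pbt \<Rightarrow> pbt \<Rightarrow> 'a::comm_monoid_add"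
  shows "(\<Sum>(a, b)\<leftarrow>splits s. \<Sum>(b0, b1)\<leftarrow>splits b. F a b0 b1) =
    (\<Sum>(a, b)\<leftarrow>splits s. \<Sum>(a0, a1)\<leftarrow>splits a. F a0 a1 b)"
proof (induction s arbitrary: F)
  case (Node l r)
  show ?case
    unfolding sum_splits_Node sum_list_split_addf Node.IH(1)[of "\<lambda>a b c. F a b (Node c r)"]
      Node.IH(2)[of "\<lambda>a b c. F (Node l a) b c"]
      sum_list_swap_split[of _ "splits r" "splits l"] add.assoc ..
qed simp

lemma sum_iter_splits_Suc:
  "(\<Sum>w\<leftarrow>iter_splits (Suc k) s. F w) = (\<Sum>(a, b)\<leftarrow>splits s. \<Sum>w\<leftarrow>iter_splits k b. F (a # w))"
  by (simp add: sum_list_concat_map sum_list_map_map case_prod_unfold o_def)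

text \<open>Coassociativity in the form that matches grafting: the first \<open>p + 1\<close> and
  the last \<open>q + 1\<close> letters belong to the leaves of the left and of the right subtree
  when these have \<open>p\<close> and \<open>q\<close> nodes.\<close>

lemma iter_splits_add:
  fixes F :: "pbt list \<Rightarrow> pbt list \<Rightarrow> 'a::comm_monoid_add"
  shows "(\<Sum>w\<leftarrow>iter_splits (Suc (p + q)) s. F (take (Suc p) w) (drop (Suc p) w)) =
    (\<Sum>(a, b)\<leftarrow>splits s. \<Sum>u\<leftarrow>iter_splits p a. \<Sum>v\<leftarrow>iter_splits q b. F u v)"
proof (induction p arbitrary: s F)
  case 0
  show ?case unfolding add_0 sum_iter_splits_Suc by simp
next
  case (Suc p)
  have "(\<Sum>w\<leftarrow>iter_splits (Suc (Suc p + q)) s. F (take (Suc (Suc p)) w) (drop (Suc (Suc p)) w)) =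
      (\<Sum>(a, b)\<leftarrow>splits s. \<Sum>w\<leftarrow>iter_splits (Suc (p + q)) b. F (a # take (Suc p) w) (drop (Suc p) w))"
    unfolding sum_iter_splits_Suc[where k = "Suc p + q"] by (simp del: iter_splits.simps(2))
  also have "\<dots> = (\<Sum>(a, b)\<leftarrow>splits s. \<Sum>(b0, b1)\<leftarrow>splits b.
      \<Sum>u\<leftarrow>iter_splits p b0. \<Sum>v\<leftarrow>iter_splits q b1. F (a # u) v)"
    unfolding Suc.IH[of "\<lambda>u v. F (_ # u) v"] ..
  also have "\<dots> = (\<Sum>(a, b)\<leftarrow>splits s. \<Sum>u\<leftarrow>iter_splits (Suc p) a. \<Sum>v\<leftarrow>iter_splits q b. F u v)"
    unfolding splits_coassoc[of "\<lambda>a b0 b1. \<Sum>u\<leftarrow>iter_splits p b0. \<Sum>v\<leftarrow>iter_splits q b1. F (a # u) v"]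
      sum_iter_splits_Suc ..
  finally show ?case .
qed

lemma sum_graft:
  fixes F :: "pbt \<Rightarrow> 'a::comm_monoid_add"
  shows "(\<Sum>w\<leftarrow>iter_splits (nodes t) s. F (graft w t)) = (\<Sum>u\<leftarrow>prod_terms s t. F u)"
proof (induction t arbitrary: s F)
  case (Node l r)
  have "(\<Sum>w\<leftarrow>iter_splits (nodes (Node l r)) s. F (graft w (Node l r))) =
      (\<Sum>w\<leftarrow>iter_splits (Suc (nodes l + nodes r)) s.
        F (Node (graft (take (Suc (nodes l)) w) l) (graft (drop (Suc (nodes l)) w) r)))"
    by (simp del: iter_splits.simps(2))
  also have "\<dots> = (\<Sum>(a, b)\<leftarrow>splits s. \<Sum>u\<leftarrow>iter_splits (nodes l) a. \<Sum>v\<leftarrow>iter_splits (nodes r) b.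
        F (Node (graft u l) (graft v r)))"
    by (rule iter_splits_add)
  also have "\<dots> = (\<Sum>u\<leftarrow>prod_terms s (Node l r). F u)"
    unfolding sum_prod_terms_Node Node.IH(2)[of "\<lambda>v. F (Node _ v)"]
      Node.IH(1)[of "\<lambda>u. \<Sum>v\<leftarrow>prod_terms _ r. F (Node u v)"] ..
  finally show ?case .
qed simp

lemma lin_form_ysym_mul:
  "lin_form F (ysym_mul x y) = lin_form (\<lambda>s. lin_form (\<lambda>t. \<Sum>u\<leftarrow>prod_terms s t. F u) y) x"
  by (simp add: ysym_mul_def lin_form_bilinext lin_form_sum_list sum_graft)

text \<open>This is the multiplicativity of the coproduct of YSym.\<close>

lemma sum_splits_prod_terms:
  fixes F :: "pbt \<Rightarrow> pbt \<Rightarrow> 'a::comm_monoid_add"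
  shows "(\<Sum>u\<leftarrow>prod_terms s t. \<Sum>(a, b)\<leftarrow>splits u. F a b) =
    (\<Sum>(s0, s1)\<leftarrow>splits s. \<Sum>(t0, t1)\<leftarrow>splits t. \<Sum>a\<leftarrow>prod_terms s0 t0. \<Sum>b\<leftarrow>prod_terms s1 t1. F a b)"
proof (induction t arbitrary: s F)
  case (Node l r)
  \<comment> \<open>The cut passes through the left subtree \<open>x\<close> of a product term.
    Coassociativity regroups the three parts of \<open>s\<close>: the first stays to the left of the
    cut, the other two go to its right.\<close>
  have "(\<Sum>(a, b)\<leftarrow>splits s. \<Sum>x\<leftarrow>prod_terms a l. \<Sum>y\<leftarrow>prod_terms b r. \<Sum>(x0, x1)\<leftarrow>splits x. F x0 (Node x1 y)) =
      (\<Sum>(a, b)\<leftarrow>splits s. \<Sum>x\<leftarrow>prod_terms a l. \<Sum>(x0, x1)\<leftarrow>splits x. \<Sum>y\<leftarrow>prod_terms b r. F x0 (Node x1 y))"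
    unfolding sum_list_swap_split'[of _ _ "prod_terms _ r"] ..
  also have "\<dots> = (\<Sum>(a, b)\<leftarrow>splits s. \<Sum>(a0, a1)\<leftarrow>splits a. \<Sum>(l0, l1)\<leftarrow>splits l.
      \<Sum>x0\<leftarrow>prod_terms a0 l0. \<Sum>x1\<leftarrow>prod_terms a1 l1. \<Sum>y\<leftarrow>prod_terms b r. F x0 (Node x1 y))"
    unfolding Node.IH(1)[of "\<lambda>x0 x1. \<Sum>y\<leftarrow>prod_terms _ r. F x0 (Node x1 y)"] ..
  also have "\<dots> = (\<Sum>(a0, c)\<leftarrow>splits s. \<Sum>(a1, b)\<leftarrow>splits c. \<Sum>(l0, l1)\<leftarrow>splits l.
      \<Sum>x0\<leftarrow>prod_terms a0 l0. \<Sum>x1\<leftarrow>prod_terms a1 l1. \<Sum>y\<leftarrow>prod_terms b r. F x0 (Node x1 y))"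
    by (rule splits_coassoc[symmetric])
  also have "\<dots> = (\<Sum>(a0, c)\<leftarrow>splits s. \<Sum>(l0, l1)\<leftarrow>splits l. \<Sum>(a1, b)\<leftarrow>splits c.
      \<Sum>x0\<leftarrow>prod_terms a0 l0. \<Sum>x1\<leftarrow>prod_terms a1 l1. \<Sum>y\<leftarrow>prod_terms b r. F x0 (Node x1 y))"
    unfolding sum_list_swap_split[of _ "splits l"] ..
  also have "\<dots> = (\<Sum>(s0, s1)\<leftarrow>splits s. \<Sum>(l0, l1)\<leftarrow>splits l. \<Sum>a\<leftarrow>prod_terms s0 l0.
      \<Sum>b\<leftarrow>prod_terms s1 (Node l1 r). F a b)"
    unfolding sum_prod_terms_Node sum_list_swap_split' ..
  finally have 1: "(\<Sum>(a, b)\<leftarrow>splits s. \<Sum>x\<leftarrow>prod_terms a l. \<Sum>y\<leftarrow>prod_terms b r.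
      \<Sum>(x0, x1)\<leftarrow>splits x. F x0 (Node x1 y)) = \<dots>" .
  \<comment> \<open>The mirror case: the cut passes through the right subtree \<open>y\<close>, and
    the first two parts of \<open>s\<close> stay to its left.\<close>
  have "(\<Sum>(a, b)\<leftarrow>splits s. \<Sum>x\<leftarrow>prod_terms a l. \<Sum>y\<leftarrow>prod_terms b r. \<Sum>(y0, y1)\<leftarrow>splits y. F (Node x y0) y1) =
      (\<Sum>(a, b)\<leftarrow>splits s. \<Sum>x\<leftarrow>prod_terms a l. \<Sum>(b0, b1)\<leftarrow>splits b. \<Sum>(r0, r1)\<leftarrow>splits r.
        \<Sum>y0\<leftarrow>prod_terms b0 r0. \<Sum>y1\<leftarrow>prod_terms b1 r1. F (Node x y0) y1)"
    unfolding Node.IH(2)[of "\<lambda>y0 y1. F (Node _ y0) y1"] ..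
  also have "\<dots> = (\<Sum>(a, b)\<leftarrow>splits s. \<Sum>(b0, b1)\<leftarrow>splits b. \<Sum>x\<leftarrow>prod_terms a l. \<Sum>(r0, r1)\<leftarrow>splits r.
        \<Sum>y0\<leftarrow>prod_terms b0 r0. \<Sum>y1\<leftarrow>prod_terms b1 r1. F (Node x y0) y1)"
    unfolding sum_list_swap_split'[of _ "splits _" "prod_terms _ l"] ..
  also have "\<dots> = (\<Sum>(c, b1)\<leftarrow>splits s. \<Sum>(a, b0)\<leftarrow>splits c. \<Sum>x\<leftarrow>prod_terms a l. \<Sum>(r0, r1)\<leftarrow>splits r.
        \<Sum>y0\<leftarrow>prod_terms b0 r0. \<Sum>y1\<leftarrow>prod_terms b1 r1. F (Node x y0) y1)"
    by (rule splits_coassoc)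
  also have "\<dots> = (\<Sum>(c, b1)\<leftarrow>splits s. \<Sum>(r0, r1)\<leftarrow>splits r. \<Sum>(a, b0)\<leftarrow>splits c. \<Sum>x\<leftarrow>prod_terms a l.
        \<Sum>y0\<leftarrow>prod_terms b0 r0. \<Sum>y1\<leftarrow>prod_terms b1 r1. F (Node x y0) y1)"
    unfolding sum_list_swap_split'[of _ "splits r" "prod_terms _ l"] sum_list_swap_split[of _ "splits r"] ..
  also have "\<dots> = (\<Sum>(s0, s1)\<leftarrow>splits s. \<Sum>(r0, r1)\<leftarrow>splits r. \<Sum>a\<leftarrow>prod_terms s0 (Node l r0).
      \<Sum>b\<leftarrow>prod_terms s1 r1. F a b)"
    unfolding sum_prod_terms_Node ..
  finally have 2: "(\<Sum>(a, b)\<leftarrow>splits s. \<Sum>x\<leftarrow>prod_terms a l. \<Sum>y\<leftarrow>prod_terms b r.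
      \<Sum>(y0, y1)\<leftarrow>splits y. F (Node x y0) y1) = \<dots>" .
  show ?case
    unfolding sum_prod_terms_Node[of _ s] sum_splits_Node sum_list_addf sum_list_split_addf 1 2 ..
qed simp

lemma lin_form_splits_mono_basis:
  "lin_form (\<lambda>t. \<Sum>(a, b)\<leftarrow>splits t. F a b) (mono_basis r) =
     (\<Sum>(a, b)\<leftarrow>deconcs r. lin_form (\<lambda>u. lin_form (F u) (mono_basis b)) (mono_basis a))"
  by (simp flip: lin_form_ysym_comul
      add: ysym_comul_mono_basis lin_form_sum_list case_prod_unfold lin_form_ysym_tensor)

section \<open>Structure constants in the monomial basis\<close>

definition prod_coeff :: "pbt \<Rightarrow> pbt \<Rightarrow> pbt \<Rightarrow> 'k::field" where
  "prod_coeff t r s = mono_coeff t (ysym_mul (mono_basis r) (mono_basis s))"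

lemma prod_coeff_eq_lin_form: "prod_coeff t r s =
    lin_form (\<lambda>a. lin_form (\<lambda>b. \<Sum>u\<leftarrow>prod_terms a b. of_bool (tamari u t)) (mono_basis s)) (mono_basis r)"
  by (simp add: prod_coeff_def mono_coeff_def lin_form_ysym_mul)

text \<open>A monomial coefficient at \<open>bslash t t'\<close> is read off from the coproduct,
  which is multiplicative and deconcatenates \<open>r\<close> and \<open>s\<close>. Iterating this
  reduces all structure constants to those with irreducible index.\<close>

lemma prod_coeff_bslash: "prod_coeff (bslash t t') r s =
    (\<Sum>(r1, r2)\<leftarrow>deconcs r. \<Sum>(s1, s2)\<leftarrow>deconcs s. prod_coeff t r1 s1 * prod_coeff t' r2 s2 :: 'k::field)"
proof -
  let ?G = "\<lambda>t a b. \<Sum>u\<leftarrow>prod_terms a b. of_bool (tamari u t) :: 'k"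
  have "?G (bslash t t') a b =
      (\<Sum>(a0, a1)\<leftarrow>splits a. \<Sum>(b0, b1)\<leftarrow>splits b. ?G t a0 b0 * ?G t' a1 b1)" for a b
    by (simp flip: sum_splits_tamari add: sum_splits_prod_terms)
       (simp add: sum_list_const_mult sum_list_mult_const)
  then have "prod_coeff (bslash t t') r s = lin_form (\<lambda>a. lin_form (\<lambda>b. \<Sum>(a0, a1)\<leftarrow>splits a. \<Sum>(b0, b1)\<leftarrow>splits b.
      ?G t a0 b0 * ?G t' a1 b1) (mono_basis s)) (mono_basis r)"
    by (simp add: prod_coeff_eq_lin_form)
  also have "\<dots> = lin_form (\<lambda>a. \<Sum>(a0, a1)\<leftarrow>splits a. lin_form (\<lambda>b. \<Sum>(b0, b1)\<leftarrow>splits b.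
      ?G t a0 b0 * ?G t' a1 b1) (mono_basis s)) (mono_basis r)"
    by (simp add: case_prod_unfold lin_form_fun_sum_list)
  also have "\<dots> = (\<Sum>(r1, r2)\<leftarrow>deconcs r. \<Sum>(s1, s2)\<leftarrow>deconcs s. prod_coeff t r1 s1 * prod_coeff t' r2 s2)"
    unfolding lin_form_splits_mono_basis
    by (simp add: case_prod_unfold lin_form_fun_sum_list lin_form_fun_cmult lin_form_fun_multc prod_coeff_eq_lin_form)
  finally show ?thesis .
qed

lemma prod_terms_Leaf: "prod_terms Leaf t = [t]"
  by (induction t) auto

lemma prod_coeff_Leaf_left: "prod_coeff t Leaf s = of_bool (t = s)"
  by (simp add: prod_coeff_eq_lin_form mono_basis_Leaf prod_terms_Leaf mono_coeff_mono_basis flip: mono_coeff_def)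

lemma prod_coeff_Leaf_right: "prod_coeff t r Leaf = of_bool (t = r)"
  by (simp add: prod_coeff_eq_lin_form mono_basis_Leaf mono_coeff_mono_basis flip: mono_coeff_def)

lemma nodes_prod_terms: "u \<in> set (prod_terms s t) \<Longrightarrow> nodes u = nodes s + nodes t"
  by (induction t arbitrary: s u) (fastforce dest: nodes_splits)+

text \<open>The product is graded, so a constant term requires two constant factors.\<close>

lemma prod_coeff_Leaf: "prod_coeff Leaf r s = (of_bool (r = Leaf) * of_bool (s = Leaf) :: 'k::field)"
proof -
  have sum: "(\<Sum>u\<leftarrow>prod_terms a b. of_bool (tamari u Leaf)) =
      (of_bool (tamari a Leaf) * of_bool (tamari b Leaf) :: 'k)" for a b
  proof (cases b)
    case (Node x y)
    then have "map (\<lambda>u. of_bool (tamari u Leaf)) (prod_terms a b) = map (\<lambda>u. 0 :: 'k) (prod_terms a b)"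
      using nodes_prod_terms[of Leaf a b] by (auto simp del: prod_terms.simps)
    then have "(\<Sum>u\<leftarrow>prod_terms a b. of_bool (tamari u Leaf)) = (0 :: 'k)"
      by (simp only: sum_list_0)
    with Node show ?thesis by (simp del: prod_terms.simps)
  qed simp
  show ?thesis
    unfolding prod_coeff_eq_lin_form sum lin_form_fun_cmult lin_form_fun_multc mono_coeff_def[symmetric] mono_coeff_mono_basis
    by (simp add: eq_commute)
qed

lemma deconcs_ncomp: "(a, b) \<in> set (deconcs t) \<Longrightarrow> ncomp a + ncomp b = ncomp t"
  by (auto dest!: bslash_eq_deconcs)

lemma ncomp_eq_0_iff [simp]: "ncomp t = 0 \<longleftrightarrow> t = Leaf"
  by (cases t) auto

text \<open>The product respects the coradical filtration.\<close>

lemma prod_coeff_eq_0: "ncomp r + ncomp s < ncomp t \<Longrightarrow> prod_coeff t r s = 0"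
proof (induction t arbitrary: r s)
  case (Node l t')
  \<comment> \<open>If \<open>r1\<close> and \<open>s1\<close> are both trivial, the first
    coefficient is 0, since the unit has no such term. Otherwise at least one component is used up,
    and too few remain for \<open>t'\<close>.\<close>
  have "prod_coeff (Node l Leaf) r1 s1 * prod_coeff t' r2 s2 = (0 :: 'a)"
    if "(r1, r2) \<in> set (deconcs r)" "(s1, s2) \<in> set (deconcs s)" for r1 r2 s1 s2
  proof (cases "r1 = Leaf \<and> s1 = Leaf")
    case False
    then have "0 < ncomp r1 + ncomp s1" by (cases r1; cases s1) auto
    moreover note deconcs_ncomp[OF that(1)] deconcs_ncomp[OF that(2)] Node.prems
    ultimately have "ncomp r2 + ncomp s2 < ncomp t'"
      unfolding ncomp.simps by linarith
    then show ?thesis using Node.IH(2) by simp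
  qed (simp add: prod_coeff_Leaf_left)
  then have "(\<Sum>(r1, r2)\<leftarrow>deconcs r. \<Sum>(s1, s2)\<leftarrow>deconcs s. prod_coeff (Node l Leaf) r1 s1 * prod_coeff t' r2 s2) =
      (\<Sum>(r1, r2)\<leftarrow>deconcs r. \<Sum>(s1, s2)\<leftarrow>deconcs s. 0 :: 'a)"
    by (intro sum_list_pair_cong) simp
  then show ?case
    using prod_coeff_bslash[of "Node l Leaf" t' r s, where 'k = 'a] by (simp add: case_prod_unfold)
qed simp

primrec pbt_unshuffles :: "pbt \<Rightarrow> (pbt \<times> pbt) list" where
  "pbt_unshuffles Leaf = [(Leaf, Leaf)]"
| "pbt_unshuffles (Node l r) =
     map (\<lambda>(a, b). (Node l a, b)) (pbt_unshuffles r) @ map (\<lambda>(a, b). (a, Node l b)) (pbt_unshuffles r)"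

lemma sum_pbt_unshuffles_Node:
  "(\<Sum>(a, b)\<leftarrow>pbt_unshuffles (Node l r). F a b) =
     (\<Sum>(a, b)\<leftarrow>pbt_unshuffles r. F (Node l a) b) + (\<Sum>(a, b)\<leftarrow>pbt_unshuffles r. F a (Node l b))"
  by (simp add: case_prod_unfold o_def)

lemma pbt_unshuffles_ncomp: "(a, b) \<in> set (pbt_unshuffles t) \<Longrightarrow> ncomp a + ncomp b = ncomp t"
  by (induction t arbitrary: a b) auto

definition pbt_unshuffles_coeff :: "pbt \<Rightarrow> pbt \<Rightarrow> pbt \<Rightarrow> 'k::field" where
  "pbt_unshuffles_coeff t r s = (\<Sum>(a, b)\<leftarrow>pbt_unshuffles t. of_bool (a = r) * of_bool (b = s))"

lemma pbt_unshuffles_coeff_eq_0: "ncomp t \<noteq> ncomp r + ncomp s \<Longrightarrow> pbt_unshuffles_coeff t r s = 0"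
proof -
  assume "ncomp t \<noteq> ncomp r + ncomp s"
  then have "of_bool (a = r) * of_bool (b = s) = (0 :: 'a)" if "(a, b) \<in> set (pbt_unshuffles t)" for a b
    using pbt_unshuffles_ncomp[OF that] by (auto simp: of_bool_def)
  then have "pbt_unshuffles_coeff t r s = (\<Sum>(a, b)\<leftarrow>pbt_unshuffles t. 0 :: 'a)"
    unfolding pbt_unshuffles_coeff_def by (rule sum_list_pair_cong)
  then show ?thesis by (simp add: case_prod_unfold)
qed

lemma pbt_unshuffles_coeff_Node:
  "pbt_unshuffles_coeff (Node l t) r s =
     (case r of Leaf \<Rightarrow> 0 | Node l' r' \<Rightarrow> of_bool (l' = l) * pbt_unshuffles_coeff t r' s) +
     (case s of Leaf \<Rightarrow> 0 | Node l' s' \<Rightarrow> of_bool (l' = l) * pbt_unshuffles_coeff t r s')"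
  unfolding pbt_unshuffles_coeff_def sum_pbt_unshuffles_Node
  by (cases r; cases s) (auto simp: case_prod_unfold)

lemma sum_deconcs_Leaf: "(\<Sum>(a, b)\<leftarrow>deconcs s. of_bool (a = Leaf) * g b) = (g s :: 'k::field)"
  by (cases s) (auto simp: case_prod_unfold o_def)

lemma sum_deconcs_irreducible:
  fixes g :: "pbt \<Rightarrow> 'k::field"
  shows "(\<Sum>(a, b)\<leftarrow>deconcs s. of_bool (a = Node l Leaf) * g b) =
     (case s of Leaf \<Rightarrow> 0 | Node l' s' \<Rightarrow> of_bool (l' = l) * g s')"
proof (cases s)
  case (Node l' s')
  show ?thesis
    using sum_deconcs_Leaf[of g s'] by (auto simp: Node case_prod_unfold o_def)
qed simp

text \<open>In the associated graded, the product is dual to the unshuffling of irreducible components.\<close>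

lemma prod_coeff_eq_pbt_unshuffles_coeff:
  "ncomp t = ncomp r + ncomp s \<Longrightarrow> prod_coeff t r s = (pbt_unshuffles_coeff t r s :: 'k::field)"
proof (induction t arbitrary: r s)
  case Leaf
  then show ?case by (simp add: prod_coeff_Leaf pbt_unshuffles_coeff_def)
next
  case (Node l t')
  let ?p = "Node l Leaf"
  \<comment> \<open>The contributions of \<open>?p\<close> that survive in top degree: one factor is
    \<open>?p\<close> and the other is trivial. This expresses that the generator is
    primitive.\<close>
  let ?h = "\<lambda>r1 s1. of_bool (r1 = ?p) * of_bool (s1 = Leaf) + of_bool (r1 = Leaf) * of_bool (s1 = ?p) :: 'k"
  have "prod_coeff ?p r1 s1 * prod_coeff t' r2 s2 = ?h r1 s1 * pbt_unshuffles_coeff t' r2 s2"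
    if r: "(r1, r2) \<in> set (deconcs r)" and s: "(s1, s2) \<in> set (deconcs s)" for r1 r2 s1 s2
  proof -
    note n = deconcs_ncomp[OF r] deconcs_ncomp[OF s] Node.prems
    \<comment> \<open>If no component is used up, both sides are 0. If exactly one is, the remaining
      ones match \<open>t'\<close> and the induction hypothesis applies. If more are, too few
      remain, and both sides are 0 again.\<close>
    consider "r1 = Leaf" "s1 = Leaf" | "ncomp r1 + ncomp s1 = 1" | "1 < ncomp r1 + ncomp s1"
      by (cases "ncomp r1 + ncomp s1"; cases "ncomp r1 + ncomp s1 - 1") auto
    then show ?thesis
    proof cases
      case 1
      then show ?thesis by (simp add: prod_coeff_Leaf_left)
    next
      case 2
      then have IH: "prod_coeff t' r2 s2 = (pbt_unshuffles_coeff t' r2 s2 :: 'k)"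
        using Node.IH(2)[of r2 s2] n by simp
      from 2 consider "r1 \<noteq> Leaf" "s1 = Leaf" | "r1 = Leaf" "s1 \<noteq> Leaf"
        by (cases r1; cases s1) auto
      then have "prod_coeff ?p r1 s1 = ?h r1 s1"
        by cases (auto simp: prod_coeff_Leaf_left prod_coeff_Leaf_right)
      with IH show ?thesis by simp
    next
      case 3
      then have "prod_coeff t' r2 s2 = (0 :: 'k)" "?h r1 s1 = 0"
        using n by (auto intro!: prod_coeff_eq_0)
      then show ?thesis by simp
    qed
  qed
  then have "(\<Sum>(r1, r2)\<leftarrow>deconcs r. \<Sum>(s1, s2)\<leftarrow>deconcs s. prod_coeff ?p r1 s1 * prod_coeff t' r2 s2) =
      (\<Sum>(r1, r2)\<leftarrow>deconcs r. \<Sum>(s1, s2)\<leftarrow>deconcs s. ?h r1 s1 * pbt_unshuffles_coeff t' r2 s2)"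
    by (intro sum_list_pair_cong) simp
  then have "prod_coeff (Node l t') r s =
      (\<Sum>(r1, r2)\<leftarrow>deconcs r. \<Sum>(s1, s2)\<leftarrow>deconcs s. ?h r1 s1 * pbt_unshuffles_coeff t' r2 s2)"
    using prod_coeff_bslash[of ?p t' r s, where 'k = 'k] by simp
  also have "\<dots> = (\<Sum>(r1, r2)\<leftarrow>deconcs r. of_bool (r1 = ?p) *
        (\<Sum>(s1, s2)\<leftarrow>deconcs s. of_bool (s1 = Leaf) * pbt_unshuffles_coeff t' r2 s2)) +
      (\<Sum>(r1, r2)\<leftarrow>deconcs r. of_bool (r1 = Leaf) *
        (\<Sum>(s1, s2)\<leftarrow>deconcs s. of_bool (s1 = ?p) * pbt_unshuffles_coeff t' r2 s2))"
    by (simp only: case_prod_unfold distrib_right mult.assoc sum_list_addf sum_list_const_mult)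
  also have "\<dots> = pbt_unshuffles_coeff (Node l t') r s"
    by (simp only: sum_deconcs_Leaf sum_deconcs_irreducible pbt_unshuffles_coeff_Node)
  finally show ?case .
qed

section \<open>The graded dual\<close>

lemma tensor_pair_eq_lin_form: "tensor_pair f g T = lin_form (\<lambda>(a, b). f a * g b) T"
  by (simp add: tensor_pair_def lin_form_def case_prod_unfold)

lemma filtered_comul_exists:
  fixes h :: "'k::field ysym"
  assumes "h \<in> corad k"
  shows "\<exists>L. filtered_comul k h L"
proof -
  obtain ts where ts: "set ts = Poly_Mapping.keys (mvec h)" "distinct ts"
    using finite_distinct_list[OF finite_keys[of "mvec h"]] by blast
  \<comment> \<open>A tree in the expansion of \<open>h\<close> may have fewer than \<open>k\<close>
    components. The right factor is therefore placed in degree \<open>k - ncomp a\<close> instead of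
    \<open>ncomp b\<close>, so that the degrees add up to \<open>k\<close>.\<close>
  let ?g = "\<lambda>t (a, b). (ncomp a, fscale (mono_coeff t h) (mono_basis a), k - ncomp a, mono_basis b :: 'k ysym)"
  let ?L = "concat (map (\<lambda>t. map (?g t) (deconcs t)) ts)"
  have "ncomp t \<le> k" if "t \<in> set ts" for t
    using that ts assms by (force simp: in_keys_iff corad_iff not_less[symmetric])
  then have "ncomp a + (k - ncomp a) = k \<and> fscale (mono_coeff t h) (mono_basis a) \<in> corad (ncomp a) \<and>
      (mono_basis b :: 'k ysym) \<in> corad (k - ncomp a)" if "t \<in> set ts" "(a, b) \<in> set (deconcs t)" for t a b
    using that deconcs_ncomp[OF that(2)]
    by (fastforce intro!: mono_basis_in_corad fvs.subspace_scale[OF subspace_corad])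
  then have "\<forall>(i, a, j, b)\<in>set ?L. i + j = k \<and> a \<in> corad i \<and> b \<in> corad j"
    by auto
  moreover have "ysym_comul h = (\<Sum>(i, a, j, b)\<leftarrow>?L. ysym_tensor a b)"
  proof (rule mono_coeff2_ext)
    fix r s
    have "mono_coeff2 r s (\<Sum>(i, a, j, b)\<leftarrow>?L. ysym_tensor a b) = (\<Sum>(i, a, j, b)\<leftarrow>?L. mono_coeff r a * mono_coeff s b)"
      by (simp add: mono_coeff2_sum_list case_prod_unfold mono_coeff2_ysym_tensor)
    also have "\<dots> = (\<Sum>t\<leftarrow>ts. mono_coeff t h * (\<Sum>(a, b)\<leftarrow>deconcs t. of_bool (a = r) * of_bool (b = s)))"
      by (simp add: sum_list_concat_map case_prod_unfold o_def mono_coeff_mono_basis_flip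
          flip: sum_list_const_mult)
    also have "\<dots> = lin_form (\<lambda>t. of_bool (t = bslash r s)) (mvec h)"
      unfolding sum_deconcs lin_form_def
      by (simp add: sum_list_distinct_conv_sum_set[OF ts(2)] ts(1))
    finally show "mono_coeff2 r s (ysym_comul h) = mono_coeff2 r s (\<Sum>(i, a, j, b)\<leftarrow>?L. ysym_tensor a b)"
      by (simp add: mono_coeff2_ysym_comul)
  qed
  ultimately show ?thesis unfolding filtered_comul_def by blast
qed

lemma linear_gr_class:
  assumes "Vector_Spaces.linear gr_scale (*) f" "h \<in> corad k"
  shows "f (gr_class k h) = lin_form (\<lambda>t. f (gr_mono t)) (ncomp_part k (mvec h))"
  by (simp add: linear_eq_lin_form[OF assms(1), of "gr_class k h"] gr_coords_class[OF assms(2)])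

lemma keys_mvec_corad: "h \<in> corad k \<Longrightarrow> t \<in> Poly_Mapping.keys (mvec h) \<Longrightarrow> ncomp t \<le> k"
  by (force simp: in_keys_iff corad_iff not_less[symmetric])

text \<open>Valid for every presentation of the coproduct as a sum of pure tensors, hence also for
  the one selected in \<open>gr_comul\<close>.\<close>

lemma mvec_ysym_comul:
  fixes h :: "'k::field ysym"
  assumes "ysym_comul h = (\<Sum>(i, a, j, b)\<leftarrow>L. ysym_tensor a b)"
  shows "(\<Sum>(i, a, j, b)\<leftarrow>L. ysym_tensor (mvec a) (mvec b)) =
    linext (\<lambda>t. \<Sum>p\<leftarrow>deconcs t. bvec p) (mvec h)"
proof (rule poly_mapping_eqI)
  fix p :: "pbt \<times> pbt"
  obtain r s where p: "p = (r, s)" by fastforce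
  have coef: "coef T (r, s) = lin_form (\<lambda>(a, b). of_bool (a = r) * of_bool (b = s)) T" for T :: "pbt \<times> pbt \<Rightarrow>\<^sub>0 'k"
    unfolding lin_form_of_bool[symmetric] by (rule lin_form_cong) auto
  have "coef (\<Sum>(i, a, j, b)\<leftarrow>L. ysym_tensor (mvec a) (mvec b)) (r, s) =
      (\<Sum>(i, a, j, b)\<leftarrow>L. mono_coeff r a * mono_coeff s b)"
    by (simp add: coef lin_form_sum_list case_prod_unfold lin_form_ysym_tensor lin_form_fun_cmult lin_form_fun_multc)
  also have "\<dots> = mono_coeff (bslash r s) h"
    unfolding mono_coeff2_ysym_comul[symmetric] assms by (simp add: mono_coeff2_sum_list case_prod_unfold mono_coeff2_ysym_tensor)
  also have "\<dots> = lin_form (\<lambda>t. \<Sum>(a, b)\<leftarrow>deconcs t. of_bool (a = r) * of_bool (b = s)) (mvec h)"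
    unfolding sum_deconcs by simp
  also have "\<dots> = coef (linext (\<lambda>t. \<Sum>p\<leftarrow>deconcs t. bvec p) (mvec h)) (r, s)"
    by (simp add: coef lin_form_linext lin_form_sum_list case_prod_unfold)
  finally show "coef (\<Sum>(i, a, j, b)\<leftarrow>L. ysym_tensor (mvec a) (mvec b)) p =
      coef (linext (\<lambda>t. \<Sum>p\<leftarrow>deconcs t. bvec p) (mvec h)) p"
    by (simp only: p)
qed

text \<open>The right-hand side is independent of \<open>L\<close>. For an entry
  \<open>(i, a, j, b)\<close>, the coordinates of \<open>a\<close> and \<open>b\<close> sit on trees
  with at most \<open>i\<close> and \<open>j\<close> components. As \<open>i + j = k\<close>, a pair
  of trees with \<open>k\<close> components in total attains both bounds, and these are exactly the
  coordinates that the classes of \<open>a\<close> and \<open>b\<close> retain.\<close>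

lemma sum_filtered_comul:
  fixes h :: "'k::field ysym"
  assumes f: "Vector_Spaces.linear gr_scale (*) f" and g: "Vector_Spaces.linear gr_scale (*) g"
    and L: "filtered_comul k h L"
  shows "(\<Sum>(i, a, j, b)\<leftarrow>L. f (gr_class i a) * g (gr_class j b)) =
    lin_form (\<lambda>t. \<Sum>(r, s)\<leftarrow>deconcs t. f (gr_mono r) * g (gr_mono s)) (ncomp_part k (mvec h))"
proof -
  let ?G = "\<lambda>p. if ncomp (fst p) + ncomp (snd p) = k then f (gr_mono (fst p)) * g (gr_mono (snd p)) else 0"
  have "f (gr_class i a) * g (gr_class j b) = lin_form ?G (ysym_tensor (mvec a) (mvec b))"
    if "(i, a, j, b) \<in> set L" for i a j b
  proof -
    from L that have ij: "i + j = k" and a: "a \<in> corad i" and b: "b \<in> corad j"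
      by (auto simp: filtered_comul_def)
    have "lin_form ?G (ysym_tensor (mvec a) (mvec b)) =
        lin_form (\<lambda>r. lin_form (\<lambda>s. (if ncomp r = i then f (gr_mono r) else 0) *
          (if ncomp s = j then g (gr_mono s) else 0)) (mvec b)) (mvec a)"
      unfolding lin_form_ysym_tensor
      using keys_mvec_corad[OF a] keys_mvec_corad[OF b] ij
      by (intro lin_form_cong) fastforce
    then show ?thesis
      by (simp add: linear_gr_class[OF f a] linear_gr_class[OF g b] lin_form_ncomp_part
          lin_form_fun_cmult lin_form_fun_multc)
  qed
  then have "(\<Sum>(i, a, j, b)\<leftarrow>L. f (gr_class i a) * g (gr_class j b)) =
      (\<Sum>(i, a, j, b)\<leftarrow>L. lin_form ?G (ysym_tensor (mvec a) (mvec b)))"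
    by (intro arg_cong[of _ _ sum_list] map_cong refl) auto
  also have "\<dots> = lin_form ?G (\<Sum>(i, a, j, b)\<leftarrow>L. ysym_tensor (mvec a) (mvec b))"
    by (simp add: lin_form_sum_list case_prod_unfold)
  also have "\<dots> = lin_form (\<lambda>t. \<Sum>p\<leftarrow>deconcs t. ?G p) (mvec h)"
    using L by (subst mvec_ysym_comul) (auto simp: filtered_comul_def lin_form_linext lin_form_sum_list)
  also have "\<dots> = lin_form (\<lambda>t. if ncomp t = k then \<Sum>(r, s)\<leftarrow>deconcs t. f (gr_mono r) * g (gr_mono s) else 0) (mvec h)"
  proof (rule lin_form_cong)
    fix t
    have "(\<Sum>p\<leftarrow>deconcs t. ?G p) =
        (\<Sum>(r, s)\<leftarrow>deconcs t. if ncomp t = k then f (gr_mono r) * g (gr_mono s) else 0)"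
      by (intro arg_cong[of _ _ sum_list] map_cong refl) (auto dest: deconcs_ncomp)
    then show "(\<Sum>p\<leftarrow>deconcs t. ?G p) =
        (if ncomp t = k then \<Sum>(r, s)\<leftarrow>deconcs t. f (gr_mono r) * g (gr_mono s) else 0)"
      by (cases "ncomp t = k") (simp_all only: if_True if_False case_prod_unfold sum_list_0 simp_thms)
  qed
  finally show ?thesis by (simp add: lin_form_ncomp_part)
qed

lemma tensor_pair_gr_comul:
  assumes f: "Vector_Spaces.linear gr_scale (*) f" and g: "Vector_Spaces.linear gr_scale (*) g"
  shows "tensor_pair f g (gr_comul X) =
    lin_form (\<lambda>t. \<Sum>(r, s)\<leftarrow>deconcs t. f (gr_mono r) * g (gr_mono s)) (gr_coords X)"
proof -
  let ?L = "\<lambda>k. SOME L. filtered_comul k (coef (rep_gr X) k) L"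
  have "filtered_comul k (coef (rep_gr X) k) (?L k)" for k
    using filtered_comul_exists[OF rep_gr_in_corad] by (rule someI_ex)
  then have "(\<Sum>(i, a, j, b)\<leftarrow>?L k. f (gr_class i a) * g (gr_class j b)) =
      lin_form (\<lambda>t. \<Sum>(r, s)\<leftarrow>deconcs t. f (gr_mono r) * g (gr_mono s)) (ncomp_part k (mvec (coef (rep_gr X) k)))" for k
    by (rule sum_filtered_comul[OF f g])
  then show ?thesis
    by (simp add: tensor_pair_eq_lin_form gr_comul_def lin_form_sum lin_form_sum_list case_prod_unfold gr_coords_def)
qed

lemma mono_coeff_ysym_mul:
  "mono_coeff t (ysym_mul x y) = lin_form (\<lambda>r. lin_form (\<lambda>s. prod_coeff t r s) (mvec y)) (mvec x)"
proof -
  let ?F = "\<lambda>a b. \<Sum>u\<leftarrow>prod_terms a b. of_bool (tamari u t)"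
  have "mono_coeff t (ysym_mul x y) = lin_form (\<lambda>a. lin_form (?F a) y) x"
    by (simp add: mono_coeff_def lin_form_ysym_mul)
  also have "\<dots> = lin_form (\<lambda>a. lin_form (\<lambda>s. lin_form (?F a) (mono_basis s)) (mvec y)) x"
    by (simp flip: lin_form_mono_basis)
  also have "\<dots> = lin_form (\<lambda>s. lin_form (\<lambda>a. lin_form (?F a) (mono_basis s)) x) (mvec y)"
    by (rule lin_form_swap)
  also have "\<dots> = lin_form (\<lambda>s. lin_form (\<lambda>r. prod_coeff t r s) (mvec x)) (mvec y)"
    unfolding prod_coeff_eq_lin_form by (simp flip: lin_form_mono_basis)
  finally show ?thesis by (simp only: lin_form_swap[of _ "mvec y"])
qed

lemma ysym_mul_in_corad:
  assumes "x \<in> corad i" "y \<in> corad j"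
  shows "ysym_mul x y \<in> corad (i + j)"
proof -
  have "mono_coeff t (ysym_mul x y) = 0" if "i + j < ncomp t" for t
  proof -
    have "prod_coeff t r s = (0 :: 'a)" if "r \<in> Poly_Mapping.keys (mvec x)" "s \<in> Poly_Mapping.keys (mvec y)" for r s
      using keys_mvec_corad[OF assms(1) that(1)] keys_mvec_corad[OF assms(2) that(2)] \<open>i + j < ncomp t\<close>
      by (intro prod_coeff_eq_0) simp
    then show ?thesis by (simp add: mono_coeff_ysym_mul cong: lin_form_cong)
  qed
  then show ?thesis by (simp add: corad_iff)
qed

text \<open>The indices \<open>r\<close> and \<open>s\<close> have at most \<open>i\<close> and
  \<open>j\<close> components. If \<open>t\<close> has \<open>i + j\<close>, a nonzero structure
  constant forces equality in both bounds and is then the unshuffling coefficient.\<close>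

lemma coef_ncomp_part_mul:
  assumes x: "x \<in> corad i" and y: "y \<in> corad j"
  shows "coef (ncomp_part (i + j) (mvec (ysym_mul x y))) t =
    lin_form (\<lambda>r. lin_form (\<lambda>s. pbt_unshuffles_coeff t r s) (ncomp_part j (mvec y))) (ncomp_part i (mvec x))"
proof -
  have "(if ncomp t = i + j then prod_coeff t r s else 0) =
      (if ncomp r = i then if ncomp s = j then pbt_unshuffles_coeff t r s else 0 else (0 :: 'a))"
    if "r \<in> Poly_Mapping.keys (mvec x)" "s \<in> Poly_Mapping.keys (mvec y)" for r s
    using keys_mvec_corad[OF x that(1)] keys_mvec_corad[OF y that(2)]
    by (auto intro!: prod_coeff_eq_0 prod_coeff_eq_pbt_unshuffles_coeff simp: pbt_unshuffles_coeff_eq_0)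
  then have "lin_form (\<lambda>r. lin_form (\<lambda>s. if ncomp t = i + j then prod_coeff t r s else 0) (mvec y)) (mvec x) =
      lin_form (\<lambda>r. lin_form (\<lambda>s. if ncomp r = i then if ncomp s = j then pbt_unshuffles_coeff t r s else 0 else 0) (mvec y)) (mvec x)"
    by (intro lin_form_cong) auto
  also have "\<dots> = lin_form (\<lambda>r. if ncomp r = i then lin_form (\<lambda>s. if ncomp s = j then pbt_unshuffles_coeff t r s else 0) (mvec y) else 0) (mvec x)"
    by (intro lin_form_cong) auto
  finally show ?thesis
    by (cases "ncomp t = i + j") (simp_all add: coef_ncomp_part mono_coeff_ysym_mul lin_form_ncomp_part)
qed

lemma coef_gr_coords_gr_mul:
  "coef (gr_coords (gr_mul X Y)) t = lin_form (\<lambda>r. lin_form (\<lambda>s. pbt_unshuffles_coeff t r s) (gr_coords Y)) (gr_coords X)"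
proof -
  let ?x = "coef (rep_gr X)" and ?y = "coef (rep_gr Y)"
  have "coef (gr_coords (gr_mul X Y)) t = (\<Sum>i\<in>Poly_Mapping.keys (rep_gr X). \<Sum>j\<in>Poly_Mapping.keys (rep_gr Y).
      coef (ncomp_part (i + j) (mvec (ysym_mul (?x i) (?y j)))) t)"
    by (simp add: gr_mul_def gr_coords_sum coef_sum gr_coords_class ysym_mul_in_corad rep_gr_in_corad)
  also have "\<dots> = (\<Sum>i\<in>Poly_Mapping.keys (rep_gr X). \<Sum>j\<in>Poly_Mapping.keys (rep_gr Y).
      lin_form (\<lambda>r. lin_form (\<lambda>s. pbt_unshuffles_coeff t r s) (ncomp_part j (mvec (?y j)))) (ncomp_part i (mvec (?x i))))"
    by (simp add: coef_ncomp_part_mul rep_gr_in_corad)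
  also have "\<dots> = lin_form (\<lambda>r. lin_form (\<lambda>s. pbt_unshuffles_coeff t r s) (gr_coords Y)) (gr_coords X)"
    unfolding gr_coords_def lin_form_sum lin_form_fun_sum by (rule sum.swap)
  finally show ?thesis .
qed

section \<open>Coordinates on the graded dual\<close>

definition dual_coords :: "'k::field grdual \<Rightarrow> 'k ysym" where
  "dual_coords \<phi> = Abs_poly_mapping (\<lambda>t. dual_app \<phi> (gr_mono t))"

lemma gr_mono_in_homog: "gr_mono t \<in> gr_homog (nodes t)"
  unfolding gr_homog_def by (intro gr.span_base) auto

text \<open>The support is finite because a functional in the graded dual is nonzero in finitely
  many degrees only, each with finitely many trees.\<close>

lemma coef_dual_coords: "coef (dual_coords \<phi>) t = dual_app \<phi> (gr_mono t)"
proof -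
  let ?N = "{n. \<exists>x\<in>gr_homog n. dual_app \<phi> x \<noteq> 0}"
  have "finite ?N" using dual_app[of \<phi>] by simp
  then have "finite (\<Union>n\<in>?N. {t. nodes t = n})" by (simp add: finite_nodes)
  then have "finite {t. dual_app \<phi> (gr_mono t) \<noteq> 0}"
    by (rule rev_finite_subset) (use gr_mono_in_homog in blast)
  then show ?thesis by (simp add: dual_coords_def)
qed

lemma dual_app_eq: "dual_app \<phi> X = lin_form (coef (dual_coords \<phi>)) (gr_coords X)"
  using linear_eq_lin_form[OF linear_dual_app, of \<phi> X] by (simp add: coef_dual_coords cong: lin_form_cong)

lemma dual_coords_inject: "dual_coords \<phi> = dual_coords \<psi> \<longleftrightarrow> \<phi> = \<psi>"
  by (metis dual_app_eq dual_app_inject ext)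

definition dual_of :: "'k::field ysym \<Rightarrow> 'k grdual" where
  "dual_of x = Abs_grdual (\<lambda>X. lin_form (coef x) (gr_coords X))"

lemma dual_app_dual_of: "dual_app (dual_of x) X = lin_form (coef x) (gr_coords X)"
proof -
  let ?N = "{n. \<exists>X\<in>gr_homog n. lin_form (coef x) (gr_coords X) \<noteq> 0}"
  have "?N \<subseteq> nodes ` Poly_Mapping.keys x"
  proof
    fix n assume "n \<in> ?N"
    then obtain X where X: "X \<in> gr_homog n" and "lin_form (coef x) (gr_coords X) \<noteq> 0" by blast
    then obtain t where "t \<in> Poly_Mapping.keys (gr_coords X)" "coef x t \<noteq> 0"
      using lin_form_nonzero by blast
    with X show "n \<in> nodes ` Poly_Mapping.keys x"
      by (auto simp: gr_homog_iff in_keys_iff)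
  qed
  then have "finite ?N" by (rule finite_subset) simp
  then have "(\<lambda>X. lin_form (coef x) (gr_coords X)) \<in> {\<phi> :: 'a gr \<Rightarrow> 'a. Vector_Spaces.linear gr_scale (*) \<phi> \<and>
      finite {n. \<exists>x\<in>gr_homog n. \<phi> x \<noteq> 0}}"
    by (simp add: linear_lin_form_gr_coords)
  then show ?thesis by (simp add: dual_of_def Abs_grdual_inverse)
qed

lemma dual_coords_dual_of [simp]: "dual_coords (dual_of x) = x"
  by (rule poly_mapping_eqI) (simp add: coef_dual_coords dual_app_dual_of)

lemma dual_of_dual_coords [simp]: "dual_of (dual_coords \<phi>) = \<phi>"
  by (simp flip: dual_coords_inject)

lemma dual_coords_add: "dual_coords (\<phi> + \<psi>) = dual_coords \<phi> + dual_coords \<psi>"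
  by (rule poly_mapping_eqI) (simp add: coef_dual_coords lookup_add plus_grdual.rep_eq)

lemma dual_coords_scale: "dual_coords (dual_scale c \<phi>) = fscale c (dual_coords \<phi>)"
  by (rule poly_mapping_eqI) (simp add: coef_dual_coords dual_scale.rep_eq)

lemma dual_mono_eq: "dual_mono t = dual_of (fund t)"
  unfolding dual_mono_def
proof (rule the_equality)
  show "\<forall>s. dual_app (dual_of (fund t)) (gr_mono s) = (if s = t then 1 else 0 :: 'a)"
    by (simp add: dual_app_dual_of coef_bvec)
  fix \<phi> :: "'a grdual"
  assume "\<forall>s. dual_app \<phi> (gr_mono s) = (if s = t then 1 else 0)"
  then have "dual_coords \<phi> = fund t"
    by (intro poly_mapping_eqI) (simp add: coef_dual_coords coef_bvec)
  then show "\<phi> = dual_of (fund t)" using dual_of_dual_coords by metis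
qed

lemma dual_coords_dual_mono [simp]: "dual_coords (dual_mono t) = fund t"
  by (simp add: dual_mono_eq)

lemma sum_deconcs_flip:
  "(\<Sum>(r, s)\<leftarrow>deconcs t. of_bool (a = r) * of_bool (b = s)) = (of_bool (bslash a b = t) :: 'k::field)"
proof -
  have "(\<lambda>(r, s). of_bool (a = r) * of_bool (b = s) :: 'k) = (\<lambda>(r, s). of_bool (r = a) * of_bool (s = b))"
    by (auto simp: fun_eq_iff)
  then show ?thesis using sum_deconcs[of a b t, where 'k = 'k] by (simp only: eq_commute[of t])
qed

text \<open>The transpose of deconcatenation is concatenation; in these coordinates the dual is the
  free associative algebra on the irreducible trees.\<close>

lemma dual_coords_dual_mul:
  "dual_coords (dual_mul \<phi> \<psi>) = bilinext (\<lambda>r s. fund (bslash r s)) (dual_coords \<phi>) (dual_coords \<psi>)"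
proof -
  let ?x = "bilinext (\<lambda>r s. fund (bslash r s)) (dual_coords \<phi>) (dual_coords \<psi>)"
  have coef: "coef ?x t = (\<Sum>(r, s)\<leftarrow>deconcs t. dual_app \<phi> (gr_mono r) * dual_app \<psi> (gr_mono s))" for t
  proof -
    have "coef ?x t = lin_form (\<lambda>a. lin_form (\<lambda>b. \<Sum>(r, s)\<leftarrow>deconcs t. of_bool (a = r) * of_bool (b = s)) (dual_coords \<psi>)) (dual_coords \<phi>)"
      unfolding lin_form_of_bool[symmetric] lin_form_bilinext
      by (simp only: sum_deconcs_flip lin_form_single mult_1)
    then show ?thesis
      by (simp add: case_prod_unfold lin_form_fun_sum_list lin_form_fun_cmult lin_form_fun_multc coef_dual_coords)
  qed
  have "tensor_pair (dual_app \<phi>) (dual_app \<psi>) (gr_comul X) = lin_form (coef ?x) (gr_coords X)" for X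
    by (simp add: tensor_pair_gr_comul linear_dual_app coef cong: lin_form_cong)
  then have "dual_mul \<phi> \<psi> = dual_of ?x" by (simp add: dual_mul_def dual_of_def)
  then show ?thesis by simp
qed

lemma dual_unit_eq: "dual_unit = dual_mono Leaf"
proof -
  have "gr_counit = (\<lambda>X. lin_form (coef (fund Leaf)) (gr_coords X) :: 'a)"
    by (rule ext) (simp add: lin_form_eq_gr_counit lin_form_coef_sym[of "fund Leaf"])
  then show ?thesis by (simp add: dual_unit_def dual_mono_eq dual_of_def)
qed

lemma dual_counit_eq: "dual_counit \<phi> = coef (dual_coords \<phi>) Leaf"
  by (simp add: dual_counit_def gr_unit_eq coef_dual_coords)

lemma dual_homog_iff: "\<phi> \<in> dual_homog n \<longleftrightarrow> (\<forall>t. coef (dual_coords \<phi>) t \<noteq> 0 \<longrightarrow> nodes t = n)"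
proof
  assume "\<phi> \<in> dual_homog n"
  then show "\<forall>t. coef (dual_coords \<phi>) t \<noteq> 0 \<longrightarrow> nodes t = n"
    using gr_mono_in_homog by (fastforce simp: dual_homog_def coef_dual_coords)
next
  assume supp: "\<forall>t. coef (dual_coords \<phi>) t \<noteq> 0 \<longrightarrow> nodes t = n"
  have "dual_app \<phi> X = 0" if "X \<in> gr_homog m" "m \<noteq> n" for X m
  proof -
    have "coef (dual_coords \<phi>) t = 0" if "t \<in> Poly_Mapping.keys (gr_coords X)" for t
      using that \<open>X \<in> gr_homog m\<close> \<open>m \<noteq> n\<close> supp by (auto simp: gr_homog_iff in_keys_iff)
    then show ?thesis by (simp add: dual_app_eq cong: lin_form_cong)
  qed
  then show "\<phi> \<in> dual_homog n" by (simp add: dual_homog_def)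
qed

lemma dual_app_gr_mul:
  "dual_app \<phi> (gr_mul X Y) = lin_form (\<lambda>t. \<Sum>(a, b)\<leftarrow>pbt_unshuffles t. coef (gr_coords X) a * coef (gr_coords Y) b) (dual_coords \<phi>)"
proof -
  have "coef (gr_coords (gr_mul X Y)) t = (\<Sum>(a, b)\<leftarrow>pbt_unshuffles t. coef (gr_coords X) a * coef (gr_coords Y) b)" for t
    unfolding coef_gr_coords_gr_mul pbt_unshuffles_coeff_def
    by (simp add: case_prod_unfold lin_form_fun_sum_list lin_form_fun_cmult lin_form_fun_multc
        lin_form_of_bool_flip)
  then show ?thesis
    by (simp add: dual_app_eq lin_form_coef_sym[of "dual_coords \<phi>"] cong: lin_form_cong)
qed

text \<open>\<open>dual_comul\<close> has its selecting property as soon as some tensor has it;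
  unshuffling the components of the indices provides one.\<close>

lemma tensor_pair_dual_comul:
  "tensor_pair (\<lambda>\<alpha>. dual_app \<alpha> X) (\<lambda>\<beta>. dual_app \<beta> Y) (dual_comul \<phi>) =
     lin_form (\<lambda>t. \<Sum>(a, b)\<leftarrow>pbt_unshuffles t. coef (gr_coords X) a * coef (gr_coords Y) b) (dual_coords \<phi>)"
proof -
  let ?T = "linext (\<lambda>t. \<Sum>(a, b)\<leftarrow>pbt_unshuffles t. bvec (dual_mono a, dual_mono b)) (dual_coords \<phi>)"
  have "dual_app (dual_mono a) X = coef (gr_coords X) a" for a and X :: "'a gr"
    by (simp add: dual_mono_eq dual_app_dual_of lin_form_coef_sym[of "fund _"])
  then have "tensor_pair (\<lambda>\<alpha>. dual_app \<alpha> X) (\<lambda>\<beta>. dual_app \<beta> Y) ?T = dual_app \<phi> (gr_mul X Y)" for X Y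
    by (simp add: tensor_pair_eq_lin_form lin_form_linext lin_form_sum_list case_prod_unfold dual_app_gr_mul)
  then have "\<exists>T. \<forall>X Y. tensor_pair (\<lambda>\<alpha>. dual_app \<alpha> X) (\<lambda>\<beta>. dual_app \<beta> Y) T = dual_app \<phi> (gr_mul X Y)"
    by blast
  from someI_ex[OF this] show ?thesis
    by (simp add: dual_comul_def dual_app_gr_mul)
qed

section \<open>Products of ordered forests\<close>

primrec unshuffles :: "'a list \<Rightarrow> ('a list \<times> 'a list) list" where
  "unshuffles [] = [([], [])]"
| "unshuffles (x # xs) = map (\<lambda>(a, b). (x # a, b)) (unshuffles xs) @ map (\<lambda>(a, b). (a, x # b)) (unshuffles xs)"

lemma sum_unshuffles_Cons:
  fixes F :: "'a list \<Rightarrow> 'a list \<Rightarrow> 'b::comm_monoid_add"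
  shows "(\<Sum>(a, b)\<leftarrow>unshuffles (x # xs). F a b) =
     (\<Sum>(a, b)\<leftarrow>unshuffles xs. F (x # a) b) + (\<Sum>(a, b)\<leftarrow>unshuffles xs. F a (x # b))"
  by (simp add: case_prod_unfold o_def)

text \<open>
  \<open>forest_attach xs ys\<close> lists the forests obtained by attaching the trees of \<open>xs\<close> to nodes of \<open>ys\<close>; for
  \<open>forest_prod\<close>, the forest \<open>ys\<close> has an additional root, to which the trees of \<open>xs\<close> may be attached too.
\<close>

function forest_attach :: "otree list \<Rightarrow> otree list \<Rightarrow> otree list list" where
  "forest_attach xs [] = (if xs = [] then [[]] else [])"
| "forest_attach xs (ONode zs # ys) =
     concat (map (\<lambda>(a, b). concat (map (\<lambda>(c, d). concat (map (\<lambda>v. map (\<lambda>w. ONode (c @ v) # w) (forest_attach b ys))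
       (forest_attach d zs))) (unshuffles a))) (unshuffles xs))"
  by pat_completeness auto
termination by (relation "measure (\<lambda>(xs, ys). size_list size ys)") auto

definition forest_prod :: "otree list \<Rightarrow> otree list \<Rightarrow> otree list list" where
  "forest_prod xs ys = concat (map (\<lambda>(a, b). map ((@) a) (forest_attach b ys)) (unshuffles xs))"

lemma sum_forest_prod:
  fixes F :: "otree list \<Rightarrow> 'a::comm_monoid_add"
  shows "(\<Sum>z\<leftarrow>forest_prod xs ys. F z) = (\<Sum>(a, b)\<leftarrow>unshuffles xs. \<Sum>w\<leftarrow>forest_attach b ys. F (a @ w))"
  by (simp add: forest_prod_def sum_list_concat_map case_prod_unfold o_def)

lemma sum_forest_attach_Cons:
  fixes F :: "otree list \<Rightarrow> 'a::comm_monoid_add"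
  shows "(\<Sum>w\<leftarrow>forest_attach xs (ONode zs # ys). F w) =
    (\<Sum>(a, b)\<leftarrow>unshuffles xs. \<Sum>u\<leftarrow>forest_prod a zs. \<Sum>w\<leftarrow>forest_attach b ys. F (ONode u # w))"
  unfolding sum_forest_prod by (simp add: sum_list_concat_map case_prod_unfold o_def)

text \<open>The hypotheses for the children of the first tree and for the remaining trees stand in
  for a mutual induction on trees and forests.\<close>

lemma forest_induct [case_names Nil Cons]:
  assumes "P []" "\<And>zs ys. P zs \<Longrightarrow> P ys \<Longrightarrow> P (ONode zs # ys)"
  shows "P ys"
proof (induction ys rule: measure_induct_rule[of "size_list size"])
  case (less ys)
  show ?case
  proof (cases ys)
    case (Cons t us)
    obtain zs where "t = ONode zs" by (cases t)
    with Cons less assms(2) show ?thesis by simp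
  qed (use assms(1) in simp)
qed

lemma forest_attach_Nil [simp]: "forest_attach [] ys = [ys]"
  by (induction ys rule: forest_induct) auto

lemma sum_forest_prod_single:
  fixes F :: "otree list \<Rightarrow> 'a::comm_monoid_add"
  shows "(\<Sum>z\<leftarrow>forest_prod [c] ys. F z) = F (c # ys) + (\<Sum>w\<leftarrow>forest_attach [c] ys. F w)"
  unfolding sum_forest_prod by simp

lemma forest_prod_Nil [simp]: "forest_prod [] ys = [ys]"
  by (simp add: forest_prod_def)

lemma sum_forest_attach_single_Cons:
  fixes F :: "otree list \<Rightarrow> 'a::comm_monoid_add"
  shows "(\<Sum>w\<leftarrow>forest_attach [c] (ONode zs # ys). F w) =
    (\<Sum>u\<leftarrow>forest_prod [c] zs. F (ONode u # ys)) + (\<Sum>w\<leftarrow>forest_attach [c] ys. F (ONode zs # w))"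
  unfolding sum_forest_attach_Cons by simp

section \<open>Grafting a single tree: coderivation property and associativity\<close>

lemma forest_attach_single_append:
  fixes F :: "otree list \<Rightarrow> 'a::comm_monoid_add"
  shows "(\<Sum>w\<leftarrow>forest_attach [c] (xs @ ys). F w) =
    (\<Sum>w\<leftarrow>forest_attach [c] xs. F (w @ ys)) + (\<Sum>w\<leftarrow>forest_attach [c] ys. F (xs @ w))"
proof (induction xs arbitrary: F)
  case (Cons x xs)
  obtain zs where x: "x = ONode zs" by (cases x)
  show ?case
    unfolding x append_Cons sum_forest_attach_single_Cons Cons.IH[of "\<lambda>w. F (ONode zs # w)"] add.assoc ..
qed simp

text \<open>The tree \<open>c\<close> is grafted inside one member of the forest, and this member
  then goes to one of the two sides as a whole.\<close>

lemma forest_attach_single_unshuffles: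
  fixes F :: "otree list \<Rightarrow> otree list \<Rightarrow> 'a::comm_monoid_add"
  shows "(\<Sum>w\<leftarrow>forest_attach [c] xs. \<Sum>(a, b)\<leftarrow>unshuffles w. F a b) =
    (\<Sum>(a, b)\<leftarrow>unshuffles xs. (\<Sum>a'\<leftarrow>forest_attach [c] a. F a' b) + (\<Sum>b'\<leftarrow>forest_attach [c] b. F a b'))"
proof (induction xs arbitrary: F)
  case (Cons x xs)
  obtain zs where x: "x = ONode zs" by (cases x)
  show ?case
    unfolding x sum_forest_attach_single_Cons sum_unshuffles_Cons sum_list_addf sum_list_split_addf
      Cons.IH sum_list_swap_split'
    by (simp add: ac_simps)
qed simp

text \<open>The coderivation property of left multiplication by a planted tree: compared with
  \<open>forest_attach\<close>, \<open>c\<close> may also become a new member of the forest, which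
  goes to either side.\<close>

lemma forest_prod_single_unshuffles:
  fixes F :: "otree list \<Rightarrow> otree list \<Rightarrow> 'a::comm_monoid_add"
  shows "(\<Sum>w\<leftarrow>forest_prod [c] xs. \<Sum>(a, b)\<leftarrow>unshuffles w. F a b) =
    (\<Sum>(a, b)\<leftarrow>unshuffles xs. (\<Sum>a'\<leftarrow>forest_prod [c] a. F a' b) + (\<Sum>b'\<leftarrow>forest_prod [c] b. F a b'))"
  unfolding sum_forest_prod_single sum_unshuffles_Cons forest_attach_single_unshuffles sum_list_split_addf
  by (simp add: ac_simps)

lemma forest_attach_single_nonempty: "w \<in> set (forest_attach [c] xs) \<Longrightarrow> w \<noteq> []"
  by (induction xs rule: forest_induct) auto

text \<open>Stated relative to \<open>forest_attach\<close> because both associativity statements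
  come out of one induction: the inductive step of \<open>forest_attach_assoc\<close> applies this
  lemma to the children of the first tree.\<close>

lemma forest_prod_assoc_aux:
  fixes F :: "otree list \<Rightarrow> 'a::comm_monoid_add"
  assumes forest_attach: "\<And>xs F :: otree list \<Rightarrow> 'a. (\<Sum>u\<leftarrow>forest_attach xs ys. \<Sum>w\<leftarrow>forest_attach [c] u. F w) =
    (\<Sum>w\<leftarrow>forest_attach (c # xs) ys. F w) + (\<Sum>u\<leftarrow>forest_attach [c] xs. \<Sum>w\<leftarrow>forest_attach u ys. F w)"
  shows "(\<Sum>u\<leftarrow>forest_prod xs ys. \<Sum>w\<leftarrow>forest_prod [c] u. F w) = (\<Sum>u\<leftarrow>forest_prod [c] xs. \<Sum>w\<leftarrow>forest_prod u ys. F w)"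
proof -
  \<comment> \<open>The four sums correspond to the place of \<open>c\<close>: at the root, inside a
    tree of \<open>xs\<close> that stays at the root, at a node of \<open>ys\<close>, or inside a
    tree of \<open>xs\<close> that is attached to \<open>ys\<close>.\<close>
  have "(\<Sum>u\<leftarrow>forest_prod xs ys. \<Sum>w\<leftarrow>forest_prod [c] u. F w) =
      (\<Sum>(a, b)\<leftarrow>unshuffles xs. \<Sum>v\<leftarrow>forest_attach b ys. F (c # a @ v)) +
      ((\<Sum>(a, b)\<leftarrow>unshuffles xs. \<Sum>v\<leftarrow>forest_attach b ys. \<Sum>a'\<leftarrow>forest_attach [c] a. F (a' @ v)) +
       ((\<Sum>(a, b)\<leftarrow>unshuffles xs. \<Sum>v\<leftarrow>forest_attach (c # b) ys. F (a @ v)) +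
        (\<Sum>(a, b)\<leftarrow>unshuffles xs. \<Sum>b'\<leftarrow>forest_attach [c] b. \<Sum>v\<leftarrow>forest_attach b' ys. F (a @ v))))"
    unfolding sum_forest_prod[of _ xs] sum_forest_prod_single forest_attach_single_append sum_list_addf
      forest_attach[of "\<lambda>v. F (_ @ v)"] sum_list_split_addf ..
  also have "\<dots> = (\<Sum>u\<leftarrow>forest_prod [c] xs. \<Sum>w\<leftarrow>forest_prod u ys. F w)"
    unfolding sum_forest_prod_single sum_forest_prod[of _ _ ys] sum_unshuffles_Cons forest_attach_single_unshuffles sum_list_split_addf
      sum_list_swap[of _ "forest_attach [c] _" "forest_attach _ ys"]
    by (simp add: ac_simps)
  finally show ?thesis .
qed

text \<open>The node to which \<open>c\<close> is attached comes either from \<open>ys\<close> or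
  from a tree of \<open>xs\<close>. In the first case \<open>c\<close> precedes the trees of
  \<open>xs\<close> attached to the same node, hence \<open>c # xs\<close>.\<close>

lemma forest_attach_assoc:
  fixes F :: "otree list \<Rightarrow> 'a::comm_monoid_add"
  shows "(\<Sum>u\<leftarrow>forest_attach xs ys. \<Sum>w\<leftarrow>forest_attach [c] u. F w) =
    (\<Sum>w\<leftarrow>forest_attach (c # xs) ys. F w) + (\<Sum>u\<leftarrow>forest_attach [c] xs. \<Sum>w\<leftarrow>forest_attach u ys. F w)"
proof (induction ys arbitrary: xs F rule: forest_induct)
  case Nil
  have "map (\<lambda>u. \<Sum>w\<leftarrow>forest_attach u []. F w) (forest_attach [c] xs) = map (\<lambda>u. 0) (forest_attach [c] xs)"
    using forest_attach_single_nonempty[of _ c xs] by auto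
  then have "(\<Sum>u\<leftarrow>forest_attach [c] xs. \<Sum>w\<leftarrow>forest_attach u []. F w) = 0"
    by (simp only: sum_list_0)
  then show ?case by simp
next
  case (Cons zs ys)
  note forest_prod_assoc = forest_prod_assoc_aux[OF Cons.IH(1)]
  let ?H = "\<lambda>a b. \<Sum>u\<leftarrow>forest_prod a zs. \<Sum>w\<leftarrow>forest_attach b ys. F (ONode u # w)"
  have "(\<Sum>u\<leftarrow>forest_attach xs (ONode zs # ys). \<Sum>w\<leftarrow>forest_attach [c] u. F w) =
      (\<Sum>(a, b)\<leftarrow>unshuffles xs. \<Sum>u\<leftarrow>forest_prod a zs. \<Sum>w\<leftarrow>forest_attach b ys. \<Sum>u'\<leftarrow>forest_prod [c] u. F (ONode u' # w)) +
      (\<Sum>(a, b)\<leftarrow>unshuffles xs. \<Sum>u\<leftarrow>forest_prod a zs. \<Sum>w\<leftarrow>forest_attach b ys. \<Sum>w'\<leftarrow>forest_attach [c] w. F (ONode u # w'))"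
    unfolding sum_forest_attach_Cons[of _ xs] sum_forest_attach_single_Cons sum_list_addf sum_list_split_addf ..
  also have "(\<Sum>(a, b)\<leftarrow>unshuffles xs. \<Sum>u\<leftarrow>forest_prod a zs. \<Sum>w\<leftarrow>forest_attach b ys. \<Sum>u'\<leftarrow>forest_prod [c] u. F (ONode u' # w)) =
      (\<Sum>(a, b)\<leftarrow>unshuffles xs. ?H (c # a) b + (\<Sum>a'\<leftarrow>forest_attach [c] a. ?H a' b))"
    unfolding sum_list_swap[of _ "forest_prod [c] _" "forest_attach _ ys"]
    unfolding forest_prod_assoc[of "\<lambda>u. \<Sum>w\<leftarrow>forest_attach _ ys. F (ONode u # w)"]
    unfolding sum_forest_prod_single ..
  also have "(\<Sum>(a, b)\<leftarrow>unshuffles xs. \<Sum>u\<leftarrow>forest_prod a zs. \<Sum>w\<leftarrow>forest_attach b ys. \<Sum>w'\<leftarrow>forest_attach [c] w. F (ONode u # w')) =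
      (\<Sum>(a, b)\<leftarrow>unshuffles xs. ?H a (c # b) + (\<Sum>b'\<leftarrow>forest_attach [c] b. ?H a b'))"
    unfolding Cons.IH(2)[of "\<lambda>w. F (ONode _ # w)"] sum_list_addf
      sum_list_swap[of _ "forest_attach [c] _" "forest_prod _ zs"] ..
  also have "(\<Sum>(a, b)\<leftarrow>unshuffles xs. ?H (c # a) b + (\<Sum>a'\<leftarrow>forest_attach [c] a. ?H a' b)) +
      (\<Sum>(a, b)\<leftarrow>unshuffles xs. ?H a (c # b) + (\<Sum>b'\<leftarrow>forest_attach [c] b. ?H a b')) =
      (\<Sum>w\<leftarrow>forest_attach (c # xs) (ONode zs # ys). F w) +
      (\<Sum>u\<leftarrow>forest_attach [c] xs. \<Sum>w\<leftarrow>forest_attach u (ONode zs # ys). F w)"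
    unfolding sum_forest_attach_Cons sum_unshuffles_Cons forest_attach_single_unshuffles sum_list_split_addf
    by (simp only: ac_simps)
  finally show ?case .
qed

lemmas forest_prod_assoc = forest_prod_assoc_aux[OF forest_attach_assoc]

text \<open>
  The sum over all maps from the trees of a forest to the addresses in \<open>N\<close>; \<open>F\<close> is applied to the
  function that returns the list of trees sent to a given address.
\<close>

primrec sum_assignments :: "otree list \<Rightarrow> nat list set \<Rightarrow> ((nat list \<Rightarrow> otree list) \<Rightarrow> 'a) \<Rightarrow> 'a::comm_monoid_add" where
  "sum_assignments [] N F = F (\<lambda>_. [])"
| "sum_assignments (c # xs) N F = (\<Sum>v\<in>N. sum_assignments xs N (\<lambda>g. F (g(v := c # g v))))"

lemma sum_PiE_eq_sum_assignments:
  fixes F :: "(nat list \<Rightarrow> otree list) \<Rightarrow> 'a::comm_monoid_add"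
  shows "(\<Sum>f\<in>{..<length cs} \<rightarrow>\<^sub>E N. F (\<lambda>p. map ((!) cs) (filter (\<lambda>i. f i = p) [0..<length cs]))) = sum_assignments cs N F"
proof (induction cs arbitrary: F)
  case Nil
  show ?case by simp
next
  case (Cons c cs)
  let ?k = "length cs"
  let ?h = "\<lambda>cs f p. map ((!) cs) (filter (\<lambda>i. f i = p) [0..<length cs])"
  have "(\<Sum>f\<in>{..<length (c # cs)} \<rightarrow>\<^sub>E N. F (?h (c # cs) f)) =
      (\<Sum>(v, f)\<in>N \<times> ({..<?k} \<rightarrow>\<^sub>E N). F ((?h cs f)(v := c # ?h cs f v)))"
  proof (rule sum.reindex_bij_witness[where
        i = "\<lambda>(v, f). \<lambda>i\<in>{..<Suc ?k}. case i of 0 \<Rightarrow> v | Suc j \<Rightarrow> f j" and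
        j = "\<lambda>f. (f 0, \<lambda>j\<in>{..<?k}. f (Suc j))"], goal_cases)
    case (1 f)
    then show ?case
      by (auto simp: fun_eq_iff restrict_def PiE_def extensional_def split: nat.splits)
  next
    case (2 f)
    then show ?case by auto
  next
    case (3 vf)
    then show ?case
      by (auto simp: fun_eq_iff restrict_def PiE_def extensional_def)
  next
    case (4 vf)
    then show ?case
      by (auto simp: restrict_def PiE_def extensional_def split: nat.splits)
  next
    case (5 f)
    let ?f = "\<lambda>j\<in>{..<?k}. f (Suc j)"
    have "?h (c # cs) f p = (if f 0 = p then [c] else []) @ ?h cs (\<lambda>j. f (Suc j)) p" for p
      by (simp add: upt_conv_Cons filter_map o_def del: upt_Suc flip: map_Suc_upt)
    moreover have "?h cs ?f p = ?h cs (\<lambda>j. f (Suc j)) p" for p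
      by (intro arg_cong[of _ _ "map _"] filter_cong) auto
    ultimately have "?h (c # cs) f = (?h cs ?f)(f 0 := c # ?h cs ?f (f 0))"
      by (auto simp: fun_eq_iff)
    then show ?case by simp
  qed
  also have "\<dots> = sum_assignments (c # cs) N F"
    by (simp add: Cons.IH[of "\<lambda>g. F (g(_ := c # g _))"] flip: sum.cartesian_product)
  finally show ?case .
qed

section \<open>Sums over assignments of trees to addresses\<close>

lemma sum_assignments_sum: "sum_assignments xs N (\<lambda>g. \<Sum>v\<in>M. F v g) = (\<Sum>v\<in>M. sum_assignments xs N (F v))"
proof (induction xs arbitrary: F)
  case (Cons c xs)
  show ?case by (simp add: Cons.IH) (rule sum.swap)
qed simp

text \<open>An assignment into a disjoint union amounts to an unshuffling of the trees and an
  assignment on each side. The predicate \<open>R\<close> tells the sides apart, so that two local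
  assignments can be glued.\<close>

lemma sum_assignments_union:
  fixes F :: "(nat list \<Rightarrow> otree list) \<Rightarrow> 'a::comm_monoid_add"
  assumes fin: "finite N1" "finite N2"
    and N1: "\<And>v. v \<in> N1 \<Longrightarrow> R v" and N2: "\<And>v. v \<in> N2 \<Longrightarrow> \<not> R v"
  shows "sum_assignments xs (N1 \<union> N2) F = (\<Sum>(a, b)\<leftarrow>unshuffles xs. sum_assignments a N1 (\<lambda>g1. sum_assignments b N2 (\<lambda>g2.
    F (\<lambda>p. if R p then g1 p else g2 p))))"
proof (induction xs arbitrary: F)
  case (Cons c xs)
  let ?m = "\<lambda>g1 g2 p. if R p then g1 p else g2 p :: otree list"
  have 1: "(?m g1 g2)(v := c # ?m g1 g2 v) = ?m (g1(v := c # g1 v)) g2" if "v \<in> N1" for v g1 g2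
    using N1[OF that] by auto
  have 2: "(?m g1 g2)(v := c # ?m g1 g2 v) = ?m g1 (g2(v := c # g2 v))" if "v \<in> N2" for v g1 g2
    using N2[OF that] by auto
  have "N1 \<inter> N2 = {}" using N1 N2 by blast
  then have "sum_assignments (c # xs) (N1 \<union> N2) F =
      (\<Sum>v\<in>N1. sum_assignments xs (N1 \<union> N2) (\<lambda>g. F (g(v := c # g v)))) +
      (\<Sum>v\<in>N2. sum_assignments xs (N1 \<union> N2) (\<lambda>g. F (g(v := c # g v))))"
    using fin by (simp add: sum.union_disjoint)
  also have "(\<Sum>v\<in>N1. sum_assignments xs (N1 \<union> N2) (\<lambda>g. F (g(v := c # g v)))) =
      (\<Sum>v\<in>N1. \<Sum>(a, b)\<leftarrow>unshuffles xs. sum_assignments a N1 (\<lambda>g1. sum_assignments b N2 (\<lambda>g2. F (?m (g1(v := c # g1 v)) g2))))"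
    unfolding Cons.IH by (intro sum.cong refl) (simp only: 1)
  also have "\<dots> = (\<Sum>(a, b)\<leftarrow>unshuffles xs. sum_assignments (c # a) N1 (\<lambda>g1. sum_assignments b N2 (\<lambda>g2. F (?m g1 g2))))"
    by (simp add: case_prod_unfold sum_sum_list_swap)
  also have "(\<Sum>v\<in>N2. sum_assignments xs (N1 \<union> N2) (\<lambda>g. F (g(v := c # g v)))) =
      (\<Sum>v\<in>N2. \<Sum>(a, b)\<leftarrow>unshuffles xs. sum_assignments a N1 (\<lambda>g1. sum_assignments b N2 (\<lambda>g2. F (?m g1 (g2(v := c # g2 v))))))"
    unfolding Cons.IH by (intro sum.cong refl) (simp only: 2)
  also have "\<dots> = (\<Sum>(a, b)\<leftarrow>unshuffles xs. sum_assignments a N1 (\<lambda>g1. sum_assignments (c # b) N2 (\<lambda>g2. F (?m g1 g2))))"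
    by (simp add: case_prod_unfold sum_sum_list_swap sum_assignments_sum)
  finally show ?case unfolding sum_unshuffles_Cons .
qed simp

lemma sum_assignments_image_Cons: "sum_assignments xs ((#) n ` N) (\<lambda>g. F (\<lambda>p. g (n # p))) = sum_assignments xs N F"
proof (induction xs arbitrary: F)
  case (Cons c xs)
  have "sum_assignments (c # xs) ((#) n ` N) (\<lambda>g. F (\<lambda>p. g (n # p))) =
      (\<Sum>v\<in>N. sum_assignments xs ((#) n ` N) (\<lambda>g. F (\<lambda>p. (g(n # v := c # g (n # v))) (n # p))))"
    by (simp add: sum.reindex)
  also have "\<dots> = (\<Sum>v\<in>N. sum_assignments xs N (\<lambda>g. F (g(v := c # g v))))"
  proof (rule sum.cong[OF refl])
    fix v
    have "(\<lambda>p. (g(n # v := c # g (n # v))) (n # p)) = (\<lambda>p. g (n # p))(v := c # g (n # v))" for g :: "nat list \<Rightarrow> otree list"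
      by auto
    then show "sum_assignments xs ((#) n ` N) (\<lambda>g. F (\<lambda>p. (g(n # v := c # g (n # v))) (n # p))) =
        sum_assignments xs N (\<lambda>g. F (g(v := c # g v)))"
      using Cons.IH[of "\<lambda>g. F (g(v := c # g v))"] by simp
  qed
  finally show ?case by simp
qed simp

lemma sum_assignments_singleton: "sum_assignments xs {v} (\<lambda>g. F (g v)) = F xs"
  by (induction xs arbitrary: F) simp_all

lemma sum_assignments_empty: "sum_assignments xs {} F = (if xs = [] then F (\<lambda>_. []) else 0)"
  by (cases xs) auto

text \<open>Addresses in a forest whose trees are the children of number \<open>n, n + 1, \<dots>\<close> of some node.\<close>

primrec Nods :: "nat \<Rightarrow> otree list \<Rightarrow> nat list set" where
  "Nods n [] = {}"
| "Nods n (t # ts) = (#) n ` Nod t \<union> Nods (Suc n) ts"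

primrec attachs :: "nat \<Rightarrow> (nat list \<Rightarrow> otree list) \<Rightarrow> otree list \<Rightarrow> otree list" where
  "attachs n g [] = []"
| "attachs n g (t # ts) = attach (\<lambda>p. g (n # p)) t # attachs (Suc n) g ts"

lemma Nods_eq: "Nods n ts = (\<Union>i<length ts. (#) (n + i) ` Nod (ts ! i))"
  by (induction ts arbitrary: n) (auto simp: lessThan_Suc_eq_insert_0)

lemma Nod_ONode: "Nod (ONode ts) = {[]} \<union> Nods 0 ts"
  by (simp add: Nods_eq)

lemma attachs_eq: "attachs n g ts = map (\<lambda>i. attach (\<lambda>p. g ((n + i) # p)) (ts ! i)) [0..<length ts]"
proof (induction ts arbitrary: n)
  case (Cons t ts)
  show ?case
    by (simp add: Cons upt_conv_Cons o_def del: upt_Suc flip: map_Suc_upt)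
qed simp

lemma attach_ONode: "attach g (ONode ts) = ONode (g [] @ attachs 0 g ts)"
  by (simp add: attachs_eq)

lemma finite_Nods: "finite (Nods n ts)"
  by (induction ts arbitrary: n rule: forest_induct) (auto simp: Nod_ONode simp del: Nod.simps)

lemma Nods_head: "q \<in> Nods n ts \<Longrightarrow> \<exists>m p. n \<le> m \<and> q = m # p"
  by (auto simp: Nods_eq)

lemma attachs_cong:
  "(\<And>m p. n \<le> m \<Longrightarrow> g (m # p) = h (m # p)) \<Longrightarrow> attachs n g ts = attachs n h ts"
  by (auto simp: attachs_eq)

text \<open>The root is the only node with address \<open>[]\<close>: the trees sent there become
  new leftmost children, and the others are distributed over the forest of old children.\<close>

lemma sum_assignments_attach_aux:
  fixes F :: "otree \<Rightarrow> 'a::comm_monoid_add"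
  assumes "\<And>xs F :: otree list \<Rightarrow> 'a. sum_assignments xs (Nods 0 ts) (\<lambda>g. F (attachs 0 g ts)) = (\<Sum>w\<leftarrow>forest_attach xs ts. F w)"
  shows "sum_assignments xs (Nod (ONode ts)) (\<lambda>g. F (attach g (ONode ts))) = (\<Sum>z\<leftarrow>forest_prod xs ts. F (ONode z))"
proof -
  have "attachs 0 (\<lambda>p. if p = [] then g1 p else g2 p) ts = attachs 0 g2 ts" for g1 g2
    by (rule attachs_cong) simp
  then have "sum_assignments xs (Nod (ONode ts)) (\<lambda>g. F (attach g (ONode ts))) =
      (\<Sum>(a, b)\<leftarrow>unshuffles xs. sum_assignments a {[]} (\<lambda>g1. sum_assignments b (Nods 0 ts) (\<lambda>g2. F (ONode (g1 [] @ attachs 0 g2 ts)))))"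
    unfolding Nod_ONode attach_ONode
    by (subst sum_assignments_union[where R = "\<lambda>p. p = []"]) (auto simp: finite_Nods dest: Nods_head)
  moreover have "sum_assignments a {[]} (\<lambda>g1. \<Sum>w\<leftarrow>forest_attach b ts. F (ONode (g1 [] @ w))) =
      (\<Sum>w\<leftarrow>forest_attach b ts. F (ONode (a @ w)))" for a b
    by (rule sum_assignments_singleton)
  ultimately show ?thesis
    unfolding assms[of _ "\<lambda>w. F (ONode (_ @ w))"] sum_forest_prod by (simp only:)
qed

lemma sum_assignments_attachs:
  fixes F :: "otree list \<Rightarrow> 'a::comm_monoid_add"
  shows "sum_assignments xs (Nods n ts) (\<lambda>g. F (attachs n g ts)) = (\<Sum>w\<leftarrow>forest_attach xs ts. F w)"
proof (induction ts arbitrary: xs n F rule: forest_induct)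
  case Nil
  show ?case by (simp add: sum_assignments_empty)
next
  case (Cons zs ts)
  note sum_assignments_attach = sum_assignments_attach_aux[OF Cons.IH(1)]
  \<comment> \<open>The addresses in the first tree are those that begin with
    \<open>n\<close>.\<close>
  let ?R = "\<lambda>p. p \<noteq> [] \<and> hd p = n"
  have "attachs (Suc n) (\<lambda>p. if ?R p then g1 p else g2 p) ts = attachs (Suc n) g2 ts" for g1 g2
    by (rule attachs_cong) simp
  then have "sum_assignments xs (Nods n (ONode zs # ts)) (\<lambda>g. F (attachs n g (ONode zs # ts))) =
      (\<Sum>(a, b)\<leftarrow>unshuffles xs. sum_assignments a ((#) n ` Nod (ONode zs)) (\<lambda>g1. sum_assignments b (Nods (Suc n) ts) (\<lambda>g2.
        F (attach (\<lambda>p. g1 (n # p)) (ONode zs) # attachs (Suc n) g2 ts))))"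
    unfolding Nods.simps attachs.simps
    by (subst sum_assignments_union[where R = ?R])
       (auto simp: finite_Nods Nod_ONode simp del: Nod.simps attach.simps dest: Nods_head)
  also have "\<dots> = (\<Sum>(a, b)\<leftarrow>unshuffles xs. \<Sum>u\<leftarrow>forest_prod a zs. \<Sum>w\<leftarrow>forest_attach b ts. F (ONode u # w))"
    unfolding sum_assignments_image_Cons[of _ n _ "\<lambda>g. sum_assignments _ (Nods (Suc n) ts) (\<lambda>g2. F (attach g (ONode zs) # attachs (Suc n) g2 ts))"]
      sum_assignments_attach[of _ "\<lambda>t. sum_assignments _ (Nods (Suc n) ts) (\<lambda>g2. F (t # attachs (Suc n) g2 ts))"]
      Cons.IH(2)[of _ _ "\<lambda>w. F (ONode _ # w)"] ..
  finally show ?case unfolding sum_forest_attach_Cons .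
qed

text \<open>Links the definition of the Grossman-Larson product by maps into the nodes with the
  recursive lists for which associativity and the coderivation property are available.\<close>

lemma sum_sharp:
  fixes F :: "otree \<Rightarrow> 'a::comm_monoid_add"
  shows "(\<Sum>f\<in>{..<ocomp x} \<rightarrow>\<^sub>E Nod y. F (sharp x f y)) =
    (\<Sum>z\<leftarrow>forest_prod (children x) (children y). F (ONode z))"
proof -
  obtain ys where "y = ONode ys" by (cases y)
  then show ?thesis
    using sum_assignments_attach_aux[OF sum_assignments_attachs, where F = F and xs = "children x" and ts = ys]
    by (simp add: sharp_def ocomp_def sum_PiE_eq_sum_assignments[where F = "\<lambda>g. F (attach g (ONode ys))"] del: attach.simps Nod.simps)
qed

text \<open>A subset puts the first entry into the left part if it contains 0 and into the right
  part otherwise; shifting by \<open>Suc\<close> describes what it does to the rest.\<close>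

lemma sum_Pow_nths:
  fixes F :: "'a list \<Rightarrow> 'a list \<Rightarrow> 'b::comm_monoid_add"
  shows "(\<Sum>S\<in>Pow {..<length cs}. F (nths cs S) (nths cs ({..<length cs} - S))) = (\<Sum>(a, b)\<leftarrow>unshuffles cs. F a b)"
proof (induction cs arbitrary: F)
  case (Cons c cs)
  let ?A = "{..<length cs}"
  have inj: "inj_on ((`) Suc) (Pow ?A)" "inj_on (\<lambda>T. insert 0 (Suc ` T)) (Pow ?A)"
    by (auto simp: inj_on_def image_iff insert_eq_iff)
  have Pow: "Pow {..<length (c # cs)} = (`) Suc ` Pow ?A \<union> (\<lambda>T. insert 0 (Suc ` T)) ` Pow ?A"
    by (simp add: lessThan_Suc_eq_insert_0 Pow_insert image_Pow_surj[OF refl, symmetric] image_image Un_commute)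
  have nths: "nths (c # cs) (Suc ` T) = nths cs T" "nths (c # cs) (insert 0 (Suc ` T)) = c # nths cs T"
    "nths (c # cs) ({..<Suc (length cs)} - Suc ` T) = c # nths cs (?A - T)"
    "nths (c # cs) ({..<Suc (length cs)} - insert 0 (Suc ` T)) = nths cs (?A - T)" for T
  proof -
    have "{j. Suc j \<in> Suc ` T} = T" "{j. j < length cs \<and> Suc j \<notin> Suc ` T} = ?A - T" by auto
    then show "nths (c # cs) (Suc ` T) = nths cs T" "nths (c # cs) (insert 0 (Suc ` T)) = c # nths cs T"
      "nths (c # cs) ({..<Suc (length cs)} - Suc ` T) = c # nths cs (?A - T)"
      "nths (c # cs) ({..<Suc (length cs)} - insert 0 (Suc ` T)) = nths cs (?A - T)"
      by (auto simp: nths_Cons)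
  qed
  have "(\<Sum>S\<in>Pow {..<length (c # cs)}. F (nths (c # cs) S) (nths (c # cs) ({..<length (c # cs)} - S))) =
      (\<Sum>T\<in>Pow ?A. F (nths cs T) (c # nths cs (?A - T))) + (\<Sum>T\<in>Pow ?A. F (c # nths cs T) (nths cs (?A - T)))"
    unfolding Pow by (subst sum.union_disjoint) (auto simp: sum.reindex[OF inj(1)] sum.reindex[OF inj(2)] o_def nths)
  then show ?case
    unfolding sum_unshuffles_Cons Cons.IH[symmetric] by (simp add: add.commute)
qed simp

section \<open>Equality in tensor products of free vector spaces\<close>

definition tensor_coords :: "(('a \<Rightarrow>\<^sub>0 'k::field) \<times> ('b \<Rightarrow>\<^sub>0 'k) \<Rightarrow>\<^sub>0 'k) \<Rightarrow> ('a \<times> 'b \<Rightarrow>\<^sub>0 'k)" where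
  "tensor_coords = linext (\<lambda>(a, b). bilinext (\<lambda>x y. bvec (x, y)) a b)"

context
  fixes R :: "(('a \<Rightarrow>\<^sub>0 'k::field) \<times> ('b \<Rightarrow>\<^sub>0 'k) \<Rightarrow>\<^sub>0 'k) set"
  defines "R \<equiv> fvs.span (tensor_relations fscale fscale)"
begin

lemma tensor_relations_in_span:
  "bvec (a + a', b) - bvec (a, b) - bvec (a', b) \<in> R"
  "bvec (a, b + b') - bvec (a, b) - bvec (a, b') \<in> R"
  "bvec (fscale c a, b) - fscale c (bvec (a, b)) \<in> R"
  "bvec (a, fscale c b) - fscale c (bvec (a, b)) \<in> R"
  unfolding R_def single_eq_fscale[of _ c, symmetric] tensor_relations_def by (intro fvs.span_base; blast)+

lemma tensor_sum_left:
  "finite A \<Longrightarrow> bvec (\<Sum>x\<in>A. g x, b) - (\<Sum>x\<in>A. bvec (g x, b)) \<in> R"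
proof (induction rule: finite_induct)
  case empty
  show ?case using tensor_relations_in_span(3)[of 0 0 b] by simp
next
  case (insert x A)
  have "bvec (\<Sum>x\<in>insert x A. g x, b) - (\<Sum>x\<in>insert x A. bvec (g x, b)) =
      (bvec (g x + (\<Sum>x\<in>A. g x), b) - bvec (g x, b) - bvec (\<Sum>x\<in>A. g x, b)) +
      (bvec (\<Sum>x\<in>A. g x, b) - (\<Sum>x\<in>A. bvec (g x, b)))"
    using insert by simp
  also have "\<dots> \<in> R"
    using insert.IH tensor_relations_in_span(1) unfolding R_def by (rule fvs.span_add[rotated])
  finally show ?case .
qed

lemma tensor_sum_right:
  "finite A \<Longrightarrow> bvec (a, \<Sum>x\<in>A. g x) - (\<Sum>x\<in>A. bvec (a, g x)) \<in> R"
proof (induction rule: finite_induct)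
  case empty
  show ?case using tensor_relations_in_span(4)[of a 0 0] by simp
next
  case (insert x A)
  have "bvec (a, \<Sum>x\<in>insert x A. g x) - (\<Sum>x\<in>insert x A. bvec (a, g x)) =
      (bvec (a, g x + (\<Sum>x\<in>A. g x)) - bvec (a, g x) - bvec (a, \<Sum>x\<in>A. g x)) +
      (bvec (a, \<Sum>x\<in>A. g x) - (\<Sum>x\<in>A. bvec (a, g x)))"
    using insert by simp
  also have "\<dots> \<in> R"
    using insert.IH tensor_relations_in_span(2) unfolding R_def by (rule fvs.span_add[rotated])
  finally show ?case .
qed

lemma R_trans: "u - v \<in> R \<Longrightarrow> v - w \<in> R \<Longrightarrow> u - w \<in> R"
  unfolding R_def using fvs.span_add[of "u - v" _ "v - w"] by simp

lemma tensor_linext_left: "bvec (a, b) - linext (\<lambda>x. bvec (bvec x, b)) a \<in> R"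
proof -
  have "bvec (a, b) - (\<Sum>x\<in>Poly_Mapping.keys a. bvec (fscale (coef a x) (bvec x), b)) \<in> R"
    using tensor_sum_left[OF finite_keys[of a], of "\<lambda>x. fscale (coef a x) (bvec x)" b]
    by (simp flip: linext_def)
  moreover have "(\<Sum>x\<in>Poly_Mapping.keys a. bvec (fscale (coef a x) (bvec x), b)) -
      linext (\<lambda>x. bvec (bvec x, b)) a \<in> R"
    unfolding linext_def sum_subtractf[symmetric] R_def
    by (rule fvs.span_sum)
       (rule tensor_relations_in_span(3)[unfolded R_def])
  ultimately show ?thesis by (rule R_trans)
qed

lemma tensor_linext_right: "bvec (a, b) - linext (\<lambda>y. bvec (a, bvec y)) b \<in> R"
proof -
  have "bvec (a, b) - (\<Sum>x\<in>Poly_Mapping.keys b. bvec (a, fscale (coef b x) (bvec x))) \<in> R"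
    using tensor_sum_right[OF finite_keys[of b], of a "\<lambda>x. fscale (coef b x) (bvec x)"]
    by (simp flip: linext_def)
  moreover have "(\<Sum>x\<in>Poly_Mapping.keys b. bvec (a, fscale (coef b x) (bvec x))) -
      linext (\<lambda>y. bvec (a, bvec y)) b \<in> R"
    unfolding linext_def sum_subtractf[symmetric] R_def
    by (rule fvs.span_sum)
       (rule tensor_relations_in_span(4)[unfolded R_def])
  ultimately show ?thesis by (rule R_trans)
qed

lemma linext_cong_R: "(\<And>a. f a - g a \<in> R) \<Longrightarrow> linext f x - linext g x \<in> R"
  unfolding linext_fun_diff[symmetric] R_def by (rule linext_in_span)

text \<open>Modulo bilinearity, both entries of every generator can be expanded in basis
  vectors.\<close>

lemma tensor_coords_cong_R: "u - linext (\<lambda>(x, y). bvec (bvec x, bvec y)) (tensor_coords u) \<in> R"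
proof -
  have "bvec (a, b) - linext (\<lambda>x. linext (\<lambda>y. bvec (bvec x, bvec y)) b) a \<in> R" for a b
    using tensor_linext_left linext_cong_R[OF tensor_linext_right] by (rule R_trans)
  then have "linext bvec u - linext (\<lambda>(a, b). linext (\<lambda>x. linext (\<lambda>y. bvec (bvec x, bvec y)) b) a) u \<in> R"
    by (intro linext_cong_R) auto
  then show ?thesis
    by (simp add: tensor_coords_def bilinext_def linext_linext linext_single case_prod_unfold)
qed

end

lemma coef_tensor_coords:
  fixes u :: "('a \<Rightarrow>\<^sub>0 'k::field) \<times> ('b \<Rightarrow>\<^sub>0 'k) \<Rightarrow>\<^sub>0 'k"
  shows "coef (tensor_coords u) (x, y) = lin_form (\<lambda>(a, b). coef a x * coef b y) u"
proof -
  have "coef (bilinext (\<lambda>x y. bvec (x, y)) a b) (x, y) = coef a x * coef b y" for a :: "'a \<Rightarrow>\<^sub>0 'k" and b :: "'b \<Rightarrow>\<^sub>0 'k"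
    unfolding lin_form_of_bool[symmetric] lin_form_bilinext
    by (simp add: coef_bvec of_bool_conj lin_form_fun_cmult lin_form_fun_multc)
  then show ?thesis by (simp add: tensor_coords_def coef_linext case_prod_unfold)
qed

text \<open>Both tensors are congruent to the expansion of the same coordinates.\<close>

lemma tensor_eqI:
  assumes "\<And>x y. lin_form (\<lambda>(a, b). coef a x * coef b y) u = lin_form (\<lambda>(a, b). coef a x * coef b y) v"
  shows "tensor_eq fscale fscale u v"
proof -
  have "tensor_coords u = tensor_coords v"
  proof (rule poly_mapping_eqI)
    fix p
    show "coef (tensor_coords u) p = coef (tensor_coords v) p"
      using assms by (cases p) (simp add: coef_tensor_coords)
  qed
  then show ?thesis
    using fvs.span_diff[OF tensor_coords_cong_R[of u] tensor_coords_cong_R[of v]] by (simp add: tensor_eq_def)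
qed

section \<open>The isomorphism\<close>

text \<open>
  Stripping off the root, the terms of the iterated product of the planted trees corresponding to
  the irreducible components.
\<close>

primrec theta_forests :: "pbt \<Rightarrow> otree list list" where
  "theta_forests Leaf = [[]]"
| "theta_forests (Node l r) = concat (map (forest_prod [psi l]) (theta_forests r))"

lemma sum_theta_forests_Node: "(\<Sum>z\<leftarrow>theta_forests (Node l r). F z) = (\<Sum>z\<leftarrow>theta_forests r. \<Sum>w\<leftarrow>forest_prod [psi l] z. F w)"
  by (simp add: sum_list_concat_map)

text \<open>The planted factors of \<open>r\<close> are stripped off one at a time, so associativity
  with a planted left factor suffices.\<close>

lemma sum_theta_forests_bslash:
  fixes F :: "otree list \<Rightarrow> 'a::comm_monoid_add"
  shows "(\<Sum>z\<leftarrow>theta_forests (bslash r s). F z) = (\<Sum>x\<leftarrow>theta_forests r. \<Sum>y\<leftarrow>theta_forests s. \<Sum>z\<leftarrow>forest_prod x y. F z)"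
proof (induction r arbitrary: F)
  case (Node l r)
  show ?case
    unfolding bslash.simps sum_theta_forests_Node Node.IH(2) forest_prod_assoc
      sum_list_swap[of _ "forest_prod [psi l] _" "theta_forests s"] ..
qed simp

text \<open>By the coderivation property each planted factor multiplies one of the two sides, which
  is the recursion of \<open>pbt_unshuffles\<close>.\<close>

lemma sum_theta_forests_pbt_unshuffles:
  fixes F :: "otree list \<Rightarrow> otree list \<Rightarrow> 'a::comm_monoid_add"
  shows "(\<Sum>z\<leftarrow>theta_forests t. \<Sum>(a, b)\<leftarrow>unshuffles z. F a b) = (\<Sum>(r, s)\<leftarrow>pbt_unshuffles t. \<Sum>a\<leftarrow>theta_forests r. \<Sum>b\<leftarrow>theta_forests s. F a b)"
proof (induction t arbitrary: F)
  case (Node l t)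
  show ?case
    unfolding sum_theta_forests_Node[of _ l t] forest_prod_single_unshuffles Node.IH(2) sum_pbt_unshuffles_Node
    unfolding sum_theta_forests_Node sum_list_addf sum_list_split_addf
      sum_list_swap[of _ "theta_forests _" "forest_prod [psi l] _"] ..
qed simp

text \<open>The image of the dual basis vector at \<open>t\<close>: the product, in the Hopf algebra
  of ordered trees, of the planted trees of the irreducible components of \<open>t\<close>.\<close>

definition theta :: "pbt \<Rightarrow> 'k::field ho" where
  "theta t = (\<Sum>z\<leftarrow>theta_forests t. bvec (ONode z))"

definition Theta :: "'k::field ysym \<Rightarrow> 'k ho" where
  "Theta = linext theta"

lemma lin_form_Theta: "lin_form F (Theta x) = lin_form (\<lambda>t. \<Sum>z\<leftarrow>theta_forests t. F (ONode z)) x"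
  by (simp add: Theta_def theta_def lin_form_linext lin_form_sum_list)

lemma lin_form_ho_mul:
  "lin_form F (ho_mul x y) =
     lin_form (\<lambda>a. lin_form (\<lambda>b. \<Sum>z\<leftarrow>forest_prod (children a) (children b). F (ONode z)) y) x"
  by (simp add: ho_mul_def lin_form_bilinext lin_form_sum sum_sharp)

lemma Theta_mul: "Theta (bilinext (\<lambda>r s. fund (bslash r s)) x y) = ho_mul (Theta x) (Theta y)"
  by (rule lin_form_ext)
     (simp add: lin_form_Theta lin_form_ho_mul lin_form_bilinext sum_theta_forests_bslash lin_form_fun_sum_list)

lemma lin_form_ho_comul:
  "lin_form F (ho_comul h) =
     lin_form (\<lambda>x. \<Sum>(a, b)\<leftarrow>unshuffles (children x). F (bvec (ONode a), bvec (ONode b))) h"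
  unfolding ho_comul_def lin_form_linext
  by (rule lin_form_cong)
     (simp add: lin_form_sum ocomp_def subcomp_def
       sum_Pow_nths[of "\<lambda>a b. F (bvec (ONode a), bvec (ONode b))"])

section \<open>Leading terms and bijectivity\<close>

lemma forest_prod_single: "forest_prod [c] ys = (c # ys) # forest_attach [c] ys"
  by (simp add: forest_prod_def map_idI)

lemma forest_attach_single_length: "w \<in> set (forest_attach [c] ys) \<Longrightarrow> length w = length ys"
  by (induction ys arbitrary: w rule: forest_induct) auto

lemma forest_attach_single_onodes:
  "w \<in> set (forest_attach [c] ys) \<Longrightarrow> sum_list (map onodes w) = onodes c + sum_list (map onodes ys)"
  by (induction ys arbitrary: w rule: forest_induct) fastforce+

lemma onodes_theta_forests: "z \<in> set (theta_forests t) \<Longrightarrow> sum_list (map onodes z) = nodes t"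
  by (induction t arbitrary: z)
     (auto simp: forest_prod_single onodes_psi dest!: forest_attach_single_onodes)

lemma length_children_psi: "length (children (psi t)) = ncomp t"
  by (induction t) (auto simp: obslash_def)

text \<open>The first term arises by placing every planted factor at the root. A factor grafted at
  another node does not add a child to the root, so all other terms have fewer.\<close>

lemma theta_forests_leading: "\<exists>R. theta_forests t = children (psi t) # R \<and> (\<forall>z\<in>set R. length z < ncomp t)"
proof (induction t)
  case (Node l r)
  then obtain R where R: "theta_forests r = children (psi r) # R" "\<forall>z\<in>set R. length z < ncomp r" by blast
  have "theta_forests (Node l r) = children (psi (Node l r)) #
      (forest_attach [psi l] (children (psi r)) @ concat (map (forest_prod [psi l]) R))"
    by (simp add: R(1) forest_prod_single obslash_def)
  moreover have "length z < ncomp (Node l r)"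
    if "z \<in> set (forest_attach [psi l] (children (psi r)) @ concat (map (forest_prod [psi l]) R))" for z
    using that R(2) length_children_psi[of r] by (auto simp: forest_prod_single dest!: forest_attach_single_length)
  ultimately show ?case by blast
qed simp

lemma psi_eq_iff: "psi s = psi t \<longleftrightarrow> s = t"
proof (induction s arbitrary: t)
  case Leaf
  show ?case by (cases t) (auto simp: obslash_def)
next
  case (Node l r)
  have "children x = children y \<longleftrightarrow> x = y" for x y by (cases x; cases y) auto
  then show ?case using Node by (cases t) (auto simp: obslash_def)
qed

lemma psi_surj: "\<exists>t. psi t = ONode ts"
proof (induction ts rule: forest_induct)
  case Nil
  show ?case by (rule exI[of _ Leaf]) simp
next
  case (Cons zs ts)
  then obtain l r where "psi l = ONode zs" "psi r = ONode ts" by blast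
  then show ?case by (intro exI[of _ "Node l r"]) (simp add: obslash_def)
qed

lemma coef_theta: "coef (theta t) x = (\<Sum>z\<leftarrow>theta_forests t. of_bool (ONode z = x))"
  by (simp add: theta_def coef_sum_list coef_bvec)

lemma coef_theta_psi:
  assumes "ncomp s \<le> ncomp t"
  shows "coef (theta s) (psi t) = of_bool (s = t)"
proof -
  obtain R where R: "theta_forests s = children (psi s) # R" "\<forall>z\<in>set R. length z < ncomp s"
    using theta_forests_leading by blast
  have "ONode z \<noteq> psi t" if "z \<in> set R" for z
    using that R(2) assms length_children_psi[of t] by (cases "psi t") force
  then have "map (\<lambda>z. of_bool (ONode z = psi t)) R = map (\<lambda>z. 0 :: 'a) R" by auto
  moreover have "ONode (children x) = x" for x by (cases x) simp
  ultimately show ?thesis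
    unfolding coef_theta R(1) by (simp add: psi_eq_iff del: map_eq_conv)
qed

text \<open>For a tree \<open>t\<close> in the support with the largest number of components, no
  other tree of the support contributes to the coefficient at \<open>psi t\<close>.\<close>

lemma Theta_eq_0:
  assumes "Theta v = 0"
  shows "v = 0"
proof (rule ccontr)
  assume "v \<noteq> 0"
  then have ne: "Poly_Mapping.keys v \<noteq> {}" by simp
  then obtain t where t: "t \<in> Poly_Mapping.keys v" and max: "ncomp t = Max (ncomp ` Poly_Mapping.keys v)"
    using Max_in[of "ncomp ` Poly_Mapping.keys v"] by fastforce
  have "0 = coef (Theta v) (psi t)" using assms by simp
  also have "\<dots> = lin_form (\<lambda>s. coef (theta s) (psi t)) v" by (simp add: Theta_def coef_linext)
  also have "\<dots> = lin_form (\<lambda>s. of_bool (s = t)) v"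
    by (rule lin_form_cong) (simp add: coef_theta_psi max)
  finally show False using t by (simp add: in_keys_iff)
qed

lemma Theta_add: "Theta (x + y) = Theta x + Theta y"
  and Theta_scale: "Theta (fscale c x) = fscale c (Theta x)"
  and Theta_diff: "Theta (x - y) = Theta x - Theta y"
  by (simp_all add: Theta_def linext_add linext_fscale linext_diff)

lemma Theta_inject: "Theta x = Theta y \<longleftrightarrow> x = y"
  using Theta_eq_0[of "x - y"] by (auto simp: Theta_diff)

text \<open>\<open>x\<close> is the leading term of \<open>theta t\<close> for
  \<open>psi t = x\<close>, and the other terms have fewer planted components. The degree is carried
  along so that the preimage is homogeneous.\<close>

lemma bvec_in_Theta_image:
  "bvec x \<in> Theta ` {v. \<forall>t. coef v t \<noteq> 0 \<longrightarrow> Suc (nodes t) = onodes x}"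
proof (induction "ocomp x" arbitrary: x rule: less_induct)
  case less
  let ?S = "{v. \<forall>t. coef v t \<noteq> 0 \<longrightarrow> Suc (nodes t) = onodes x} :: 'a ysym set"
  have S: "fvs.subspace ?S"
    by (rule fvs.subspaceI) (auto simp: lookup_add, metis add_0)
  have TS: "fvs.subspace (Theta ` ?S)"
  proof (rule fvs.subspaceI)
    show "0 \<in> Theta ` ?S" by (rule image_eqI[of _ _ 0]) (simp_all add: Theta_def)
    fix a b assume "a \<in> Theta ` ?S" "b \<in> Theta ` ?S"
    then obtain u v where "a = Theta u" "u \<in> ?S" "b = Theta v" "v \<in> ?S" by blast
    with fvs.subspace_add[OF S, of u v] show "a + b \<in> Theta ` ?S"
      by (intro image_eqI[of _ _ "u + v"]) (simp_all only: Theta_add)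
  next
    fix c a assume "a \<in> Theta ` ?S"
    then obtain u where "a = Theta u" "u \<in> ?S" by blast
    with fvs.subspace_scale[OF S, of u c] show "fscale c a \<in> Theta ` ?S"
      by (intro image_eqI[of _ _ "fscale c u"]) (simp_all only: Theta_scale)
  qed
  obtain t where t: "psi t = x" using psi_surj[of "children x"] by (cases x) auto
  obtain R where R: "theta_forests t = children (psi t) # R" "\<forall>z\<in>set R. length z < ncomp t"
    using theta_forests_leading by blast
  have "bvec (ONode z) \<in> Theta ` ?S" if z: "z \<in> set R" for z
  proof -
    have "ocomp (ONode z) < ocomp x"
      using R(2) z length_children_psi[of t] t by (simp add: ocomp_def)
    moreover have "onodes (ONode z) = onodes x"
      using onodes_theta_forests[of z t] z R(1) onodes_psi[of t] t by simp
    ultimately show ?thesis using less[of "ONode z"] by simp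
  qed
  then have sum: "(\<Sum>z\<leftarrow>R. bvec (ONode z)) \<in> Theta ` ?S"
    by (rule subspace_sum_list[OF TS])
  have theta: "theta t \<in> Theta ` ?S"
    by (rule image_eqI[of _ _ "fund t"]) (use onodes_psi[of t] t in \<open>auto simp: Theta_def linext_single coef_bvec\<close>)
  have "(bvec x :: 'a ho) = theta t - (\<Sum>z\<leftarrow>R. bvec (ONode z))"
    by (cases x) (simp add: theta_def R(1) t)
  then show ?case
    using fvs.subspace_diff[OF TS theta sum] by (simp only:)
qed

interpretation dual: vector_space "dual_scale :: 'k::field \<Rightarrow> 'k grdual \<Rightarrow> 'k grdual"
  by standard (simp_all flip: dual_coords_inject add: dual_coords_add dual_coords_scale
      fvs.scale_right_distrib fvs.scale_left_distrib)

interpretation dual_fvs: vector_space_pair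
  "dual_scale :: 'k::field \<Rightarrow> 'k grdual \<Rightarrow> 'k grdual" "fscale :: 'k \<Rightarrow> ('b \<Rightarrow>\<^sub>0 'k) \<Rightarrow> _"
  by standard

definition Psi :: "'k::field grdual \<Rightarrow> 'k ho" where
  "Psi \<phi> = Theta (dual_coords \<phi>)"

lemma linear_Psi: "Vector_Spaces.linear dual_scale fscale Psi"
  by (auto simp: Vector_Spaces.linear_iff Psi_def dual_coords_add dual_coords_scale Theta_add Theta_scale
      intro: dual.vector_space_axioms fvs.vector_space_axioms)

lemma subspace_range_Theta: "fvs.subspace (range (Theta :: 'k::field ysym \<Rightarrow> 'k ho))"
proof (rule fvs.subspaceI)
  show "0 \<in> range (Theta :: 'k ysym \<Rightarrow> 'k ho)" by (rule range_eqI[of _ _ 0]) (simp add: Theta_def)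
qed (auto simp flip: Theta_add Theta_scale)

lemma bij_Psi: "bij (Psi :: 'k::field grdual \<Rightarrow> 'k ho)"
proof (rule bijI)
  show "inj (Psi :: 'k grdual \<Rightarrow> 'k ho)"
    by (rule injI) (simp add: Psi_def Theta_inject dual_coords_inject)
  have "h \<in> range Theta" for h :: "'k ho"
  proof -
    have "bvec x \<in> range (Theta :: 'k ysym \<Rightarrow> 'k ho)" for x
      using bvec_in_Theta_image by blast
    then have "linext bvec h \<in> range Theta"
      unfolding linext_def
      by (intro fvs.subspace_sum fvs.subspace_scale subspace_range_Theta)
    then show ?thesis by simp
  qed
  then have "h \<in> range Psi" for h :: "'k ho"
    by (metis Psi_def dual_coords_dual_of rangeE rangeI)
  then show "surj (Psi :: 'k grdual \<Rightarrow> 'k ho)" by blast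
qed

lemma coef_theta_nodes: "coef (theta t) x \<noteq> 0 \<Longrightarrow> Suc (nodes t) = onodes x"
proof (rule ccontr)
  assume ne: "coef (theta t) x \<noteq> (0 :: 'a)" and "Suc (nodes t) \<noteq> onodes x"
  then have "ONode z \<noteq> x" if "z \<in> set (theta_forests t)" for z
    using onodes_theta_forests[OF that] by auto
  then have "map (\<lambda>z. of_bool (ONode z = x)) (theta_forests t) = map (\<lambda>z. 0 :: 'a) (theta_forests t)"
    by simp
  then have "coef (theta t) x = (0 :: 'a)"
    unfolding coef_theta by (simp only: sum_list_0)
  with ne show False ..
qed

lemma Psi_homog: "(Psi ` dual_homog n :: 'a::field ho set) = fvs.span {bvec x | x. onodes x = n + 1}"
proof
  show "(Psi ` dual_homog n :: 'a ho set) \<subseteq> fvs.span {bvec x | x. onodes x = n + 1}"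
  proof
    fix h :: "'a ho" assume "h \<in> Psi ` dual_homog n"
    then obtain \<phi> where h: "h = Psi \<phi>" and \<phi>: "\<phi> \<in> dual_homog n" by blast
    have "(theta t :: 'a ho) \<in> fvs.span {bvec x | x. onodes x = n + 1}" if "t \<in> Poly_Mapping.keys (dual_coords \<phi>)" for t
      unfolding theta_def
    proof (rule subspace_sum_list[OF fvs.subspace_span], rule fvs.span_base)
      fix z assume "z \<in> set (theta_forests t)"
      then have "onodes (ONode z) = n + 1"
        using onodes_theta_forests[of z t] \<phi> that by (simp add: dual_homog_iff in_keys_iff)
      then show "(bvec (ONode z) :: 'a ho) \<in> {bvec x | x. onodes x = n + 1}" by blast
    qed
    then show "h \<in> fvs.span {bvec x | x. onodes x = n + 1}"
      unfolding h Psi_def Theta_def by (rule linext_in_span)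
  qed
  show "fvs.span {bvec x | x. onodes x = n + 1} \<subseteq> (Psi ` dual_homog n :: 'a ho set)"
  proof (rule fvs.span_minimal)
    show "{bvec x | x. onodes x = n + 1} \<subseteq> (Psi ` dual_homog n :: 'a ho set)"
    proof clarify
      fix x assume "onodes x = n + 1"
      then obtain v where v: "(bvec x :: 'a ho) = Theta v" "\<forall>t. coef v t \<noteq> 0 \<longrightarrow> Suc (nodes t) = n + 1"
        using bvec_in_Theta_image[of x] by auto
      then show "(bvec x :: 'a ho) \<in> Psi ` dual_homog n"
        by (intro image_eqI[of _ _ "dual_of v"]) (simp_all add: Psi_def dual_homog_iff)
    qed
    show "fvs.subspace (Psi ` dual_homog n :: 'a ho set)"
    proof (rule dual_fvs.linear_subspace_image[OF linear_Psi])
      show "dual.subspace (dual_homog n :: 'a grdual set)"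
      proof (rule dual.subspaceI)
        fix \<phi> \<psi> :: "'a grdual" assume "\<phi> \<in> dual_homog n" "\<psi> \<in> dual_homog n"
        then show "\<phi> + \<psi> \<in> dual_homog n"
          by (simp add: dual_homog_def plus_grdual.rep_eq)
      qed (simp_all add: dual_homog_def zero_grdual.rep_eq dual_scale.rep_eq)
    qed
  qed
qed

text \<open>The vectors of the graded algebra at which to evaluate in order to read off a coefficient of \<open>Psi\<close>.\<close>

definition Xi :: "otree \<Rightarrow> 'k::field gr" where
  "Xi x = gr_of (\<Sum>t\<in>{t. nodes t = onodes x - 1}. Poly_Mapping.single t (coef (theta t) x))"

lemma coef_gr_coords_Xi: "coef (gr_coords (Xi x)) t = coef (theta t) x"
proof -
  have "coef (gr_coords (Xi x)) t = (\<Sum>s\<in>{t. nodes t = onodes x - 1}. if s = t then coef (theta t) x else 0)"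
    unfolding Xi_def gr_coords_gr_of coef_sum by (rule sum.cong) (auto simp: lookup_single when_def)
  also have "\<dots> = (if nodes t = onodes x - 1 then coef (theta t) x else 0)"
    using finite_nodes by simp
  also have "\<dots> = coef (theta t) x"
    by (cases "coef (theta t) x = (0 :: 'a)") (use coef_theta_nodes[of t x] in force)+
  finally show ?thesis .
qed

text \<open>\<open>dual_comul\<close> can only be examined by evaluation at vectors of the graded
  algebra, and this turns coefficients into such evaluations. The vector \<open>Xi x\<close> exists
  because \<open>x\<close> occurs in \<open>theta t\<close> only for the finitely many
  \<open>t\<close> of its own degree.\<close>

lemma coef_Psi: "coef (Psi \<phi>) x = dual_app \<phi> (Xi x)"
  by (simp add: Psi_def Theta_def coef_linext dual_app_eq lin_form_coef_sym[of "dual_coords \<phi>"]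
      coef_gr_coords_Xi cong: lin_form_cong)

text \<open>At a pair of trees, the left side unshuffles the components of the index and then
  multiplies out, while the right side multiplies out and then unshuffles the children of the root.
  These agree by \<open>sum_theta_forests_pbt_unshuffles\<close>.\<close>

lemma Psi_comul: "tensor_eq fscale fscale (tensor_map Psi Psi (dual_comul \<phi>)) (ho_comul (Psi \<phi>))"
proof (rule tensor_eqI)
  fix x y :: otree
  let ?f = "\<lambda>(a, b). coef a x * coef b y :: 'a"
  have "lin_form ?f (tensor_map Psi Psi (dual_comul \<phi>)) =
      tensor_pair (\<lambda>\<alpha>. dual_app \<alpha> (Xi x)) (\<lambda>\<beta>. dual_app \<beta> (Xi y)) (dual_comul \<phi>)"
    by (simp add: tensor_map_def lin_form_linext tensor_pair_eq_lin_form case_prod_unfold coef_Psi)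
  also have "\<dots> = lin_form (\<lambda>t. \<Sum>(r, s)\<leftarrow>pbt_unshuffles t. \<Sum>a\<leftarrow>theta_forests r. \<Sum>b\<leftarrow>theta_forests s.
      of_bool (ONode a = x) * of_bool (ONode b = y)) (dual_coords \<phi>)"
    unfolding tensor_pair_dual_comul coef_gr_coords_Xi coef_theta
    by (simp add: sum_list_const_mult sum_list_mult_const)
  also have "\<dots> = lin_form ?f (ho_comul (Psi \<phi>))"
    unfolding sum_theta_forests_pbt_unshuffles[symmetric]
    by (simp add: lin_form_ho_comul Psi_def lin_form_Theta coef_bvec)
  finally show "lin_form ?f (tensor_map Psi Psi (dual_comul \<phi>)) = lin_form ?f (ho_comul (Psi \<phi>))" .
qed

lemma theta_Leaf: "theta Leaf = bvec (ONode [])"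
  by (simp add: theta_def)

lemma coef_theta_unit: "coef (theta t) (ONode []) = of_bool (t = Leaf)"
proof (cases "t = Leaf")
  case False
  then have "coef (theta t) (ONode []) = (0 :: 'a)"
    using coef_theta_nodes[of t "ONode []", where 'a = 'a] by (cases t) auto
  with False show ?thesis by simp
qed (simp add: theta_Leaf coef_bvec)

theorem graded_hopf_iso_Psi: "graded_hopf_iso gr_ysym_dual grossman_larson Psi"
  unfolding graded_hopf_iso_def gr_ysym_dual_def grossman_larson_def hopf.simps
proof (intro conjI allI)
  show "Vector_Spaces.linear dual_scale fscale Psi" by (rule linear_Psi)
  show "bij Psi" by (rule bij_Psi)
  show "Psi (dual_mul \<phi> \<psi>) = ho_mul (Psi \<phi>) (Psi \<psi>)" for \<phi> \<psi>
    by (simp add: Psi_def dual_coords_dual_mul Theta_mul)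
  show "Psi dual_unit = bvec (ONode [])"
    by (simp add: Psi_def dual_unit_eq Theta_def linext_single theta_Leaf)
  show "tensor_eq fscale fscale (tensor_map Psi Psi (dual_comul \<phi>)) (ho_comul (Psi \<phi>))" for \<phi>
    by (rule Psi_comul)
  show "coef (Psi \<phi>) (ONode []) = dual_counit \<phi>" for \<phi>
    by (simp add: Psi_def Theta_def coef_linext coef_theta_unit dual_counit_eq)
  show "Psi ` dual_homog n = fvs.span {bvec x | x. onodes x = n + 1}" for n
    by (rule Psi_homog)
qed

lemma Psi_irreducible: "bs_irreducible t \<Longrightarrow> Psi (dual_mono t) = bvec (psi t)"
  by (auto simp: bs_irreducible_iff Psi_def Theta_def linext_single theta_def forest_prod_single
      obslash_def)

section \<open>Uniqueness of the isomorphism\<close>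

lemma dual_mono_Node: "dual_mono (Node l r) = dual_mul (dual_mono (Node l Leaf)) (dual_mono r)"
  by (simp flip: dual_coords_inject add: dual_coords_dual_mul bilinext_def linext_single)

lemma dual_mono_expansion:
  "\<phi> = (\<Sum>t\<in>Poly_Mapping.keys (dual_coords \<phi>). dual_scale (coef (dual_coords \<phi>) t) (dual_mono t))"
proof -
  have "dual_coords (\<Sum>i\<in>I. X i) = (\<Sum>i\<in>I. dual_coords (X i))" for I and X :: "pbt \<Rightarrow> 'a grdual"
  proof (induction I rule: infinite_finite_induct)
    case (insert i I)
    then show ?case by (simp add: dual_coords_add)
  qed (use dual_coords_add[of 0 0] in simp_all)
  then show ?thesis
    using linext_bvec[of "dual_coords \<phi>"] unfolding linext_def by (simp flip: dual_coords_inject add: dual_coords_scale)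
qed

text \<open>A unital algebra map is fixed by its values on generators: by
  \<open>dual_mono_Node\<close> every dual basis vector is a product of irreducible ones, and these
  products span.\<close>

lemma graded_hopf_iso_unique:
  assumes iso: "graded_hopf_iso gr_ysym_dual grossman_larson f" "graded_hopf_iso gr_ysym_dual grossman_larson g"
    and irr: "\<And>t. bs_irreducible t \<Longrightarrow> f (dual_mono t) = g (dual_mono t)"
  shows "f = g"
proof -
  have lin: "Vector_Spaces.linear dual_scale fscale f" "Vector_Spaces.linear dual_scale fscale g"
    and mul: "f (dual_mul \<phi> \<psi>) = ho_mul (f \<phi>) (f \<psi>)" "g (dual_mul \<phi> \<psi>) = ho_mul (g \<phi>) (g \<psi>)"
    and unit: "f dual_unit = g dual_unit" for \<phi> \<psi>
    using iso by (auto simp: graded_hopf_iso_def gr_ysym_dual_def grossman_larson_def)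
  have "f (dual_mono t) = g (dual_mono t)" for t
  proof (induction t)
    case Leaf
    show ?case using unit by (simp add: dual_unit_eq)
  next
    case (Node l r)
    have "f (dual_mono (Node l Leaf)) = g (dual_mono (Node l Leaf))"
      by (rule irr) (auto simp: bs_irreducible_iff)
    then show ?case
      unfolding dual_mono_Node[of l r] mul by (simp only: Node.IH(2))
  qed
  then have "f \<phi> = g \<phi>" for \<phi>
    by (subst (1 2) dual_mono_expansion[of \<phi>])
       (simp add: dual_fvs.linear_sum[OF lin(1)] dual_fvs.linear_sum[OF lin(2)]
         dual_fvs.linear_scale[OF lin(1)] dual_fvs.linear_scale[OF lin(2)])
  then show ?thesis by (rule ext)
qed

theorem theorem2p5:
  shows "\<exists>!\<Psi> :: 'k::field grdual \<Rightarrow> 'k ho.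
    graded_hopf_iso gr_ysym_dual grossman_larson \<Psi> \<and>
    (\<forall>t. bs_irreducible t \<longrightarrow> \<Psi> (dual_mono t) = Poly_Mapping.single (psi t) 1)"
proof (rule ex1I[of _ Psi])
  show "graded_hopf_iso gr_ysym_dual grossman_larson (Psi :: 'k grdual \<Rightarrow> 'k ho) \<and>
      (\<forall>t. bs_irreducible t \<longrightarrow> Psi (dual_mono t) = (Poly_Mapping.single (psi t) 1 :: 'k ho))"
    using graded_hopf_iso_Psi Psi_irreducible by blast
  fix \<Psi> :: "'k grdual \<Rightarrow> 'k ho"
  assume "graded_hopf_iso gr_ysym_dual grossman_larson \<Psi> \<and>
    (\<forall>t. bs_irreducible t \<longrightarrow> \<Psi> (dual_mono t) = Poly_Mapping.single (psi t) 1)"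
  then show "\<Psi> = Psi"
    using graded_hopf_iso_unique graded_hopf_iso_Psi Psi_irreducible by metis
qed

end
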